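(* Let $G$ be a finite group acting on a measurable space $(Y,\mathcal{Y})$, such that $\chi_\pi$ is real-valued for every $[\pi]\in\widehat G$. Let $(Z_1,Z_2)$ be a correlated (generalized) Volterra process with respect to an isonormal Gaussian process $X$ on $L^2_{\mathbb{R}}(d\tau)$, with parameter $\rho\in[0,1]$ and kernels $\phi_1,\phi_2$, and assume $(Z_1,Z_2)$ has a $G$-invariant law. Let $\mu$ be a $G$-invariant, $\sigma$-finite positive measure on $(Y,\mathcal{Y})$ such that for every $\omega\in\Omega$ and $g\in G$, $y\mapsto Z_i(\omega,g\cdot y)$ is in $L^2(\mu)$ and $(g,y)\mapsto Z_i(\omega,g\cdot y)$ is in $L^2(dg\times\mu(dy))$ ($i=1,2$), and suppose $\mathbf{E}\int_Y Z_1(y)^2\mu(dy)=\int_Y\int_T\phi_1(y,t)^2\mu(dy)\tau(dt)=\int_Y R(y,y)\mu(dy)<+\infty$. Then: 1. $\int_Y\int_Y R(x,y)^2\mu(dx)\mu(dy)<+\infty$ and $\int_Y\int_Y R^{\pi\otimes\pi}(x,y)^2\mu(dx)\mu(dy)<+\infty$ for every $[\pi]\in\widehat G$. 2. The random variables $\int_Y Z_1^\pi(y)Z_2^\pi(y)\mu(dy)$, $[\pi]\in\widehat G$, are stochastically independent. 3. For every $[\pi]\in\widehat G$, $(Z_1^\pi,Z_2^\pi)$ is a correlated Volterra process with parameter $\rho$. 4. The following are equivalent: (i) for every $[\pi],[\sigma]\in\widehat G$, $\int_Y Z_1^\pi(y)Z_2^\pi(y)\mu(dy)$ and $\int_Y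 Z_1^\sigma(y)Z_2^\sigma(y)\mu(dy)$ have the same law; (ii) for every $[\pi]\in\widehat G$ and every $n\ge1$, $K(n,\rho)\int_Y[R^{\pi\otimes\pi}\otimes_{(n)}R^{\pi\otimes\pi}](y,y)\mu(dy)=\frac{K(n,\rho)}{|\widehat G|}\int_Y[R\otimes_{(n)}R](y,y)\mu(dy)$; (iii) for every $[\pi],[\sigma]\in\widehat G$ and every $n\ge1$, $K(n,\rho)\int_Y[R^{\pi\otimes\pi}\otimes_{(n)}R^{\pi\otimes\pi}](y,y)\mu(dy)=K(n,\rho)\int_Y[R^{\sigma\otimes\sigma}\otimes_{(n)}R^{\sigma\otimes\sigma}](y,y)\mu(dy)$.
   Context: $\widehat G$ is the (finite) set of equivalence classes $[\pi]$ of irreducible complex representations of $G$, $d_\pi$ their dimension, $\chi_\pi$ their character, $|\widehat G|$ its cardinality; the action satisfies $(gh)\cdot y=g\cdot(h\cdot y)$, and $\mu$ is $G$-invariant if $\int f(y)\mu(dy)=\int f(g\cdot y)\mu(dy)$ for all $f\in L^1(\mu)$, $g\in G$; $dg$ is normalized counting measure on $G$. $(T,\mathcal{T},\tau)$ is a measure space with $\tau$ positive, $\sigma$-finite and non-atomic. An isonormal Gaussian process on $L^2_{\mathbb{R}}(d\tau)$ is a centered Gaussian family $\{X(f):f\in L^2_{\mathbb{R}}(d\tau)\}$ on $(\Omega,\mathcal{F},\mathbf{P})$ with $\mathbf{E}[X(f_1)X(f_2)]=\int_T f_1f_2\,d\tau$. A correlated Volterra process with parameter $\rho$ is a two-dimensional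 Gaussian process $(Z_1,Z_2)$ indexed by $Y$ for which there are $\mathcal{Y}\otimes\mathcal{T}$-measurable $\phi_i:Y\times T\to\mathbb{R}$ with $\phi_i(y,\cdot)\in L^2_{\mathbb{R}}(d\tau)$, $Z_i(y)=X(\phi_i(y,\cdot))$ a.s., and, writing $R_{i,j}(y_1,y_2)=\mathbf{E}[Z_i(y_1)Z_j(y_2)]$: $R_{1,1}=R_{2,2}=:R$ and $R_{1,2}=R_{2,1}=\rho R$. $G$-invariant law means $R_{i,j}(g\cdot y_1,g\cdot y_2)=R_{i,j}(y_1,y_2)$ for all $g,y_1,y_2,i,j$. Notation: $Z_i^\pi(y)=\frac{d_\pi}{|G|}\sum_{g\in G}\chi_\pi(g)Z_i(g^{-1}\cdot y)$; $R^{\pi\otimes\pi}(y_1,y_2)=\frac{d_\pi^2}{|G|^2}\sum_{g_1,g_2\in G}\chi_\pi(g_1)\chi_\pi(g_2)R(g_1^{-1}\cdot y_1,g_2^{-1}\cdot y_2)$. For real $\Phi,\Psi\in L^2(\mu\times\mu)$: $\Phi\otimes_{(1)}\Phi=\Phi$; $[\Phi\otimes_{(2)}\Psi](y_1,y_2)=\int_Y\Phi(y_1,x)\Psi(y_2,x)\mu(dx)$; for $p\ge3$, $\Phi\otimes_{(p)}\Phi=[\Phi\otimes_{(p-1)}\Phi]\otimes_{(2)}\Phi$. Constants: $K(1,\rho)=2\rho$; for even $n\ge2$, $K(n,\rho)=2\sum_{j=0}^{n/2-1}\binom{n-1}{2j}\rho^{2j}+2\sum_{j=0}^{n/2-1}\binom{n-1}{2j+1}\rho^{2j+2}$;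 for odd $n\ge3$, $K(n,\rho)=2\sum_{j=0}^{(n-1)/2}\binom{n-1}{2j}\rho^{2j+1}+2\sum_{j=0}^{(n-3)/2}\binom{n-1}{2j+1}\rho^{2j+1}$.
   Formalization: The formal statement additionally assumes that (y,ω) ↦ Z_i(y)(ω) is jointly measurable on Y×Ω for i=1,2; without this the paths may be altered on a null set of ω for each y, and the equivalence in item 4 can fail. *)

theory Defs
  imports "Jordan_Normal_Form.Determinant" "HOL-Probability.Probability"
begin

definition mtrace :: "complex mat \<Rightarrow> complex" where
  "mtrace A = (\<Sum>i<dim_row A. A $$ (i, i))"

definition is_rep :: "('g, 'b) monoid_scheme \<Rightarrow> nat \<Rightarrow> ('g \<Rightarrow> complex mat) \<Rightarrow> bool" where
  "is_rep G d \<pi> \<longleftrightarrow> d > 0 \<and> (\<forall>g\<in>carrier G. \<pi> g \<in> carrier_mat d d)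
     \<and> (\<forall>g\<in>carrier G. \<forall>h\<in>carrier G. \<pi> (g \<otimes>\<^bsub>G\<^esub> h) = \<pi> g * \<pi> h)
     \<and> \<pi> \<one>\<^bsub>G\<^esub> = 1\<^sub>m d"

definition is_subspace :: "nat \<Rightarrow> complex Matrix.vec set \<Rightarrow> bool" where
  "is_subspace d W \<longleftrightarrow> W \<subseteq> carrier_vec d \<and> 0\<^sub>v d \<in> W
     \<and> (\<forall>v\<in>W. \<forall>w\<in>W. v + w \<in> W) \<and> (\<forall>c. \<forall>v\<in>W. c \<cdot>\<^sub>v v \<in> W)"

definition is_irrep :: "('g, 'b) monoid_scheme \<Rightarrow> nat \<Rightarrow> ('g \<Rightarrow> complex mat) \<Rightarrow> bool" where
  "is_irrep G d \<pi> \<longleftrightarrow> is_rep G d \<pi> \<and>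
     \<not> (\<exists>W. is_subspace d W \<and> W \<noteq> {0\<^sub>v d} \<and> W \<noteq> carrier_vec d
            \<and> (\<forall>g\<in>carrier G. \<forall>w\<in>W. \<pi> g *\<^sub>v w \<in> W))"

definition irreps :: "('g, 'b) monoid_scheme \<Rightarrow> (nat \<times> ('g \<Rightarrow> complex mat)) set" where
  "irreps G = {(d, \<pi>). is_irrep G d \<pi>}"

definition rep_equiv :: "('g, 'b) monoid_scheme \<Rightarrow>
    ((nat \<times> ('g \<Rightarrow> complex mat)) \<times> (nat \<times> ('g \<Rightarrow> complex mat))) set" where
  "rep_equiv G = {((d, \<pi>), (d', \<pi>')). (d, \<pi>) \<in> irreps G \<and> (d', \<pi>') \<in> irreps G \<and> d = d' \<and>
      (\<exists>P\<in>carrier_mat d d. Determinant.det P \<noteq> 0 \<and> (\<forall>g\<in>carrier G. P * \<pi> g = \<pi>' g * P))}"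

definition dual_classes :: "('g, 'b) monoid_scheme \<Rightarrow> (nat \<times> ('g \<Rightarrow> complex mat)) set set" where
  "dual_classes G = irreps G // rep_equiv G"

definition class_dim :: "(nat \<times> ('g \<Rightarrow> complex mat)) set \<Rightarrow> nat" where
  "class_dim c = fst (SOME p. p \<in> c)"

definition class_char :: "(nat \<times> ('g \<Rightarrow> complex mat)) set \<Rightarrow> 'g \<Rightarrow> complex" where
  "class_char c g = mtrace (snd (SOME p. p \<in> c) g)"

definition measurable_action :: "('g, 'b) monoid_scheme \<Rightarrow> 'y measure \<Rightarrow> ('g \<Rightarrow> 'y \<Rightarrow> 'y) \<Rightarrow> bool" where
  "measurable_action G Y act \<longleftrightarrow>
     (\<forall>g\<in>carrier G. act g \<in> Y \<rightarrow>\<^sub>M Y)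
     \<and> (\<forall>g\<in>carrier G. \<forall>h\<in>carrier G. \<forall>y\<in>space Y. act (g \<otimes>\<^bsub>G\<^esub> h) y = act g (act h y))
     \<and> (\<forall>y\<in>space Y. act \<one>\<^bsub>G\<^esub> y = y)"

text \<open>Isotypic components \<open>Z^\<pi>(y) = d_\<pi>/|G| \<Sum>_g \<chi>_\<pi>(g) Z(g\<^sup>-\<^sup>1 y)\<close>
  (characters are assumed real-valued, so we take real parts).\<close>
definition iso_comp :: "('g, 'b) monoid_scheme \<Rightarrow> ('g \<Rightarrow> 'y \<Rightarrow> 'y) \<Rightarrow>
     (nat \<times> ('g \<Rightarrow> complex mat)) set \<Rightarrow> ('y \<Rightarrow> 'w \<Rightarrow> real) \<Rightarrow> 'y \<Rightarrow> 'w \<Rightarrow> real" where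
  "iso_comp G act c Z y \<omega> = real (class_dim c) / real (card (carrier G)) *
     (\<Sum>g\<in>carrier G. Re (class_char c g) * Z (act (inv\<^bsub>G\<^esub> g) y) \<omega>)"

definition kernel_comp :: "('g, 'b) monoid_scheme \<Rightarrow> ('g \<Rightarrow> 'y \<Rightarrow> 'y) \<Rightarrow>
     (nat \<times> ('g \<Rightarrow> complex mat)) set \<Rightarrow> ('y \<Rightarrow> 'y \<Rightarrow> real) \<Rightarrow> 'y \<Rightarrow> 'y \<Rightarrow> real" where
  "kernel_comp G act c R y1 y2 = (real (class_dim c))\<^sup>2 / (real (card (carrier G)))\<^sup>2 *
     (\<Sum>g1\<in>carrier G. \<Sum>g2\<in>carrier G. Re (class_char c g1) * Re (class_char c g2) *
        R (act (inv\<^bsub>G\<^esub> g1) y1) (act (inv\<^bsub>G\<^esub> g2) y2))"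

definition L2R :: "'t measure \<Rightarrow> ('t \<Rightarrow> real) set" where
  "L2R tau = {f. f \<in> borel_measurable tau \<and> integrable tau (\<lambda>t. (f t)\<^sup>2)}"

definition is_atom :: "'t measure \<Rightarrow> 't set \<Rightarrow> bool" where
  "is_atom tau A \<longleftrightarrow> A \<in> sets tau \<and> emeasure tau A > 0 \<and>
     (\<forall>B\<in>sets tau. B \<subseteq> A \<longrightarrow> emeasure tau B = 0 \<or> emeasure tau B = emeasure tau A)"

definition nonatomic :: "'t measure \<Rightarrow> bool" where
  "nonatomic tau \<longleftrightarrow> \<not> (\<exists>A. is_atom tau A)"

definition centered_normal :: "'w measure \<Rightarrow> ('w \<Rightarrow> real) \<Rightarrow> bool" where
  "centered_normal M V \<longleftrightarrow> V \<in> borel_measurable M \<and>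
     (\<exists>\<sigma>\<ge>0. distr M borel V =
        (if \<sigma> = 0 then return borel 0 else density lborel (normal_density 0 \<sigma>)))"

definition isonormal :: "'w measure \<Rightarrow> 't measure \<Rightarrow> (('t \<Rightarrow> real) \<Rightarrow> 'w \<Rightarrow> real) \<Rightarrow> bool" where
  "isonormal M tau X \<longleftrightarrow>
     (\<forall>f\<in>L2R tau. X f \<in> borel_measurable M)
     \<and> (\<forall>I a. finite I \<and> I \<subseteq> L2R tau \<longrightarrow>
          centered_normal M (\<lambda>\<omega>. \<Sum>f\<in>I. a f * X f \<omega>))
     \<and> (\<forall>f1\<in>L2R tau. \<forall>f2\<in>L2R tau.
          prob_space.expectation M (\<lambda>\<omega>. X f1 \<omega> * X f2 \<omega>) = (\<integral>t. f1 t * f2 t \<partial>tau))"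

definition cov :: "'w measure \<Rightarrow> ('y \<Rightarrow> 'w \<Rightarrow> real) \<Rightarrow> ('y \<Rightarrow> 'w \<Rightarrow> real) \<Rightarrow> 'y \<Rightarrow> 'y \<Rightarrow> real" where
  "cov M Z1 Z2 y1 y2 = prob_space.expectation M (\<lambda>\<omega>. Z1 y1 \<omega> * Z2 y2 \<omega>)"

definition corr_volterra_kernels :: "'w measure \<Rightarrow> 't measure \<Rightarrow> (('t \<Rightarrow> real) \<Rightarrow> 'w \<Rightarrow> real) \<Rightarrow>
    'y measure \<Rightarrow> ('y \<Rightarrow> 'w \<Rightarrow> real) \<Rightarrow> ('y \<Rightarrow> 'w \<Rightarrow> real) \<Rightarrow> real \<Rightarrow>
    ('y \<Rightarrow> 't \<Rightarrow> real) \<Rightarrow> ('y \<Rightarrow> 't \<Rightarrow> real) \<Rightarrow> bool" where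
  "corr_volterra_kernels M tau X Y Z1 Z2 \<rho> \<phi>1 \<phi>2 \<longleftrightarrow>
     (\<lambda>(y, t). \<phi>1 y t) \<in> borel_measurable (Y \<Otimes>\<^sub>M tau)
     \<and> (\<lambda>(y, t). \<phi>2 y t) \<in> borel_measurable (Y \<Otimes>\<^sub>M tau)
     \<and> (\<forall>y\<in>space Y. \<phi>1 y \<in> L2R tau \<and> \<phi>2 y \<in> L2R tau)
     \<and> (\<forall>y\<in>space Y. Z1 y \<in> borel_measurable M \<and> Z2 y \<in> borel_measurable M)
     \<and> (\<forall>y\<in>space Y. (AE \<omega> in M. Z1 y \<omega> = X (\<phi>1 y) \<omega>) \<and> (AE \<omega> in M. Z2 y \<omega> = X (\<phi>2 y) \<omega>))
     \<and> (\<forall>y1\<in>space Y. \<forall>y2\<in>space Y.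
          cov M Z2 Z2 y1 y2 = cov M Z1 Z1 y1 y2
          \<and> cov M Z1 Z2 y1 y2 = \<rho> * cov M Z1 Z1 y1 y2
          \<and> cov M Z2 Z1 y1 y2 = \<rho> * cov M Z1 Z1 y1 y2)"

definition corr_volterra :: "'w measure \<Rightarrow> 't measure \<Rightarrow> (('t \<Rightarrow> real) \<Rightarrow> 'w \<Rightarrow> real) \<Rightarrow>
    'y measure \<Rightarrow> ('y \<Rightarrow> 'w \<Rightarrow> real) \<Rightarrow> ('y \<Rightarrow> 'w \<Rightarrow> real) \<Rightarrow> real \<Rightarrow> bool" where
  "corr_volterra M tau X Y Z1 Z2 \<rho> \<longleftrightarrow> (\<exists>\<phi>1 \<phi>2. corr_volterra_kernels M tau X Y Z1 Z2 \<rho> \<phi>1 \<phi>2)"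

definition invariant_law :: "('g, 'b) monoid_scheme \<Rightarrow> 'y measure \<Rightarrow> ('g \<Rightarrow> 'y \<Rightarrow> 'y) \<Rightarrow>
    'w measure \<Rightarrow> ('y \<Rightarrow> 'w \<Rightarrow> real) \<Rightarrow> ('y \<Rightarrow> 'w \<Rightarrow> real) \<Rightarrow> bool" where
  "invariant_law G Y act M Z1 Z2 \<longleftrightarrow>
     (\<forall>g\<in>carrier G. \<forall>y1\<in>space Y. \<forall>y2\<in>space Y. \<forall>U\<in>{Z1, Z2}. \<forall>V\<in>{Z1, Z2}.
        cov M U V (act g y1) (act g y2) = cov M U V y1 y2)"

definition invariant_measure :: "('g, 'b) monoid_scheme \<Rightarrow> ('g \<Rightarrow> 'y \<Rightarrow> 'y) \<Rightarrow> 'y measure \<Rightarrow> bool" where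
  "invariant_measure G act mu \<longleftrightarrow>
     (\<forall>g\<in>carrier G. \<forall>f::'y \<Rightarrow> real. integrable mu f \<longrightarrow>
        (\<integral>y. f y \<partial>mu) = (\<integral>y. f (act g y) \<partial>mu))"

definition contr2 :: "'y measure \<Rightarrow> ('y \<Rightarrow> 'y \<Rightarrow> real) \<Rightarrow> ('y \<Rightarrow> 'y \<Rightarrow> real) \<Rightarrow> 'y \<Rightarrow> 'y \<Rightarrow> real" where
  "contr2 mu \<Phi> \<Psi> y1 y2 = (\<integral>x. \<Phi> y1 x * \<Psi> y2 x \<partial>mu)"

text \<open>\<open>contr mu n \<Phi>\<close> is \<open>\<Phi> \<otimes>_(n) \<Phi>\<close> for n \<ge> 1 (the value at n = 0 is irrelevant).\<close>
fun contr :: "'y measure \<Rightarrow> nat \<Rightarrow> ('y \<Rightarrow> 'y \<Rightarrow> real) \<Rightarrow> 'y \<Rightarrow> 'y \<Rightarrow> real" where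
  "contr mu 0 \<Phi> = \<Phi>"
| "contr mu (Suc 0) \<Phi> = \<Phi>"
| "contr mu (Suc (Suc n)) \<Phi> = contr2 mu (contr mu (Suc n) \<Phi>) \<Phi>"

definition Kconst :: "nat \<Rightarrow> real \<Rightarrow> real" where
  "Kconst n \<rho> =
    (if n = 1 then 2 * \<rho>
     else if even n then
       2 * (\<Sum>j<n div 2. real ((n - 1) choose (2 * j)) * \<rho> ^ (2 * j))
       + 2 * (\<Sum>j<n div 2. real ((n - 1) choose (2 * j + 1)) * \<rho> ^ (2 * j + 2))
     else
       2 * (\<Sum>j\<le>(n - 1) div 2. real ((n - 1) choose (2 * j)) * \<rho> ^ (2 * j + 1))
       + 2 * (\<Sum>j<(n - 1) div 2. real ((n - 1) choose (2 * j + 1)) * \<rho> ^ (2 * j + 1)))"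

end

theory Submission
  imports Defs "HOL-Library.Function_Algebras" "HOL-Complex_Analysis.Complex_Analysis"
    "Jordan_Normal_Form.Spectral_Radius"
begin

text \<open>By the orthogonality relations the isotypic components \<open>Z\<^sup>\<pi>\<close> are mutually uncorrelated, sum up to
  \<open>Z\<close>, and are orthogonal in \<open>L\<^sup>2(\<mu>)\<close> along every path. By polarization \<open>\<integral> Z\<^sub>1\<^sup>\<pi> Z\<^sub>2\<^sup>\<pi> d\<mu>\<close> is a difference of
  squared \<open>L\<^sup>2(\<mu>)\<close> norms of uncorrelated Gaussian processes with covariances \<open>(1 \<plusminus> \<rho>)/2 R\<^sup>\<pi>\<close>. For a linear
  combination \<open>Q\<close> of such squared norms, Gaussian integration by parts gives a linear recursion for the moments,
  i.e. \<open>F' = F P\<close> for the exponential moment series \<open>F\<close>, where the coefficients of \<open>P\<close> are the traces of the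
  iterated contractions (times \<open>K(n, \<rho>)\<close>). Since \<open>Q\<close> has exponential moments, \<open>F\<close> determines the
  law. Hence equality of laws amounts to equality of the traces, and additivity of \<open>P\<close> makes the moment
  generating functions multiplicative, which is independence.\<close>

section \<open>Characters of a finite group\<close>

text \<open>Origin of the constants: K(n, \<rho>) = (1 + \<rho>)^n + (-1)^n (1 - \<rho>)^n. After
  polarization the two squared norms have weights +1 and -1 and covariances scaled by (1 + \<rho>)/2
  and (1 - \<rho>)/2. The n-th trace enters the recursion with the factor 2^(n-1), which against
  2^(-n) leaves K(n, \<rho>)/2. The traces are plain integrals of iterated kernels, bounded through
  Cauchy-Schwarz by powers of the integral of R(y, y), and the equation F' = F P takes the place of
  an eigenvalue expansion of the covariance operator. P is the derivative of the cumulant generating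
  function, hence the additivity over uncorrelated parts. That the components sum up to Z is the
  delicate algebraic point: orthogonality alone gives Bessel's inequality, and equality needs
  completeness of the characters. The average in (ii) needs in turn that the traces of the
  components add up to the trace of R for each n; this is read off from the same uniqueness of
  P.\<close>

lemma mat_mult_entry:
  assumes "A \<in> carrier_mat n m" "B \<in> carrier_mat m p" "i < n" "j < p"
  shows "(A * B) $$ (i, j) = (\<Sum>k<m. A $$ (i, k) * B $$ (k, j))"
  using assms by (auto simp: scalar_prod_def lessThan_atLeast0 intro!: sum.cong)

lemma mat_vec_entry:
  assumes "A \<in> carrier_mat n m" "v \<in> carrier_vec m" "i < n"
  shows "vec_index (A *\<^sub>v v) i = (\<Sum>k<m. A $$ (i, k) * vec_index v k)"
  using assms by (auto simp: scalar_prod_def lessThan_atLeast0 intro!: sum.cong)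

lemma mtrace_mult_comm:
  assumes A: "A \<in> carrier_mat n m" and B: "B \<in> carrier_mat m n"
  shows "mtrace (A * B) = mtrace (B * A)"
proof -
  have "mtrace (A * B) = (\<Sum>i<n. \<Sum>k<m. A $$ (i, k) * B $$ (k, i))"
    using A B mat_mult_entry[OF A B] by (simp add: mtrace_def)
  also have "\<dots> = (\<Sum>k<m. \<Sum>i<n. B $$ (k, i) * A $$ (i, k))"
    by (subst sum.swap) (simp add: mult.commute)
  also have "\<dots> = mtrace (B * A)"
    using A B mat_mult_entry[OF B A] by (simp add: mtrace_def)
  finally show ?thesis .
qed

lemma mtrace_one: "mtrace (1\<^sub>m d) = of_nat d"
  by (simp add: mtrace_def)

lemma mat_inverse_exists:
  fixes P :: "'a::field mat"
  assumes P: "P \<in> carrier_mat d d" "Determinant.det P \<noteq> 0"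
  obtains Q where "Q \<in> carrier_mat d d" "Q * P = 1\<^sub>m d" "P * Q = 1\<^sub>m d"
  using det_non_zero_imp_unit[OF P, of "undefined"] that
  unfolding Units_def ring_mat_def by auto

lemma mtrace_similar:
  assumes P: "P \<in> carrier_mat d d" "Determinant.det P \<noteq> 0"
    and A: "A \<in> carrier_mat d d" and B: "B \<in> carrier_mat d d" and eq: "P * A = B * P"
  shows "mtrace A = mtrace B"
proof -
  obtain Q where Q: "Q \<in> carrier_mat d d" "Q * P = 1\<^sub>m d" "P * Q = 1\<^sub>m d"
    using mat_inverse_exists[OF P] by blast
  have "A = (Q * P) * A" using A Q by simp
  also have "\<dots> = Q * (B * P)" unfolding eq[symmetric] by (rule assoc_mult_mat[OF Q(1) P(1) A])
  finally have "mtrace A = mtrace ((B * P) * Q)"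
    using mtrace_mult_comm[of Q d d "B * P"] P B Q by auto
  also have "(B * P) * Q = B" using P B Q by (simp add: assoc_mult_mat[of B d d P d Q d])
  finally show ?thesis .
qed

lemma mat_eq_zeroI:
  fixes A :: "'a::field mat"
  assumes A: "A \<in> carrier_mat n m" and "\<And>v. v \<in> carrier_vec m \<Longrightarrow> A *\<^sub>v v = 0\<^sub>v n"
  shows "A = 0\<^sub>m n m"
proof (rule eq_matI)
  fix i j assume ij: "i < dim_row (0\<^sub>m n m)" "j < dim_col (0\<^sub>m n m)"
  hence "vec_index (A *\<^sub>v unit_vec m j) i = 0" using assms(2)[of "unit_vec m j"] by simp
  thus "A $$ (i, j) = 0\<^sub>m n m $$ (i, j)"
    using mat_vec_entry[OF A, of "unit_vec m j" i] ij by (simp add: unit_vec_def if_distrib sum.delta cong: if_cong)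
qed (use A in auto)

lemma mat_diff_eq_zeroD:
  fixes A :: "'a::ring_1 mat"
  assumes "A - B = 0\<^sub>m n m" "A \<in> carrier_mat n m" "B \<in> carrier_mat n m"
  shows "A = B"
proof (rule eq_matI)
  fix i j assume "i < dim_row B" "j < dim_col B"
  hence ij: "i < n" "j < m" using assms by auto
  hence "(A - B) $$ (i, j) = 0" unfolding assms(1) by simp
  moreover have "(A - B) $$ (i, j) = A $$ (i, j) - B $$ (i, j)" using ij assms(2,3) by simp
  ultimately show "A $$ (i, j) = B $$ (i, j)" by simp
qed (use assms in auto)

lemma sum_rotate:
  "(\<Sum>a\<in>A. \<Sum>b\<in>B. \<Sum>c\<in>C. f a b c) = (\<Sum>c\<in>C. \<Sum>a\<in>A. \<Sum>b\<in>B. f a b c)"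
proof -
  have "(\<Sum>a\<in>A. \<Sum>b\<in>B. \<Sum>c\<in>C. f a b c) = (\<Sum>a\<in>A. \<Sum>c\<in>C. \<Sum>b\<in>B. f a b c)"
    by (intro sum.cong refl, rule sum.swap)
  also have "\<dots> = (\<Sum>c\<in>C. \<Sum>a\<in>A. \<Sum>b\<in>B. f a b c)" by (rule sum.swap)
  finally show ?thesis .
qed

section \<open>Schur's lemma and orthogonality of matrix coefficients\<close>

lemma is_repD:
  assumes "is_rep G d \<pi>"
  shows "0 < d" "g \<in> carrier G \<Longrightarrow> \<pi> g \<in> carrier_mat d d"
    "g \<in> carrier G \<Longrightarrow> h \<in> carrier G \<Longrightarrow> \<pi> (g \<otimes>\<^bsub>G\<^esub> h) = \<pi> g * \<pi> h"
    "\<pi> \<one>\<^bsub>G\<^esub> = 1\<^sub>m d"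
  using assms unfolding is_rep_def by auto

lemma is_irrepD:
  assumes "is_irrep G d \<pi>"
  shows "is_rep G d \<pi>"
    "is_subspace d W \<Longrightarrow> (\<And>g w. g \<in> carrier G \<Longrightarrow> w \<in> W \<Longrightarrow> \<pi> g *\<^sub>v w \<in> W) \<Longrightarrow> W = {0\<^sub>v d} \<or> W = carrier_vec d"
  using assms unfolding is_irrep_def by auto

text \<open>Schur's lemma: kernel and range of an intertwiner are invariant subspaces, so
  irreducibility on both sides makes a nonzero one injective and surjective.\<close>

lemma schur_bijective:
  assumes p: "is_irrep G d \<pi>" and s: "is_irrep G d' \<sigma>" and A: "A \<in> carrier_mat d d'"
    and comm: "\<And>h. h \<in> carrier G \<Longrightarrow> \<pi> h * A = A * \<sigma> h" and nz: "A \<noteq> 0\<^sub>m d d'"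
  shows "d = d' \<and> Determinant.det A \<noteq> 0"
proof -
  note pr = is_repD[OF is_irrepD(1)[OF p]] and sr = is_repD[OF is_irrepD(1)[OF s]]
  define W where "W = {v \<in> carrier_vec d'. A *\<^sub>v v = 0\<^sub>v d}"
  have "W = {0\<^sub>v d'} \<or> W = carrier_vec d'"
  proof (rule is_irrepD(2)[OF s])
    show "is_subspace d' W" using A unfolding is_subspace_def W_def
      by (auto simp: mult_add_distrib_mat_vec mult_mat_vec)
    fix g w assume g: "g \<in> carrier G" and w: "w \<in> W"
    have "A *\<^sub>v (\<sigma> g *\<^sub>v w) = (A * \<sigma> g) *\<^sub>v w"
      using assoc_mult_mat_vec[OF A sr(2)[OF g], of w] w by (simp add: W_def)
    also have "\<dots> = \<pi> g *\<^sub>v (A *\<^sub>v w)"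
      using assoc_mult_mat_vec[OF pr(2)[OF g] A, of w] w comm[OF g] by (simp add: W_def)
    also have "\<dots> = 0\<^sub>v d" using w pr(2)[OF g] by (auto simp: W_def)
    finally show "\<sigma> g *\<^sub>v w \<in> W" using w sr(2)[OF g] by (auto simp: W_def)
  qed
  moreover have "W \<noteq> carrier_vec d'"
    using mat_eq_zeroI[OF A] nz unfolding W_def by blast
  ultimately have W: "W = {0\<^sub>v d'}" by blast
  define U where "U = {A *\<^sub>v v | v. v \<in> carrier_vec d'}"
  have "U = {0\<^sub>v d} \<or> U = carrier_vec d"
  proof (rule is_irrepD(2)[OF p])
    have "0\<^sub>v d \<in> U" unfolding U_def using A by (auto intro!: exI[of _ "0\<^sub>v d'"])
    moreover have "v + w \<in> U" if "v \<in> U" "w \<in> U" for v w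
    proof -
      from that obtain a b where "a \<in> carrier_vec d'" "b \<in> carrier_vec d'" "v = A *\<^sub>v a" "w = A *\<^sub>v b"
        unfolding U_def by auto
      thus ?thesis unfolding U_def using A by (auto intro!: exI[of _ "a + b"] simp: mult_add_distrib_mat_vec)
    qed
    moreover have "c \<cdot>\<^sub>v v \<in> U" if "v \<in> U" for c v
    proof -
      from that obtain a where "a \<in> carrier_vec d'" "v = A *\<^sub>v a" unfolding U_def by auto
      thus ?thesis unfolding U_def using A by (auto intro!: exI[of _ "c \<cdot>\<^sub>v a"] simp: mult_mat_vec)
    qed
    ultimately show "is_subspace d U" using A unfolding is_subspace_def by (auto simp: U_def)
    fix g w assume g: "g \<in> carrier G" and "w \<in> U"
    then obtain a where a: "a \<in> carrier_vec d'" "w = A *\<^sub>v a" unfolding U_def by auto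
    have "\<pi> g *\<^sub>v w = A *\<^sub>v (\<sigma> g *\<^sub>v a)"
      using assoc_mult_mat_vec[OF pr(2)[OF g] A a(1)] assoc_mult_mat_vec[OF A sr(2)[OF g] a(1)] comm[OF g] a(2)
      by simp
    thus "\<pi> g *\<^sub>v w \<in> U" unfolding U_def using a sr(2)[OF g] by auto
  qed
  moreover have "U \<noteq> {0\<^sub>v d}"
    using mat_eq_zeroI[OF A] nz unfolding U_def by blast
  ultimately have U: "U = carrier_vec d" by blast
  have "\<exists>v\<in>carrier_vec d'. A *\<^sub>v v = unit_vec d j" for j
  proof -
    have "unit_vec d j \<in> U" using U by simp
    thus ?thesis unfolding U_def by auto
  qed
  then obtain v where v: "\<And>j. v j \<in> carrier_vec d'" "\<And>j. A *\<^sub>v v j = unit_vec d j" by metis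
  \<comment> \<open>A right inverse of \<open>A\<close>, whose columns are preimages of the unit
    vectors.\<close>
  define B where "B = Matrix.mat d' d (\<lambda>(i, j). vec_index (v j) i)"
  have B: "B \<in> carrier_mat d' d" by (simp add: B_def)
  have colB: "col B j = v j" if "j < d" for j
    using that v(1)[of j] by (intro eq_vecI) (auto simp: B_def)
  have AB: "A * B = 1\<^sub>m d"
  proof (rule eq_matI)
    fix i j assume ij: "i < dim_row (1\<^sub>m d)" "j < dim_col (1\<^sub>m d)"
    hence "(A * B) $$ (i, j) = vec_index (A *\<^sub>v v j) i" using A B colB by simp
    also have "\<dots> = 1\<^sub>m d $$ (i, j)" using ij v(2) by (auto simp: unit_vec_def)
    finally show "(A * B) $$ (i, j) = 1\<^sub>m d $$ (i, j)" .
  qed (use A B in auto)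
  \<comment> \<open>\<open>A\<close> annihilates B A - 1 because A B = 1, and the kernel of
    \<open>A\<close> is trivial; so \<open>B\<close> is also a left inverse.\<close>
  have "B * A - 1\<^sub>m d' = 0\<^sub>m d' d'"
  proof (rule mat_eq_zeroI)
    fix x :: "complex Matrix.vec" assume x: "x \<in> carrier_vec d'"
    let ?y = "(B * A - 1\<^sub>m d') *\<^sub>v x"
    have C: "B * A - 1\<^sub>m d' \<in> carrier_mat d' d'" by (rule minus_carrier_mat) simp
    have yc: "?y \<in> carrier_vec d'" using C x by (rule mult_mat_vec_carrier)
    have "A *\<^sub>v ?y = (A * (B * A - 1\<^sub>m d')) *\<^sub>v x" by (rule assoc_mult_mat_vec[OF A C x, symmetric])
    also have "A * (B * A - 1\<^sub>m d') = A * (B * A) - A"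
      using A B by (subst mult_minus_distrib_mat[of _ d d' _ d']) auto
    also have "A * (B * A) = (A * B) * A" using A B by (simp add: assoc_mult_mat[of A d d' B d A d'])
    also have "(A * B) * A - A = 0\<^sub>m d d'" using A by (simp add: AB)
    also have "0\<^sub>m d d' *\<^sub>v x = 0\<^sub>v d" using x by auto
    finally have "?y \<in> W" unfolding W_def using yc by simp
    thus "?y = 0\<^sub>v d'" using W by simp
  qed (use A B in auto)
  hence BA: "B * A = 1\<^sub>m d'" using A B by (auto elim!: mat_diff_eq_zeroD)
  \<comment> \<open>A B and B A have the same trace, and both are identity matrices, of sizes
    \<open>d\<close> and \<open>d'\<close>.\<close>
  have "(of_nat d :: complex) = of_nat d'"
    using mtrace_mult_comm[OF A B] AB BA by (simp add: mtrace_one)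
  hence d: "d = d'" by simp
  have B': "B \<in> carrier_mat d d" and A': "A \<in> carrier_mat d d" using A B d by auto
  have "Determinant.det A * Determinant.det B = Determinant.det (A * B)"
    by (rule det_mult[OF A' B', symmetric])
  also have "\<dots> = 1" by (simp add: AB)
  finally have "Determinant.det A \<noteq> 0" by auto
  thus ?thesis using d by blast
qed

lemma mtrace_mult:
  assumes "A \<in> carrier_mat n m" "B \<in> carrier_mat m n"
  shows "mtrace (A * B) = (\<Sum>i<n. \<Sum>k<m. A $$ (i, k) * B $$ (k, i))"
  using assms mat_mult_entry[OF assms] by (simp add: mtrace_def)

locale finite_group = group G for G :: "('g, 'b) monoid_scheme" (structure) +
  assumes fin: "finite (carrier G)"
begin

lemma sum_left_translate:
  assumes "h \<in> carrier G"
  shows "(\<Sum>g\<in>carrier G. f (h \<otimes> g)) = (\<Sum>g\<in>carrier G. f g)"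
  using assms by (intro sum.reindex_bij_witness[where i = "\<lambda>g. inv h \<otimes> g" and j = "\<lambda>g. h \<otimes> g"])
    (auto simp: m_assoc[symmetric])

lemma sum_right_translate:
  assumes "h \<in> carrier G"
  shows "(\<Sum>g\<in>carrier G. f (g \<otimes> h)) = (\<Sum>g\<in>carrier G. f g)"
  using assms by (intro sum.reindex_bij_witness[where i = "\<lambda>g. g \<otimes> inv h" and j = "\<lambda>g. g \<otimes> h"])
    (auto simp: m_assoc)

lemma sum_inverse:
  "(\<Sum>g\<in>carrier G. f (inv g)) = (\<Sum>g\<in>carrier G. f g)"
  by (intro sum.reindex_bij_witness[where i = "\<lambda>g. inv g" and j = "\<lambda>g. inv g"]) auto

text \<open>\<open>A\<close> is the average over the group of \<pi>(g) E \<sigma>(inv g), where E is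
  the elementary matrix with its single entry at (j, k). Translating the summation variable by
  \<open>h\<close> moves \<pi>(h) on the left to \<sigma>(h) on the right.\<close>

lemma intertwiner:
  assumes p: "is_rep G d \<pi>" and s: "is_rep G d' \<sigma>" and h: "h \<in> carrier G" and jk: "j < d" "k < d'"
  defines "A \<equiv> Matrix.mat d d' (\<lambda>(i, l). \<Sum>g\<in>carrier G. \<pi> g $$ (i, j) * \<sigma> (inv g) $$ (k, l))"
  shows "\<pi> h * A = A * \<sigma> h"
proof (rule eq_matI)
  note pr = is_repD[OF p] and sr = is_repD[OF s]
  have A: "A \<in> carrier_mat d d'" by (simp add: A_def)
  show "dim_row (\<pi> h * A) = dim_row (A * \<sigma> h)" "dim_col (\<pi> h * A) = dim_col (A * \<sigma> h)"
    using A pr(2)[OF h] sr(2)[OF h] by auto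
  fix i l assume "i < dim_row (A * \<sigma> h)" "l < dim_col (A * \<sigma> h)"
  hence il: "i < d" "l < d'" using A sr(2)[OF h] by auto
  have "(\<pi> h * A) $$ (i, l) = (\<Sum>m<d. \<Sum>g\<in>carrier G. \<pi> h $$ (i, m) * \<pi> g $$ (m, j) * \<sigma> (inv g) $$ (k, l))"
    using mat_mult_entry[OF pr(2)[OF h] A il] il by (simp add: A_def sum_distrib_left mult.assoc)
  also have "\<dots> = (\<Sum>g\<in>carrier G. \<pi> (h \<otimes> g) $$ (i, j) * \<sigma> (inv g) $$ (k, l))"
    using h il jk by (subst sum.swap)
      (auto simp: pr(3) mat_mult_entry[OF pr(2) pr(2)] sum_distrib_right intro!: sum.cong)
  \<comment> \<open>Since inv g = inv (h g) h, the summand depends on \<open>g\<close> only through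
    h g, which makes it ready for translation.\<close>
  also have "\<dots> = (\<Sum>g\<in>carrier G. \<pi> (h \<otimes> g) $$ (i, j) * \<sigma> (inv (h \<otimes> g) \<otimes> h) $$ (k, l))"
    using h by (intro sum.cong refl) (simp add: inv_mult_group m_assoc)
  also have "\<dots> = (\<Sum>g\<in>carrier G. \<pi> g $$ (i, j) * \<sigma> (inv g \<otimes> h) $$ (k, l))"
    by (rule sum_left_translate[OF h])
  also have "\<dots> = (\<Sum>m<d'. \<Sum>g\<in>carrier G. \<pi> g $$ (i, j) * \<sigma> (inv g) $$ (k, m) * \<sigma> h $$ (m, l))"
    using h il jk by (subst sum.swap)
      (auto simp: sr(3) mat_mult_entry[OF sr(2) sr(2)] sum_distrib_left mult.assoc intro!: sum.cong)
  also have "\<dots> = (A * \<sigma> h) $$ (i, l)"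
    using mat_mult_entry[OF A sr(2)[OF h] il] il by (simp add: A_def sum_distrib_right)
  finally show "(\<pi> h * A) $$ (i, l) = (A * \<sigma> h) $$ (i, l)" .
qed

text \<open>If the averaged intertwiner were nonzero, it would be invertible and would itself be an
  equivalence. It maps the space of \<sigma> to that of \<pi>, whence the order of the pair in
  \<open>ne\<close>.\<close>

lemma schur_orthogonality:
  assumes p: "is_irrep G d \<pi>" and s: "is_irrep G d' \<sigma>"
    and ne: "((d', \<sigma>), (d, \<pi>)) \<notin> rep_equiv G"
    and ij: "i < d" "j < d" and kl: "k < d'" "l < d'"
  shows "(\<Sum>g\<in>carrier G. \<pi> g $$ (i, j) * \<sigma> (inv g) $$ (k, l)) = 0"
proof -
  define A where "A = Matrix.mat d d' (\<lambda>(i, l). \<Sum>g\<in>carrier G. \<pi> g $$ (i, j) * \<sigma> (inv g) $$ (k, l))"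
  have A: "A \<in> carrier_mat d d'" by (simp add: A_def)
  have comm: "\<pi> h * A = A * \<sigma> h" if "h \<in> carrier G" for h
    unfolding A_def using intertwiner[OF is_irrepD(1)[OF p] is_irrepD(1)[OF s] that ij(2) kl(1)] .
  have "A = 0\<^sub>m d d'"
  proof (rule ccontr)
    assume "A \<noteq> 0\<^sub>m d d'"
    from schur_bijective[OF p s A comm this] have "d = d'" "Determinant.det A \<noteq> 0" by auto
    moreover have "A * \<sigma> h = \<pi> h * A" if "h \<in> carrier G" for h using comm[OF that] by simp
    ultimately have "((d', \<sigma>), (d, \<pi>)) \<in> rep_equiv G"
      unfolding rep_equiv_def irreps_def using p s A by (auto intro!: bexI[of _ A])
    thus False using ne by simp
  qed
  hence "A $$ (i, l) = 0" using ij kl by simp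
  thus ?thesis using ij kl by (simp add: A_def)
qed

text \<open>Subtracting an eigenvalue leaves an intertwiner that is singular, hence zero.\<close>

lemma schur_scalar:
  assumes p: "is_irrep G d \<pi>" and A: "A \<in> carrier_mat d d"
    and comm: "\<And>h. h \<in> carrier G \<Longrightarrow> \<pi> h * A = A * \<pi> h"
  shows "\<exists>c. A = c \<cdot>\<^sub>m 1\<^sub>m d"
proof -
  note pr = is_repD[OF is_irrepD(1)[OF p]]
  obtain c where c: "eigenvalue A c"
    using spectrum_non_empty[OF A] pr(1) unfolding spectrum_def by auto
  then obtain v where v: "v \<in> carrier_vec d" "v \<noteq> 0\<^sub>v d" "A *\<^sub>v v = c \<cdot>\<^sub>v v"
    unfolding eigenvalue_def eigenvector_def using A by auto
  define B where "B = A - c \<cdot>\<^sub>m 1\<^sub>m d"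
  have B: "B \<in> carrier_mat d d" unfolding B_def by (rule minus_carrier_mat) simp
  have Bv: "B *\<^sub>v v = 0\<^sub>v d"
  proof (rule eq_vecI)
    fix i assume "i < dim_vec (0\<^sub>v d)"
    hence i: "i < d" by simp
    have "vec_index (B *\<^sub>v v) i = (\<Sum>k<d. A $$ (i, k) * vec_index v k - (if k = i then c * vec_index v k else 0))"
      unfolding mat_vec_entry[OF B v(1) i] using i A by (intro sum.cong refl) (auto simp: B_def left_diff_distrib)
    also have "\<dots> = vec_index (A *\<^sub>v v) i - c * vec_index v i"
      unfolding mat_vec_entry[OF A v(1) i] using i by (simp add: sum_subtractf)
    also have "\<dots> = 0" using v i by simp
    finally show "vec_index (B *\<^sub>v v) i = vec_index (0\<^sub>v d) i" using i by simp
  qed (use B in auto)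
  have commB: "\<pi> h * B = B * \<pi> h" if "h \<in> carrier G" for h
    unfolding B_def using A pr(2)[OF that] comm[OF that]
    by (simp add: mult_minus_distrib_mat[of _ d d _ d] minus_mult_distrib_mat[of _ d d _ _ d]
        mult_smult_distrib[of _ d d _ d] mult_smult_assoc_mat[of _ d d _ d])
  have "B = 0\<^sub>m d d"
  proof (rule ccontr)
    assume "B \<noteq> 0\<^sub>m d d"
    hence "Determinant.det B \<noteq> 0" using schur_bijective[OF p p B commB] by auto
    thus False using det_0_iff_vec_prod_zero[OF B] Bv v by blast
  qed
  hence "A = c \<cdot>\<^sub>m 1\<^sub>m d" unfolding B_def using A by (auto elim!: mat_diff_eq_zeroD)
  thus ?thesis by blast
qed

lemma schur_orthogonality_same:
  assumes p: "is_irrep G d \<pi>" and ij: "i < d" "j < d" and kl: "k < d" "l < d"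
  shows "(\<Sum>g\<in>carrier G. \<pi> g $$ (i, j) * \<pi> (inv g) $$ (k, l)) =
    (if j = k \<and> i = l then of_nat (card (carrier G)) / of_nat d else 0)"
proof -
  note pr = is_repD[OF is_irrepD(1)[OF p]]
  define A where "A = Matrix.mat d d (\<lambda>(i, l). \<Sum>g\<in>carrier G. \<pi> g $$ (i, j) * \<pi> (inv g) $$ (k, l))"
  have A: "A \<in> carrier_mat d d" by (simp add: A_def)
  have comm: "\<pi> h * A = A * \<pi> h" if "h \<in> carrier G" for h
    unfolding A_def using intertwiner[OF is_irrepD(1)[OF p] is_irrepD(1)[OF p] that ij(2) kl(1)] .
  obtain c where c: "A = c \<cdot>\<^sub>m 1\<^sub>m d" using schur_scalar[OF p A comm] by blast
  \<comment> \<open>The scalar is computed from the trace: summing over the diagonal collapses the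
    product to \<pi>(inv g) \<pi>(g) = 1 for each \<open>g\<close>.\<close>
  have "of_nat d * c = mtrace A" by (simp add: c mtrace_def)
  also have "\<dots> = (\<Sum>g\<in>carrier G. \<Sum>i<d. \<pi> (inv g) $$ (k, i) * \<pi> g $$ (i, j))"
    by (simp add: mtrace_def A_def mult.commute) (rule sum.swap)
  also have "\<dots> = (\<Sum>g\<in>carrier G. (\<pi> (inv g) * \<pi> g) $$ (k, j))"
    using ij kl by (intro sum.cong refl) (simp add: mat_mult_entry[OF pr(2) pr(2)])
  also have "\<dots> = (\<Sum>g\<in>carrier G. (if j = k then 1 else 0))"
    using ij kl by (intro sum.cong refl) (simp add: pr(3)[symmetric] pr(4))
  finally have "c = (if j = k then of_nat (card (carrier G)) / of_nat d else 0)"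
    using pr(1) by (auto simp: field_simps)
  moreover have "A $$ (i, l) = (if i = l then c else 0)" using ij kl by (simp add: c)
  ultimately show ?thesis using ij kl by (simp add: A_def)
qed

text \<open>Weyl's averaging: \<open>H\<close> is the Gram matrix of an invariant inner product and
  \<open>S\<close> the adjoint of \<pi>(h). Invariance says that \<open>H\<close> conjugates
  \<pi>(inv h) into \<open>S\<close>, so the two have equal trace.\<close>

lemma char_inv:
  assumes p: "is_rep G d \<pi>" and h: "h \<in> carrier G"
  shows "mtrace (\<pi> (inv h)) = cnj (mtrace (\<pi> h))"
proof -
  note pr = is_repD[OF p]
  have h': "inv h \<in> carrier G" using h by simp
  define H where "H = Matrix.mat d d (\<lambda>(i, j). \<Sum>g\<in>carrier G. \<Sum>k<d. cnj (\<pi> g $$ (k, i)) * \<pi> g $$ (k, j))"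
  define S where "S = Matrix.mat d d (\<lambda>(i, j). cnj (\<pi> h $$ (j, i)))"
  have H: "H \<in> carrier_mat d d" and S: "S \<in> carrier_mat d d" by (simp_all add: H_def S_def)
  have eq: "H * \<pi> (inv h) = S * H"
  proof (rule eq_matI)
    show "dim_row (H * \<pi> (inv h)) = dim_row (S * H)" "dim_col (H * \<pi> (inv h)) = dim_col (S * H)"
      using H S pr(2)[OF h'] by auto
    fix i j assume "i < dim_row (S * H)" "j < dim_col (S * H)"
    hence ij: "i < d" "j < d" using S H by auto
    have "(H * \<pi> (inv h)) $$ (i, j) =
      (\<Sum>m<d. \<Sum>g\<in>carrier G. \<Sum>k<d. cnj (\<pi> g $$ (k, i)) * (\<pi> g $$ (k, m) * \<pi> (inv h) $$ (m, j)))"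
      using mat_mult_entry[OF H pr(2)[OF h'] ij] ij by (simp add: H_def sum_distrib_right mult.assoc)
    also have "\<dots> = (\<Sum>g\<in>carrier G. \<Sum>k<d. \<Sum>m<d. cnj (\<pi> g $$ (k, i)) * (\<pi> g $$ (k, m) * \<pi> (inv h) $$ (m, j)))"
      by (rule sum_rotate[symmetric])
    also have "\<dots> = (\<Sum>g\<in>carrier G. \<Sum>k<d. cnj (\<pi> g $$ (k, i)) * \<pi> (g \<otimes> inv h) $$ (k, j))"
      using h' ij by (intro sum.cong refl) (simp add: pr(3) mat_mult_entry[OF pr(2) pr(2)] sum_distrib_left)
    also have "\<dots> = (\<Sum>g\<in>carrier G. \<Sum>k<d. cnj (\<pi> ((g \<otimes> inv h) \<otimes> h) $$ (k, i)) * \<pi> (g \<otimes> inv h) $$ (k, j))"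
      using h by (intro sum.cong refl) (simp add: m_assoc)
    also have "\<dots> = (\<Sum>g\<in>carrier G. \<Sum>k<d. cnj (\<pi> (g \<otimes> h) $$ (k, i)) * \<pi> g $$ (k, j))"
      by (rule sum_right_translate[OF h'])
    also have "\<dots> = (\<Sum>g\<in>carrier G. \<Sum>k<d. \<Sum>m<d. cnj (\<pi> h $$ (m, i)) * (cnj (\<pi> g $$ (k, m)) * \<pi> g $$ (k, j)))"
      using h ij by (intro sum.cong refl)
        (simp add: pr(3) mat_mult_entry[OF pr(2) pr(2)] sum_distrib_left sum_distrib_right mult_ac)
    also have "\<dots> = (\<Sum>m<d. \<Sum>g\<in>carrier G. \<Sum>k<d. cnj (\<pi> h $$ (m, i)) * (cnj (\<pi> g $$ (k, m)) * \<pi> g $$ (k, j)))"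
      by (rule sum_rotate)
    also have "\<dots> = (S * H) $$ (i, j)"
      using mat_mult_entry[OF S H ij] ij by (simp add: H_def S_def sum_distrib_left)
    finally show "(H * \<pi> (inv h)) $$ (i, j) = (S * H) $$ (i, j)" .
  qed
  have "Determinant.det H \<noteq> 0"
  proof
    assume "Determinant.det H = 0"
    then obtain v where v: "v \<in> carrier_vec d" "v \<noteq> 0\<^sub>v d" "H *\<^sub>v v = 0\<^sub>v d"
      using det_0_iff_vec_prod_zero[OF H] by blast
    define w where "w g k = (\<Sum>j<d. \<pi> g $$ (k, j) * vec_index v j)" for g k
    \<comment> \<open>For a null vector of \<open>H\<close> the quadratic form at \<open>v\<close>
      is the sum over the group of the squared norms of \<pi>(g) v. Already the term of the neutral
      element forces v = 0.\<close>
    have "0 = (\<Sum>i<d. cnj (vec_index v i) * vec_index (H *\<^sub>v v) i)" using v by simp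
    also have "\<dots> = (\<Sum>i<d. \<Sum>j<d. \<Sum>g\<in>carrier G. \<Sum>k<d.
        cnj (\<pi> g $$ (k, i) * vec_index v i) * (\<pi> g $$ (k, j) * vec_index v j))"
      by (intro sum.cong refl, subst mat_vec_entry[OF H v(1)])
        (auto simp: H_def sum_distrib_left sum_distrib_right mult_ac intro!: sum.cong)
    also have "\<dots> = (\<Sum>g\<in>carrier G. \<Sum>i<d. \<Sum>j<d. \<Sum>k<d.
        cnj (\<pi> g $$ (k, i) * vec_index v i) * (\<pi> g $$ (k, j) * vec_index v j))"
      by (rule sum_rotate)
    also have "\<dots> = (\<Sum>g\<in>carrier G. \<Sum>k<d. \<Sum>i<d. \<Sum>j<d.
        cnj (\<pi> g $$ (k, i) * vec_index v i) * (\<pi> g $$ (k, j) * vec_index v j))"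
      by (rule sum.cong[OF refl], rule sum_rotate)
    also have "\<dots> = (\<Sum>g\<in>carrier G. \<Sum>k<d. cnj (w g k) * w g k)"
      unfolding w_def cnj_sum sum_product ..
    also have "\<dots> = of_real (\<Sum>g\<in>carrier G. \<Sum>k<d. (cmod (w g k))\<^sup>2)"
      unfolding of_real_sum complex_norm_square by (simp add: mult.commute)
    finally have "complex_of_real (\<Sum>g\<in>carrier G. \<Sum>k<d. (cmod (w g k))\<^sup>2) = 0" by (rule sym)
    hence "(\<Sum>g\<in>carrier G. \<Sum>k<d. (cmod (w g k))\<^sup>2) = 0" by (simp only: of_real_eq_0_iff)
    hence "w \<one> k = 0" if "k < d" for k
      using that fin by (auto simp: sum_nonneg_eq_0_iff sum_nonneg)
    moreover have "w \<one> k = vec_index v k" if "k < d" for k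
      using that v(1) by (simp add: w_def pr(4) if_distrib[of "\<lambda>x. x * _"] sum.delta' cong: if_cong)
    ultimately have "v = 0\<^sub>v d" using v(1) by (intro eq_vecI) auto
    thus False using v by simp
  qed
  hence "mtrace (\<pi> (inv h)) = mtrace S" using mtrace_similar[OF H _ pr(2)[OF h'] S eq] by simp
  also have "\<dots> = cnj (mtrace (\<pi> h))" using pr(2)[OF h] by (simp add: mtrace_def S_def cnj_sum)
  finally show ?thesis .
qed

lemma char_conv_entry:
  assumes p: "is_irrep G d \<pi>" and s: "is_irrep G d' \<sigma>"
    and ne: "((d', \<sigma>), (d, \<pi>)) \<notin> rep_equiv G" and kl: "k < d'" "l < d'"
  shows "(\<Sum>g\<in>carrier G. mtrace (\<pi> g) * \<sigma> (inv g) $$ (k, l)) = 0"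
proof -
  note pr = is_repD[OF is_irrepD(1)[OF p]]
  have "(\<Sum>g\<in>carrier G. mtrace (\<pi> g) * \<sigma> (inv g) $$ (k, l)) =
     (\<Sum>g\<in>carrier G. \<Sum>i<d. \<pi> g $$ (i, i) * \<sigma> (inv g) $$ (k, l))"
    by (intro sum.cong refl) (simp add: mtrace_def sum_distrib_right carrier_matD(1)[OF pr(2)])
  also have "\<dots> = (\<Sum>i<d. \<Sum>g\<in>carrier G. \<pi> g $$ (i, i) * \<sigma> (inv g) $$ (k, l))" by (rule sum.swap)
  also have "\<dots> = 0" using schur_orthogonality[OF p s ne _ _ kl] by simp
  finally show ?thesis .
qed

text \<open>The entrywise form, finer than the convolution identity of characters, is what
  \<open>char_complete\<close> evaluates.\<close>

lemma char_conv_entry_same: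
  assumes p: "is_irrep G d \<pi>" and kl: "k < d" "l < d"
  shows "(\<Sum>g\<in>carrier G. mtrace (\<pi> g) * \<pi> (inv g) $$ (k, l)) =
    (if k = l then of_nat (card (carrier G)) / of_nat d else 0)"
proof -
  note pr = is_repD[OF is_irrepD(1)[OF p]]
  have "(\<Sum>g\<in>carrier G. mtrace (\<pi> g) * \<pi> (inv g) $$ (k, l)) =
     (\<Sum>g\<in>carrier G. \<Sum>i<d. \<pi> g $$ (i, i) * \<pi> (inv g) $$ (k, l))"
    by (intro sum.cong refl) (simp add: mtrace_def sum_distrib_right carrier_matD(1)[OF pr(2)])
  also have "\<dots> = (\<Sum>i<d. \<Sum>g\<in>carrier G. \<pi> g $$ (i, i) * \<pi> (inv g) $$ (k, l))" by (rule sum.swap)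
  also have "\<dots> = (\<Sum>i<d. if i = k then (if k = l then of_nat (card (carrier G)) / of_nat d else 0) else 0)"
    using kl by (intro sum.cong refl) (auto simp: schur_orthogonality_same[OF p])
  also have "\<dots> = (if k = l then of_nat (card (carrier G)) / of_nat d else 0)" using kl by simp
  finally show ?thesis .
qed

lemma char_conv:
  assumes p: "is_irrep G d \<pi>" and s: "is_irrep G d' \<sigma>"
    and ne: "((d', \<sigma>), (d, \<pi>)) \<notin> rep_equiv G" and ab: "a \<in> carrier G" "b \<in> carrier G"
  shows "(\<Sum>g\<in>carrier G. mtrace (\<pi> g) * mtrace (\<sigma> (a \<otimes> inv g \<otimes> b))) = 0"
proof -
  note sr = is_repD[OF is_irrepD(1)[OF s]]
  \<comment> \<open>Cyclicity of the trace gathers \<open>a\<close> and \<open>b\<close> into one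
    matrix that does not depend on \<open>g\<close>, so the sum becomes a linear combination of the
    entrywise identities.\<close>
  have tr: "mtrace (\<sigma> (a \<otimes> inv g \<otimes> b)) = (\<Sum>k<d'. \<Sum>l<d'. \<sigma> (inv g) $$ (k, l) * \<sigma> (b \<otimes> a) $$ (l, k))"
    if g: "g \<in> carrier G" for g
  proof -
    have "\<sigma> (a \<otimes> inv g \<otimes> b) = \<sigma> a * \<sigma> (inv g \<otimes> b)" using ab g by (simp add: sr(3)[symmetric] m_assoc)
    hence "mtrace (\<sigma> (a \<otimes> inv g \<otimes> b)) = mtrace (\<sigma> (inv g \<otimes> b) * \<sigma> a)"
      using mtrace_mult_comm[OF sr(2) sr(2)] ab g by simp
    also have "\<dots> = mtrace (\<sigma> (inv g) * \<sigma> (b \<otimes> a))" using ab g by (simp add: sr(3)[symmetric] m_assoc)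
    also have "\<dots> = (\<Sum>k<d'. \<Sum>l<d'. \<sigma> (inv g) $$ (k, l) * \<sigma> (b \<otimes> a) $$ (l, k))"
      using ab g by (intro mtrace_mult sr(2)) auto
    finally show ?thesis .
  qed
  have "(\<Sum>g\<in>carrier G. mtrace (\<pi> g) * mtrace (\<sigma> (a \<otimes> inv g \<otimes> b))) =
    (\<Sum>g\<in>carrier G. \<Sum>k<d'. \<Sum>l<d'. (mtrace (\<pi> g) * \<sigma> (inv g) $$ (k, l)) * \<sigma> (b \<otimes> a) $$ (l, k))"
    by (intro sum.cong refl) (simp add: tr sum_distrib_left mult.assoc)
  also have "\<dots> = (\<Sum>k<d'. \<Sum>l<d'. \<Sum>g\<in>carrier G. (mtrace (\<pi> g) * \<sigma> (inv g) $$ (k, l)) * \<sigma> (b \<otimes> a) $$ (l, k))"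
    by (rule sum_rotate[symmetric])
  also have "\<dots> = 0"
    by (simp add: sum_distrib_right[symmetric] char_conv_entry[OF p s ne])
  finally show ?thesis .
qed

lemma char_conv_same:
  assumes p: "is_irrep G d \<pi>" and b: "b \<in> carrier G"
  shows "(\<Sum>g\<in>carrier G. mtrace (\<pi> g) * mtrace (\<pi> (inv g \<otimes> b))) =
    of_nat (card (carrier G)) / of_nat d * mtrace (\<pi> b)"
proof -
  note pr = is_repD[OF is_irrepD(1)[OF p]]
  have "(\<Sum>g\<in>carrier G. mtrace (\<pi> g) * mtrace (\<pi> (inv g \<otimes> b))) =
    (\<Sum>g\<in>carrier G. \<Sum>k<d. \<Sum>l<d. (mtrace (\<pi> g) * \<pi> (inv g) $$ (k, l)) * \<pi> b $$ (l, k))"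
    using b by (intro sum.cong refl) (simp add: pr(3) mtrace_mult[OF pr(2) pr(2)] sum_distrib_left mult.assoc)
  also have "\<dots> = (\<Sum>k<d. \<Sum>l<d. \<Sum>g\<in>carrier G. (mtrace (\<pi> g) * \<pi> (inv g) $$ (k, l)) * \<pi> b $$ (l, k))"
    by (rule sum_rotate[symmetric])
  also have "\<dots> = (\<Sum>k<d. \<Sum>l<d. (if k = l then of_nat (card (carrier G)) / of_nat d else 0) * \<pi> b $$ (l, k))"
    by (simp add: sum_distrib_right[symmetric] char_conv_entry_same[OF p])
  also have "\<dots> = (\<Sum>k<d. of_nat (card (carrier G)) / of_nat d * \<pi> b $$ (k, k))"
    by (intro sum.cong refl) (simp add: if_distrib[of "\<lambda>x. x * _"] sum.delta' sum.delta cong: if_cong)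
  also have "\<dots> = of_nat (card (carrier G)) / of_nat d * mtrace (\<pi> b)"
    using pr(2)[OF b] by (simp add: mtrace_def sum_distrib_left)
  finally show ?thesis .
qed

end

section \<open>Completeness of the irreducible characters\<close>

lemma (in vector_space) finite_dim_subspace_eq:
  assumes B: "finite B" "W \<subseteq> span B" and S: "subspace S" "S \<subseteq> W" and dim: "dim W \<le> dim S"
  shows "S = W"
proof -
  obtain C where C: "C \<subseteq> S" "independent C" "S \<subseteq> span C" "card C = dim S"
    using basis_exists[of S] by blast
  obtain D where D: "C \<subseteq> D" "D \<subseteq> W" "independent D" "W \<subseteq> span D"
    using maximal_independent_subset_extend[of C W] C S by blast
  have finD: "finite D" using independent_span_bound[OF B(1) D(3)] D(2) B(2) by blast
  have "card D \<le> card C" using basis_card_eq_dim[OF D(2) D(4) D(3)] C(4) dim by simp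
  hence "C = D" using D(1) finD by (intro card_seteq) auto
  hence "W \<subseteq> S" using D(4) span_minimal[OF C(1) S(1)] by blast
  thus ?thesis using S by blast
qed

lemma vector_space_complex_fun: "vector_space (\<lambda>(c::complex) (f::'x \<Rightarrow> complex) x. c * f x)"
  by unfold_locales (auto simp: fun_eq_iff algebra_simps)

lemma sum_fun_apply: "(\<Sum>i\<in>A. F i) x = (\<Sum>i\<in>A. F i (x::'x) :: complex)"
  by (induction A rule: infinite_finite_induct) auto

context finite_group begin

text \<open>Set to zero off the carrier, so that translation preserves the finite dimensional space
  of functions supported on the group.\<close>

definition "right_translate h f = (\<lambda>x. if x \<in> carrier G then f (x \<otimes> h) else 0)" for h and f :: "'g \<Rightarrow> complex"

text \<open>A right-translation invariant space of functions annihilated by all characters would, at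
  minimal positive dimension, carry an irreducible representation whose own character does not
  annihilate it.\<close>

lemma char_complete:
  fixes f :: "'g \<Rightarrow> complex"
  assumes supp: "\<And>x. x \<notin> carrier G \<Longrightarrow> f x = 0"
    and kill: "\<And>d \<pi> x. is_irrep G d \<pi> \<Longrightarrow> x \<in> carrier G \<Longrightarrow>
      (\<Sum>g\<in>carrier G. mtrace (\<pi> g) * f (inv g \<otimes> x)) = 0"
  shows "f x = 0"
proof (rule ccontr)
  assume fx: "f x \<noteq> 0"
  interpret FV: vector_space "\<lambda>(c::complex) (f::'g \<Rightarrow> complex) x. c * f x"
    by (rule vector_space_complex_fun)
  \<comment> \<open>The space of all counterexamples. Its defining convolutions act from the left,
    so right translation preserves it.\<close>
  define K :: "('g \<Rightarrow> complex) set" where "K = {f. (\<forall>x. x \<notin> carrier G \<longrightarrow> f x = 0) \<and> (\<forall>d \<pi>. is_irrep G d \<pi> \<longrightarrow>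
     (\<forall>x\<in>carrier G. (\<Sum>g\<in>carrier G. mtrace (\<pi> g) * f (inv g \<otimes> x)) = 0))}"
  define good where "good W \<longleftrightarrow> FV.subspace W \<and> W \<subseteq> K \<and> W \<noteq> {0} \<and>
     (\<forall>h\<in>carrier G. \<forall>f\<in>W. right_translate h f \<in> W)" for W
  have "good K" unfolding good_def
  proof (intro conjI ballI)
    show "FV.subspace K" unfolding FV.subspace_def
    proof (intro conjI ballI allI)
      show "0 \<in> K" by (simp add: K_def)
      show "u + v \<in> K" if "u \<in> K" "v \<in> K" for u v
        using that by (simp add: K_def distrib_left sum.distrib)
      show "(\<lambda>x. c * u x) \<in> K" if u: "u \<in> K" for c u
      proof -
        have "(\<Sum>g\<in>carrier G. mtrace (\<pi> g) * (c * u (inv g \<otimes> x))) =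
            c * (\<Sum>g\<in>carrier G. mtrace (\<pi> g) * u (inv g \<otimes> x))" for \<pi> x
          by (simp add: sum_distrib_left mult.left_commute)
        thus ?thesis using u by (simp add: K_def)
      qed
    qed
    have "f \<in> K" using supp kill by (simp add: K_def)
    moreover have "f \<noteq> 0" using fx by auto
    ultimately show "K \<noteq> {0}" by blast
    fix h f assume h: "h \<in> carrier G" and f: "f \<in> K"
    have "(\<Sum>g\<in>carrier G. mtrace (\<pi> g) * right_translate h f (inv g \<otimes> x)) = 0"
      if p: "is_irrep G d \<pi>" and x: "x \<in> carrier G" for d \<pi> x
    proof -
      have "(\<Sum>g\<in>carrier G. mtrace (\<pi> g) * right_translate h f (inv g \<otimes> x)) =
         (\<Sum>g\<in>carrier G. mtrace (\<pi> g) * f (inv g \<otimes> (x \<otimes> h)))"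
        using x h by (intro sum.cong refl) (auto simp: right_translate_def m_assoc)
      also have "\<dots> = 0" using f p x h unfolding K_def by auto
      finally show ?thesis .
    qed
    thus "right_translate h f \<in> K" unfolding K_def by (auto simp: right_translate_def)
  qed auto
  then obtain W where W: "good W" and min: "\<And>W'. good W' \<Longrightarrow> FV.dim W \<le> FV.dim W'"
    using ex_has_least_nat[of good K FV.dim] by blast
  note W' = W[unfolded good_def]
  define \<delta> where "\<delta> g = (\<lambda>x. if x = g then 1 else 0 :: complex)" for g :: 'g
  have K_span: "K \<subseteq> FV.span (\<delta> ` carrier G)"
  proof
    fix f assume f: "f \<in> K"
    have "(\<Sum>g\<in>carrier G. (\<lambda>x. f g * \<delta> g x)) \<in> FV.span (\<delta> ` carrier G)"
      by (intro FV.span_sum FV.span_scale FV.span_base) auto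
    also have "(\<Sum>g\<in>carrier G. (\<lambda>x. f g * \<delta> g x)) = f"
      using f fin by (auto simp: fun_eq_iff sum_fun_apply \<delta>_def K_def if_distrib sum.delta cong: if_cong)
    finally show "f \<in> FV.span (\<delta> ` carrier G)" .
  qed
  obtain B where B: "B \<subseteq> W" "FV.independent B" "W \<subseteq> FV.span B" "card B = FV.dim W"
    using FV.basis_exists[of W] by blast
  have finB: "finite B"
    using FV.independent_span_bound[of "\<delta> ` carrier G" B] fin B(1,2) W' K_span by blast
  define d where "d = card B"
  obtain b where b: "bij_betw b {0..<d} B" using ex_bij_betw_nat_finite[OF finB] d_def by blast
  have bW: "b i \<in> W" if "i < d" for i using b B(1) that unfolding bij_betw_def by auto
  have b0: "b i x = 0" if "i < d" "x \<notin> carrier G" for i x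
    using bW[OF that(1)] W' that(2) unfolding K_def by auto
  have sumB: "(\<Sum>v\<in>B. u v * v x) = (\<Sum>i<d. u (b i) * b i x)" for u x
    using b by (simp add: sum.reindex_bij_betw[symmetric] lessThan_atLeast0)
  have "\<exists>c. \<forall>x. w x = (\<Sum>i<d. c i * b i x)" if "w \<in> W" for w
  proof -
    from that B(3) obtain u where "w = (\<Sum>v\<in>B. (\<lambda>x. u v * v x))"
      unfolding FV.span_finite[OF finB] by auto
    hence "w x = (\<Sum>i<d. u (b i) * b i x)" for x by (simp add: sum_fun_apply sumB)
    thus ?thesis by (intro exI[of _ "\<lambda>i. u (b i)"]) simp
  qed
  hence ex: "\<forall>w\<in>W. \<exists>c. \<forall>x. w x = (\<Sum>i<d. c i * b i x)" by blast
  obtain coef where coef: "\<And>w x. w \<in> W \<Longrightarrow> w x = (\<Sum>i<d. coef w i * b i x)"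
    using bchoice[OF ex] by blast
  have uniq: "c i = 0" if z: "\<And>x. (\<Sum>i<d. c i * b i x) = 0" and i: "i < d" for c i
  proof -
    define u where "u v = c (inv_into {0..<d} b v)" for v
    have ub: "u (b i) = c i" if "i < d" for i
      using b that unfolding u_def bij_betw_def by (simp add: inv_into_f_f)
    have "(\<Sum>v\<in>B. (\<lambda>x. u v * v x)) = 0"
    proof
      fix x
      have "(\<Sum>v\<in>B. u v * v x) = (\<Sum>i<d. c i * b i x)" unfolding sumB by (intro sum.cong refl) (simp add: ub)
      thus "(\<Sum>v\<in>B. (\<lambda>x. u v * v x)) x = 0 x" by (simp add: sum_fun_apply z)
    qed
    moreover have "b i \<in> B" using b i unfolding bij_betw_def by auto
    ultimately have "u (b i) = 0" using FV.independentD[OF B(2) finB order_refl, of u "b i"] by blast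
    thus ?thesis using ub i by simp
  qed
  \<comment> \<open>The matrix of right translation by \<open>h\<close> in the basis
    \<open>b\<close>. Translating by \<open>h\<close> and then by \<open>g\<close> is translation by
    g h, the order that a representation requires.\<close>
  define \<sigma> where "\<sigma> h = Matrix.mat d d (\<lambda>(i, j). coef (right_translate h (b j)) i)" for h
  have \<sigma>C: "\<sigma> h \<in> carrier_mat d d" for h by (simp add: \<sigma>_def)
  have \<sigma>: "right_translate h (b j) x = (\<Sum>i<d. \<sigma> h $$ (i, j) * b i x)" if "h \<in> carrier G" "j < d" for h j x
  proof -
    have "right_translate h (b j) \<in> W" using W' that bW by blast
    thus ?thesis using coef[of "right_translate h (b j)" x] that by (simp add: \<sigma>_def)
  qed
  have d0: "0 < d"
  proof (rule ccontr)
    assume "\<not> 0 < d"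
    hence "w = 0" if "w \<in> W" for w using coef[OF that] by (auto simp: fun_eq_iff)
    thus False using W' FV.subspace_0 by blast
  qed
  have rep: "is_rep G d \<sigma>" unfolding is_rep_def
  proof (intro conjI ballI)
    show "0 < d" by (rule d0)
    show "\<sigma> g \<in> carrier_mat d d" for g by (rule \<sigma>C)
    show "\<sigma> \<one> = 1\<^sub>m d"
    proof (rule eq_matI)
      fix i j assume "i < dim_row (1\<^sub>m d)" "j < dim_col (1\<^sub>m d)"
      hence ij: "i < d" "j < d" by auto
      have "(\<Sum>i<d. (\<sigma> \<one> $$ (i, j) - (if i = j then 1 else 0)) * b i x) = 0" for x
      proof -
        have "right_translate \<one> (b j) x = b j x" using b0 ij by (auto simp: right_translate_def)
        thus ?thesis using \<sigma>[of \<one> j x] ij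
          by (simp add: left_diff_distrib sum_subtractf if_distrib[of "\<lambda>y. y * _"] sum.delta cong: if_cong)
      qed
      from uniq[OF this ij(1)] show "\<sigma> \<one> $$ (i, j) = 1\<^sub>m d $$ (i, j)" using ij by auto
    qed (use \<sigma>C in auto)
    fix g h assume g: "g \<in> carrier G" and h: "h \<in> carrier G"
    show "\<sigma> (g \<otimes> h) = \<sigma> g * \<sigma> h"
    proof (rule eq_matI)
      fix i j assume "i < dim_row (\<sigma> g * \<sigma> h)" "j < dim_col (\<sigma> g * \<sigma> h)"
      hence ij: "i < d" "j < d" using \<sigma>C[of g] \<sigma>C[of h] by auto
      have "(\<Sum>i<d. (\<sigma> (g \<otimes> h) $$ (i, j) - (\<sigma> g * \<sigma> h) $$ (i, j)) * b i x) = 0" for x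
      proof -
        have "(\<Sum>i<d. \<sigma> (g \<otimes> h) $$ (i, j) * b i x) = right_translate g (right_translate h (b j)) x"
          using \<sigma>[of "g \<otimes> h" j x] g h ij by (auto simp: right_translate_def m_assoc)
        also have "\<dots> = (\<Sum>k<d. \<sigma> h $$ (k, j) * right_translate g (b k) x)"
          using \<sigma>[of h j "x \<otimes> g"] h ij by (auto simp: right_translate_def)
        also have "\<dots> = (\<Sum>k<d. \<Sum>i<d. \<sigma> g $$ (i, k) * \<sigma> h $$ (k, j) * b i x)"
          using g by (intro sum.cong refl) (simp add: \<sigma> sum_distrib_left mult_ac)
        also have "\<dots> = (\<Sum>i<d. (\<sigma> g * \<sigma> h) $$ (i, j) * b i x)"
          using ij by (subst sum.swap) (simp add: mat_mult_entry[OF \<sigma>C \<sigma>C] sum_distrib_right)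
        finally show ?thesis by (simp add: left_diff_distrib sum_subtractf)
      qed
      from uniq[OF this ij(1)] show "\<sigma> (g \<otimes> h) $$ (i, j) = (\<sigma> g * \<sigma> h) $$ (i, j)" by simp
    qed (use \<sigma>C[of g] \<sigma>C[of h] \<sigma>C[of "g \<otimes> h"] in auto)
  qed
  have irrep: "is_irrep G d \<sigma>" unfolding is_irrep_def
  proof (intro conjI notI rep)
    assume "\<exists>U. is_subspace d U \<and> U \<noteq> {0\<^sub>v d} \<and> U \<noteq> carrier_vec d \<and> (\<forall>g\<in>carrier G. \<forall>w\<in>U. \<sigma> g *\<^sub>v w \<in> U)"
    then obtain U where U: "is_subspace d U" "U \<noteq> {0\<^sub>v d}" "U \<noteq> carrier_vec d"
      "\<And>g w. g \<in> carrier G \<Longrightarrow> w \<in> U \<Longrightarrow> \<sigma> g *\<^sub>v w \<in> U" by blast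
    note U' = U(1)[unfolded is_subspace_def]
    \<comment> \<open>Coordinates to functions. A proper invariant subspace \<open>U\<close> of
      coordinate vectors would yield the good space T(U) inside \<open>W\<close>; minimality of the
      dimension makes it all of \<open>W\<close>, and injectivity of \<open>T\<close> makes
      \<open>U\<close> everything.\<close>
    define T where "T u = (\<lambda>x. \<Sum>i<d. vec_index u i * b i x)" for u
    have T_inj: "u = v" if "T u = T v" "u \<in> carrier_vec d" "v \<in> carrier_vec d" for u v
    proof (rule eq_vecI)
      fix i assume "i < dim_vec v"
      hence i: "i < d" using that by auto
      have "(\<Sum>i<d. (vec_index u i - vec_index v i) * b i x) = 0" for x
        using fun_cong[OF that(1), of x] by (simp add: T_def left_diff_distrib sum_subtractf)
      from uniq[OF this i] show "vec_index u i = vec_index v i" by simp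
    qed (use that in auto)
    have T0: "T (0\<^sub>v d) = 0" by (auto simp: T_def fun_eq_iff)
    have good: "good (T ` U)" unfolding good_def
    proof (intro conjI ballI)
      have Tadd: "T u + T v = T (u + v)" if "u \<in> U" "v \<in> U" for u v
      proof
        fix x
        have "u \<in> carrier_vec d" "v \<in> carrier_vec d" using that U' by auto
        hence "T (u + v) x = (\<Sum>i<d. vec_index u i * b i x + vec_index v i * b i x)"
          unfolding T_def by (intro sum.cong refl) (auto simp: distrib_right)
        thus "(T u + T v) x = T (u + v) x" by (simp add: T_def sum.distrib)
      qed
      have Tsm: "(\<lambda>x. c * T u x) = T (c \<cdot>\<^sub>v u)" if "u \<in> U" for c u
      proof -
        have "u \<in> carrier_vec d" using that U' by blast
        thus ?thesis by (auto simp: T_def fun_eq_iff sum_distrib_left mult.assoc intro!: sum.cong)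
      qed
      show "FV.subspace (T ` U)" unfolding FV.subspace_def
      proof (intro conjI ballI allI)
        show "0 \<in> T ` U" using U' T0 by (intro image_eqI[of _ _ "0\<^sub>v d"]) auto
        show "x + y \<in> T ` U" if "x \<in> T ` U" "y \<in> T ` U" for x y using that U' Tadd by auto
        show "(\<lambda>x. c * f x) \<in> T ` U" if "f \<in> T ` U" for c f using that U' Tsm by auto
      qed
      have "T u \<in> W" for u
      proof -
        have "(\<Sum>i<d. (\<lambda>x. vec_index u i * b i x)) \<in> W"
          using W' bW by (intro FV.subspace_sum FV.subspace_scale) auto
        also have "(\<Sum>i<d. (\<lambda>x. vec_index u i * b i x)) = T u" by (auto simp: T_def fun_eq_iff sum_fun_apply)
        finally show ?thesis .
      qed
      thus "T ` U \<subseteq> K" using W' by blast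
      obtain u where u: "u \<in> U" "u \<noteq> 0\<^sub>v d" using U U' by blast
      hence "T u \<noteq> 0" using T_inj[of u "0\<^sub>v d"] T0 U' by auto
      thus "T ` U \<noteq> {0}" using u by blast
      fix h f assume h: "h \<in> carrier G" and "f \<in> T ` U"
      then obtain u where u: "u \<in> U" "f = T u" by blast
      have uc: "u \<in> carrier_vec d" using u U' by blast
      have "right_translate h f x = T (\<sigma> h *\<^sub>v u) x" for x
      proof -
        have "right_translate h f x = (\<Sum>i<d. vec_index u i * right_translate h (b i) x)"
          by (auto simp: u T_def right_translate_def)
        also have "\<dots> = (\<Sum>i<d. \<Sum>m<d. \<sigma> h $$ (m, i) * vec_index u i * b m x)"
          using h by (intro sum.cong refl) (simp add: \<sigma> sum_distrib_left mult_ac)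
        also have "\<dots> = T (\<sigma> h *\<^sub>v u) x"
          by (subst sum.swap) (auto simp: T_def mat_vec_entry[OF \<sigma>C uc] sum_distrib_right intro!: sum.cong)
        finally show ?thesis .
      qed
      hence "right_translate h f = T (\<sigma> h *\<^sub>v u)" by blast
      thus "right_translate h f \<in> T ` U" using U(4)[OF h u(1)] by blast
    qed
    have TW: "T u \<in> W" for u
    proof -
      have "(\<Sum>i<d. (\<lambda>x. vec_index u i * b i x)) \<in> W"
        using W' bW by (intro FV.subspace_sum FV.subspace_scale) auto
      also have "(\<Sum>i<d. (\<lambda>x. vec_index u i * b i x)) = T u" by (auto simp: T_def fun_eq_iff sum_fun_apply)
      finally show ?thesis .
    qed
    have "T ` U = W"
    proof (rule FV.finite_dim_subspace_eq)
      show "finite (\<delta> ` carrier G)" using fin by simp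
      show "W \<subseteq> FV.span (\<delta> ` carrier G)" using W' K_span by blast
      show "FV.subspace (T ` U)" using good unfolding good_def by blast
      show "T ` U \<subseteq> W" using TW by blast
      show "FV.dim W \<le> FV.dim (T ` U)" by (rule min[OF good])
    qed
    moreover have "u \<in> U" if u: "u \<in> carrier_vec d" and "T u \<in> T ` U" for u
    proof -
      from that obtain v where "v \<in> U" "T u = T v" by blast
      thus ?thesis using T_inj[of u v] u U' by auto
    qed
    ultimately have "u \<in> U" if "u \<in> carrier_vec d" for u using that TW[of u] by blast
    thus False using U(3) U' by blast
  qed
  have "b 0 x = 0" for x
  proof (cases "x \<in> carrier G")
    case x: True
    \<comment> \<open>Evaluating a translated basis function at the neutral element expresses
      \<open>b 0\<close> through matrix entries of \<sigma>. Convolution with the character of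
      \<sigma> then reproduces \<open>b 0\<close> up to the nonzero factor |G|/d, although
      membership in \<open>K\<close> makes it vanish.\<close>
    have bh: "b 0 h = (\<Sum>i<d. \<sigma> h $$ (i, 0) * b i \<one>)" if "h \<in> carrier G" for h
      using \<sigma>[OF that d0, of \<one>] that by (simp add: right_translate_def)
    have "0 = (\<Sum>g\<in>carrier G. mtrace (\<sigma> g) * b 0 (inv g \<otimes> x))"
      using bW[OF d0] W' irrep x unfolding K_def by auto
    also have "\<dots> = (\<Sum>g\<in>carrier G. \<Sum>i<d. \<Sum>m<d. (mtrace (\<sigma> g) * \<sigma> (inv g) $$ (i, m)) * (\<sigma> x $$ (m, 0) * b i \<one>))"
      using x d0 by (intro sum.cong refl)
        (simp add: bh is_repD(3)[OF rep] mat_mult_entry[OF \<sigma>C \<sigma>C] sum_distrib_left sum_distrib_right mult_ac)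
    also have "\<dots> = (\<Sum>i<d. \<Sum>m<d. \<Sum>g\<in>carrier G. (mtrace (\<sigma> g) * \<sigma> (inv g) $$ (i, m)) * (\<sigma> x $$ (m, 0) * b i \<one>))"
      by (rule sum_rotate[symmetric])
    also have "\<dots> = (\<Sum>i<d. \<Sum>m<d. (if i = m then of_nat (card (carrier G)) / of_nat d else 0) * (\<sigma> x $$ (m, 0) * b i \<one>))"
      by (simp add: sum_distrib_right[symmetric] char_conv_entry_same[OF irrep])
    also have "\<dots> = (\<Sum>i<d. of_nat (card (carrier G)) / of_nat d * (\<sigma> x $$ (i, 0) * b i \<one>))"
      by (intro sum.cong refl) (simp add: if_distrib[of "\<lambda>x. x * _"] sum.delta' sum.delta cong: if_cong)
    also have "\<dots> = of_nat (card (carrier G)) / of_nat d * b 0 x"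
      by (simp add: bh[OF x] sum_distrib_left)
    finally show "b 0 x = 0" using d0 fin by auto
  qed (use b0 d0 in auto)
  hence "(\<Sum>i<d. (if i = 0 then 1 else 0) * b i x) = 0" for x
    using d0 by (simp add: if_distrib[of "\<lambda>y. y * _"] sum.delta cong: if_cong)
  from uniq[OF this d0] show False by simp
qed

end

section \<open>Equivalence classes of irreducible representations and their central
  idempotents\<close>

locale real_char_group = finite_group G for G :: "('g, 'b) monoid_scheme" (structure) +
  assumes real_chars: "\<forall>(d, \<pi>)\<in>irreps G. \<forall>g\<in>carrier G. Im (mtrace (\<pi> g)) = 0"
begin

definition "chi c g = Re (class_char c g)"

abbreviation "class_rep c \<equiv> snd (SOME p. p \<in> c)"

lemma equiv_rep_equiv: "equiv (irreps G) (rep_equiv G)"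
proof (rule equivI)
  show "rep_equiv G \<subseteq> irreps G \<times> irreps G" by (auto simp: rep_equiv_def)
  have "((d, \<pi>), (d, \<pi>)) \<in> rep_equiv G" if "(d, \<pi>) \<in> irreps G" for d \<pi>
  proof -
    have "is_rep G d \<pi>" using that by (simp add: irreps_def is_irrepD(1))
    hence "\<forall>g\<in>carrier G. 1\<^sub>m d * \<pi> g = \<pi> g * 1\<^sub>m d" by (auto dest: is_repD(2))
    thus ?thesis using that by (auto simp: rep_equiv_def intro!: bexI[of _ "1\<^sub>m d"])
  qed
  thus "refl_on (irreps G) (rep_equiv G)" unfolding refl_on_def by auto
  show "sym (rep_equiv G)"
  proof (rule symI)
    fix x y assume xy: "(x, y) \<in> rep_equiv G"
    then obtain d \<pi> \<sigma> P where x: "x = (d, \<pi>)" "y = (d, \<sigma>)" and irr: "(d, \<pi>) \<in> irreps G" "(d, \<sigma>) \<in> irreps G"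
      and P: "P \<in> carrier_mat d d" "Determinant.det P \<noteq> 0" and eq: "\<And>g. g \<in> carrier G \<Longrightarrow> P * \<pi> g = \<sigma> g * P"
      unfolding rep_equiv_def by auto
    have \<pi>: "\<pi> g \<in> carrier_mat d d" and \<sigma>: "\<sigma> g \<in> carrier_mat d d" if "g \<in> carrier G" for g
      using irr that is_repD(2)[OF is_irrepD(1)] by (auto simp: irreps_def)
    obtain Q where Q: "Q \<in> carrier_mat d d" "Q * P = 1\<^sub>m d" "P * Q = 1\<^sub>m d"
      using mat_inverse_exists[OF P] by blast
    have "Q * \<sigma> g = \<pi> g * Q" if g: "g \<in> carrier G" for g
    proof -
      have "Q * \<sigma> g = Q * (\<sigma> g * (P * Q))" using \<sigma>[OF g] by (simp add: Q)
      also have "\<dots> = Q * ((P * \<pi> g) * Q)" by (simp only: eq[OF g] assoc_mult_mat[OF \<sigma>[OF g] P(1) Q(1)])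
      also have "\<dots> = Q * (P * (\<pi> g * Q))" by (simp only: assoc_mult_mat[OF P(1) \<pi>[OF g] Q(1)])
      also have "\<dots> = (Q * P) * (\<pi> g * Q)"
        by (rule assoc_mult_mat[OF Q(1) P(1), symmetric]) (use \<pi>[OF g] Q in auto)
      also have "\<dots> = \<pi> g * Q" using \<pi>[OF g] Q by simp
      finally show ?thesis .
    qed
    moreover have "Determinant.det Q \<noteq> 0"
    proof -
      have "Determinant.det Q * Determinant.det P = 1" using det_mult[OF Q(1) P(1)] Q(2) by simp
      thus ?thesis by auto
    qed
    ultimately show "(y, x) \<in> rep_equiv G" using x irr Q(1) unfolding rep_equiv_def by (auto intro!: bexI[of _ Q])
  qed
  show "trans (rep_equiv G)"
  proof (rule transI)
    fix x y z assume "(x, y) \<in> rep_equiv G" "(y, z) \<in> rep_equiv G"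
    then obtain d \<pi> \<sigma> \<kappa> P Q where x: "x = (d, \<pi>)" "z = (d, \<kappa>)" and irr: "(d, \<pi>) \<in> irreps G" "(d, \<sigma>) \<in> irreps G" "(d, \<kappa>) \<in> irreps G"
      and P: "P \<in> carrier_mat d d" "Determinant.det P \<noteq> 0" and eqP: "\<And>g. g \<in> carrier G \<Longrightarrow> P * \<pi> g = \<sigma> g * P"
      and Q: "Q \<in> carrier_mat d d" "Determinant.det Q \<noteq> 0" and eqQ: "\<And>g. g \<in> carrier G \<Longrightarrow> Q * \<sigma> g = \<kappa> g * Q"
      unfolding rep_equiv_def by auto
    have \<pi>: "\<pi> g \<in> carrier_mat d d" and \<sigma>: "\<sigma> g \<in> carrier_mat d d" and \<kappa>: "\<kappa> g \<in> carrier_mat d d" if "g \<in> carrier G" for g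
      using irr that is_repD(2)[OF is_irrepD(1)] by (auto simp: irreps_def)
    have "(Q * P) * \<pi> g = \<kappa> g * (Q * P)" if g: "g \<in> carrier G" for g
    proof -
      have "(Q * P) * \<pi> g = Q * (\<sigma> g * P)" by (simp only: assoc_mult_mat[OF Q(1) P(1) \<pi>[OF g]] eqP[OF g])
      also have "\<dots> = (\<kappa> g * Q) * P" by (simp only: assoc_mult_mat[OF Q(1) \<sigma>[OF g] P(1), symmetric] eqQ[OF g])
      also have "\<dots> = \<kappa> g * (Q * P)" by (rule assoc_mult_mat[OF \<kappa>[OF g] Q(1) P(1)])
      finally show ?thesis .
    qed
    thus "(x, z) \<in> rep_equiv G" using x irr P Q det_mult[OF Q(1) P(1)]
      unfolding rep_equiv_def by (auto intro!: bexI[of _ "Q * P"])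
  qed
qed

lemma class_rep_in: "c \<in> dual_classes G \<Longrightarrow> (class_dim c, class_rep c) \<in> c"
proof -
  assume "c \<in> dual_classes G"
  hence "c \<noteq> {}" unfolding dual_classes_def using equiv_rep_equiv by (metis in_quotient_imp_non_empty)
  hence "(SOME p. p \<in> c) \<in> c" by (simp add: some_in_eq)
  thus ?thesis by (simp add: class_dim_def)
qed

lemma class_irrep: "c \<in> dual_classes G \<Longrightarrow> is_irrep G (class_dim c) (class_rep c)"
  using class_rep_in[of c] in_quotient_imp_subset[OF equiv_rep_equiv, of c]
  unfolding dual_classes_def irreps_def by auto

lemma class_inequivalent:
  assumes "c \<in> dual_classes G" "c' \<in> dual_classes G" "c \<noteq> c'"
  shows "((class_dim c', class_rep c'), (class_dim c, class_rep c)) \<notin> rep_equiv G"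
  using quotient_eq_iff[OF equiv_rep_equiv assms(2,1)[unfolded dual_classes_def]
      class_rep_in[OF assms(2)] class_rep_in[OF assms(1)]] assms(3) by auto

lemma class_char_eq:
  assumes "c \<in> dual_classes G" "g \<in> carrier G"
  shows "mtrace (class_rep c g) = of_real (chi c g)"
  using real_chars class_irrep[OF assms(1)] assms(2)
  by (auto simp: chi_def class_char_def complex_eq_iff irreps_def)

text \<open>Lets \<open>char_complete\<close>, which quantifies over all irreducible matrix
  representations, be applied with chosen representatives of the classes only.\<close>

lemma irrep_char_eq:
  assumes p: "is_irrep G d \<pi>"
  obtains c where "c \<in> dual_classes G" "\<And>g. g \<in> carrier G \<Longrightarrow> mtrace (\<pi> g) = of_real (chi c g)"
proof -
  define c where "c = rep_equiv G `` {(d, \<pi>)}"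
  have c: "c \<in> dual_classes G" unfolding dual_classes_def c_def using p by (intro quotientI) (simp add: irreps_def)
  have "((d, \<pi>), (class_dim c, class_rep c)) \<in> rep_equiv G" using class_rep_in[OF c] unfolding c_def by simp
  then obtain P where d: "class_dim c = d" and P: "P \<in> carrier_mat d d" "Determinant.det P \<noteq> 0"
    and eq: "\<And>g. g \<in> carrier G \<Longrightarrow> P * \<pi> g = class_rep c g * P" unfolding rep_equiv_def by auto
  have "mtrace (\<pi> g) = of_real (chi c g)" if g: "g \<in> carrier G" for g
    using mtrace_similar[OF P _ _ eq[OF g]] is_repD(2)[OF is_irrepD(1)[OF p] g]
      is_repD(2)[OF is_irrepD(1)[OF class_irrep[OF c]] g] class_char_eq[OF c g] d by simp
  thus ?thesis using c that by blast
qed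

lemma class_dim_pos: "c \<in> dual_classes G \<Longrightarrow> 0 < class_dim c"
  using is_repD(1)[OF is_irrepD(1)[OF class_irrep]] .

lemma chi_one: "c \<in> dual_classes G \<Longrightarrow> chi c \<one> = real (class_dim c)"
  using class_char_eq[of c \<one>] is_repD(4)[OF is_irrepD(1)[OF class_irrep[of c]]]
  by (simp add: mtrace_one) (metis of_real_eq_iff of_real_of_nat_eq)

lemma chi_inv: "c \<in> dual_classes G \<Longrightarrow> g \<in> carrier G \<Longrightarrow> chi c (inv g) = chi c g"
  using char_inv[OF is_irrepD(1)[OF class_irrep], of c g] class_char_eq[of c g] class_char_eq[of c "inv g"]
  by simp

lemma chi_orthogonal:
  assumes "c \<in> dual_classes G" "c' \<in> dual_classes G" "c \<noteq> c'" "a \<in> carrier G" "b \<in> carrier G"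
  shows "(\<Sum>g\<in>carrier G. chi c g * chi c' (a \<otimes> inv g \<otimes> b)) = 0"
proof -
  have "complex_of_real (\<Sum>g\<in>carrier G. chi c g * chi c' (a \<otimes> inv g \<otimes> b)) =
    (\<Sum>g\<in>carrier G. mtrace (class_rep c g) * mtrace (class_rep c' (a \<otimes> inv g \<otimes> b)))"
    using assms by (simp add: class_char_eq)
  also have "\<dots> = 0"
    by (rule char_conv[OF class_irrep class_irrep class_inequivalent]) (use assms in auto)
  finally show ?thesis by (simp only: of_real_eq_0_iff)
qed

lemma chi_conv_same:
  assumes c: "c \<in> dual_classes G" and b: "b \<in> carrier G"
  shows "(\<Sum>g\<in>carrier G. chi c g * chi c (inv g \<otimes> b)) = real (card (carrier G)) / real (class_dim c) * chi c b"
proof -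
  have "complex_of_real (\<Sum>g\<in>carrier G. chi c g * chi c (inv g \<otimes> b)) =
    (\<Sum>g\<in>carrier G. mtrace (class_rep c g) * mtrace (class_rep c (inv g \<otimes> b)))"
    using assms by (simp add: class_char_eq)
  also have "\<dots> = complex_of_real (real (card (carrier G)) / real (class_dim c) * chi c b)"
    using char_conv_same[OF class_irrep[OF c] b] class_char_eq[OF c b] by simp
  finally show ?thesis by (simp only: of_real_eq_iff)
qed

lemma chi_orthogonal':
  assumes "c \<in> dual_classes G" "c' \<in> dual_classes G" "b \<in> carrier G"
  shows "(\<Sum>g\<in>carrier G. chi c g * chi c' (inv g \<otimes> b)) =
    (if c = c' then real (card (carrier G)) / real (class_dim c) * chi c b else 0)"
proof (cases "c = c'")
  case True
  thus ?thesis using chi_conv_same[OF assms(1,3)] by simp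
next
  case False
  thus ?thesis using chi_orthogonal[OF assms(1,2) False one_closed assms(3)] assms by simp
qed

lemma card_G_pos: "0 < card (carrier G)"
  using fin one_closed card_gt_0_iff by blast

text \<open>Coefficients of the central idempotent of the group algebra that belongs to the class;
  the isotypic component of a process is its action.\<close>

definition "idem c g = real (class_dim c) / real (card (carrier G)) * chi c g"

lemma idem_conv:
  assumes "c \<in> dual_classes G" "c' \<in> dual_classes G" "b \<in> carrier G"
  shows "(\<Sum>g\<in>carrier G. chi c g * idem c' (inv g \<otimes> b)) = (if c = c' then chi c b else 0)"
proof -
  have "(\<Sum>g\<in>carrier G. chi c g * idem c' (inv g \<otimes> b)) = real (class_dim c') / real (card (carrier G)) *
    (\<Sum>g\<in>carrier G. chi c g * chi c' (inv g \<otimes> b))"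
    by (simp add: idem_def sum_distrib_left mult_ac)
  also have "\<dots> = (if c = c' then chi c b else 0)"
    unfolding chi_orthogonal'[OF assms] using class_dim_pos[OF assms(1)] card_G_pos by (cases "c = c'") auto
  finally show ?thesis .
qed

text \<open>Bessel's inequality for the functions \<open>d\<^sub>c \<chi>\<^sub>c / |G|\<close> and the unit mass at the neutral element.\<close>

lemma dim_square_sum_le:
  assumes S: "finite S" "S \<subseteq> dual_classes G"
  shows "(\<Sum>c\<in>S. (real (class_dim c))\<^sup>2) \<le> real (card (carrier G))"
proof -
  define n where "n = real (card (carrier G))"
  have n: "n > 0" using card_G_pos by (simp add: n_def)
  \<comment> \<open>The residual of the unit mass at the neutral element after subtracting its
    projections onto the idempotents.\<close>
  define D where "D g = (if g = \<one> then 1 else 0) - (\<Sum>c\<in>S. idem c g)" for g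
  have sumD: "(\<Sum>g\<in>carrier G. F g * D g) = F \<one> - (\<Sum>c\<in>S. \<Sum>g\<in>carrier G. F g * idem c g)" for F
  proof -
    have "(\<Sum>g\<in>carrier G. F g * D g) = (\<Sum>g\<in>carrier G. (if g = \<one> then F g else 0) - (\<Sum>c\<in>S. F g * idem c g))"
      by (intro sum.cong refl) (auto simp: D_def right_diff_distrib sum_distrib_left)
    also have "\<dots> = F \<one> - (\<Sum>g\<in>carrier G. \<Sum>c\<in>S. F g * idem c g)"
      using fin by (simp add: sum_subtractf)
    finally show ?thesis by (subst sum.swap) 
  qed
  have conv: "(\<Sum>g\<in>carrier G. idem c g * idem c' g) = (if c = c' then idem c \<one> else 0)" if "c \<in> S" "c' \<in> S" for c c'
  proof -
    have "(\<Sum>g\<in>carrier G. idem c g * idem c' g) = real (class_dim c) / n * (\<Sum>g\<in>carrier G. chi c g * idem c' (inv g \<otimes> \<one>))"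
      using that S by (simp add: idem_def[of c] n_def sum_distrib_left mult_ac)
        (auto simp: idem_def chi_inv intro!: sum.cong)
    also have "\<dots> = (if c = c' then idem c \<one> else 0)"
    proof -
      have "c \<in> dual_classes G" "c' \<in> dual_classes G" using that S by auto
      thus ?thesis by (subst idem_conv) (simp_all add: idem_def n_def)
    qed
    finally show ?thesis .
  qed
  \<comment> \<open>The residual is orthogonal to every idempotent in \<open>S\<close>, so its
    squared norm is its inner product with the unit mass, which is its value at the neutral
    element.\<close>
  have "0 \<le> (\<Sum>g\<in>carrier G. D g * D g)" by (intro sum_nonneg) auto
  also have "\<dots> = D \<one> - (\<Sum>c\<in>S. \<Sum>g\<in>carrier G. D g * idem c g)" by (rule sumD)
  also have "(\<Sum>c\<in>S. \<Sum>g\<in>carrier G. D g * idem c g) = (\<Sum>c\<in>S. \<Sum>g\<in>carrier G. idem c g * D g)"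
    by (simp add: mult.commute)
  also have "\<dots> = 0"
  proof (rule sum.neutral, rule ballI)
    fix c assume c: "c \<in> S"
    show "(\<Sum>g\<in>carrier G. idem c g * D g) = 0"
      unfolding sumD using c S by (simp add: conv[OF c] cong: sum.cong)
  qed
  finally have "(\<Sum>c\<in>S. idem c \<one>) \<le> 1" by (simp add: D_def)
  also have "(\<Sum>c\<in>S. idem c \<one>) = (\<Sum>c\<in>S. (real (class_dim c))\<^sup>2) / n"
    unfolding sum_divide_distrib using S by (intro sum.cong refl) (auto simp: idem_def chi_one n_def power2_eq_square)
  finally show ?thesis using n by (simp add: field_simps n_def)
qed

text \<open>Each dimension is at least 1, so Bessel's inequality bounds the size of every finite set
  of classes by the order of the group.\<close>

lemma finite_dual_classes: "finite (dual_classes G)"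
proof -
  have "card S \<le> card (carrier G)" if S: "S \<subseteq> dual_classes G" "finite S" for S
  proof -
    have "real (card S) = (\<Sum>c\<in>S. 1)" by simp
    also have "\<dots> \<le> (\<Sum>c\<in>S. (real (class_dim c))\<^sup>2)"
    proof (rule sum_mono)
      fix c assume "c \<in> S"
      hence "1 \<le> real (class_dim c)" using class_dim_pos[of c] S by fastforce
      thus "1 \<le> (real (class_dim c))\<^sup>2" by (simp add: one_le_power)
    qed
    also have "\<dots> \<le> real (card (carrier G))" using dim_square_sum_le S by blast
    finally show ?thesis by simp
  qed
  thus ?thesis using finite_if_finite_subsets_card_bdd[of "dual_classes G" "card (carrier G)"] by blast
qed

text \<open>Convolving an irreducible character with the sum of all idempotents returns that
  character, as does the unit mass. Their difference is annihilated by all characters and is zero by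
  \<open>char_complete\<close>.\<close>

lemma sum_idem:
  assumes k: "k \<in> carrier G"
  shows "(\<Sum>c\<in>dual_classes G. idem c k) = (if k = \<one> then 1 else 0)"
proof -
  define D where "D g = (if g \<in> carrier G then (if g = \<one> then 1 else 0) - (\<Sum>c\<in>dual_classes G. idem c g) else 0)" for g
  have "complex_of_real (D k) = 0"
  proof (rule char_complete)
    fix x assume "x \<notin> carrier G" thus "complex_of_real (D x) = 0" by (simp add: D_def)
  next
    fix d \<pi> x assume p: "is_irrep G d \<pi>" and x: "x \<in> carrier G"
    obtain c where c: "c \<in> dual_classes G" "\<And>g. g \<in> carrier G \<Longrightarrow> mtrace (\<pi> g) = of_real (chi c g)"
      using irrep_char_eq[OF p] by blast
    have "(\<Sum>g\<in>carrier G. mtrace (\<pi> g) * of_real (D (inv g \<otimes> x))) =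
       of_real (\<Sum>g\<in>carrier G. chi c g * D (inv g \<otimes> x))"
      by (simp add: c(2))
    also have "(\<Sum>g\<in>carrier G. chi c g * D (inv g \<otimes> x)) =
       (\<Sum>g\<in>carrier G. (if g = x then chi c g else 0) - (\<Sum>c'\<in>dual_classes G. chi c g * idem c' (inv g \<otimes> x)))"
    proof (intro sum.cong refl)
      fix g assume g: "g \<in> carrier G"
      have "inv g \<otimes> x = \<one> \<longleftrightarrow> g = x" using g x by (metis inv_equality inv_inv inv_closed l_inv)
      thus "chi c g * D (inv g \<otimes> x) = (if g = x then chi c g else 0) - (\<Sum>c'\<in>dual_classes G. chi c g * idem c' (inv g \<otimes> x))"
        using g x by (simp add: D_def right_diff_distrib sum_distrib_left)
    qed
    also have "\<dots> = chi c x - (\<Sum>g\<in>carrier G. \<Sum>c'\<in>dual_classes G. chi c g * idem c' (inv g \<otimes> x))"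
      using fin x by (simp add: sum_subtractf)
    also have "(\<Sum>g\<in>carrier G. \<Sum>c'\<in>dual_classes G. chi c g * idem c' (inv g \<otimes> x)) =
      (\<Sum>c'\<in>dual_classes G. if c = c' then chi c x else 0)"
      by (subst sum.swap) (simp add: idem_conv[OF c(1) _ x] cong: sum.cong)
    also have "chi c x - \<dots> = 0" using c(1) finite_dual_classes by simp
    finally show "(\<Sum>g\<in>carrier G. mtrace (\<pi> g) * complex_of_real (D (inv g \<otimes> x))) = 0" by simp
  qed
  hence "D k = 0" by (simp only: of_real_eq_0_iff)
  thus ?thesis using k by (simp add: D_def)
qed

text \<open>The two ways in which orthogonality of isotypic components enters: for forms invariant under
  simultaneous left translation (covariances) and right translation (integrals over \<open>Y\<close>).\<close>

lemma chi_orthogonal_left: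
  assumes c: "c \<in> dual_classes G" "c' \<in> dual_classes G" "c \<noteq> c'"
    and B: "\<And>k a b. k \<in> carrier G \<Longrightarrow> a \<in> carrier G \<Longrightarrow> b \<in> carrier G \<Longrightarrow> B (k \<otimes> a) (k \<otimes> b) = B a b"
  shows "(\<Sum>g1\<in>carrier G. \<Sum>g2\<in>carrier G. chi c g1 * chi c' g2 * B (inv g1) (inv g2)) = (0::real)"
proof -
  \<comment> \<open>Substitute g2 = inv h g1.\<close>
  have "(\<Sum>g1\<in>carrier G. \<Sum>g2\<in>carrier G. chi c g1 * chi c' g2 * B (inv g1) (inv g2)) =
    (\<Sum>g1\<in>carrier G. \<Sum>h\<in>carrier G. chi c g1 * chi c' (inv h \<otimes> g1) * B (inv g1) (inv (inv h \<otimes> g1)))"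
  proof (rule sum.cong[OF refl])
    fix g1 assume g1: "g1 \<in> carrier G"
    show "(\<Sum>g2\<in>carrier G. chi c g1 * chi c' g2 * B (inv g1) (inv g2)) =
      (\<Sum>h\<in>carrier G. chi c g1 * chi c' (inv h \<otimes> g1) * B (inv g1) (inv (inv h \<otimes> g1)))"
      using sum_right_translate[OF g1, of "\<lambda>g2. chi c g1 * chi c' g2 * B (inv g1) (inv g2)"]
        sum_inverse[of "\<lambda>h. chi c g1 * chi c' (h \<otimes> g1) * B (inv g1) (inv (h \<otimes> g1))"] by simp
  qed
  \<comment> \<open>By invariance the form now depends on \<open>h\<close> only, and the remaining
    sum over \<open>g1\<close> is a convolution of two different characters.\<close>
  also have "\<dots> = (\<Sum>g1\<in>carrier G. \<Sum>h\<in>carrier G. (chi c g1 * chi c' (\<one> \<otimes> inv g1 \<otimes> h)) * B \<one> h)"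
  proof (intro sum.cong refl)
    fix g1 h assume g: "g1 \<in> carrier G" "h \<in> carrier G"
    have "B (inv g1) (inv (inv h \<otimes> g1)) = B (inv g1 \<otimes> \<one>) (inv g1 \<otimes> h)"
      using g by (simp add: inv_mult_group)
    moreover have "chi c' (inv h \<otimes> g1) = chi c' (inv g1 \<otimes> h)"
      using g chi_inv[OF c(2), of "inv h \<otimes> g1"] by (simp add: inv_mult_group)
    ultimately show "chi c g1 * chi c' (inv h \<otimes> g1) * B (inv g1) (inv (inv h \<otimes> g1)) =
      (chi c g1 * chi c' (\<one> \<otimes> inv g1 \<otimes> h)) * B \<one> h" using g B[of "inv g1" \<one> h] by simp
  qed
  also have "\<dots> = 0"
    by (subst sum.swap)
      (rule sum.neutral, rule ballI, simp only: sum_distrib_right[symmetric] chi_orthogonal[OF c one_closed] mult_zero_left)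
  finally show ?thesis .
qed

text \<open>Inverting both arguments turns right invariance into left invariance, and real
  characters do not change under inversion.\<close>

lemma chi_orthogonal_right:
  assumes c: "c \<in> dual_classes G" "c' \<in> dual_classes G" "c \<noteq> c'"
    and B: "\<And>k a b. k \<in> carrier G \<Longrightarrow> a \<in> carrier G \<Longrightarrow> b \<in> carrier G \<Longrightarrow> B (a \<otimes> k) (b \<otimes> k) = B a b"
  shows "(\<Sum>g1\<in>carrier G. \<Sum>g2\<in>carrier G. chi c g1 * chi c' g2 * B (inv g1) (inv g2)) = (0::real)"
proof -
  have "(\<Sum>g1\<in>carrier G. \<Sum>g2\<in>carrier G. chi c g1 * chi c' g2 * B (inv g1) (inv g2)) =
    (\<Sum>g1\<in>carrier G. \<Sum>g2\<in>carrier G. chi c (inv g1) * chi c' (inv g2) * B (inv (inv g1)) (inv (inv g2)))"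
    unfolding sum_inverse[of "\<lambda>g1. \<Sum>g2\<in>carrier G. chi c g1 * chi c' (inv g2) * B (inv g1) (inv (inv g2))"]
    by (intro sum.cong refl sum_inverse[of "\<lambda>g2. chi c _ * chi c' g2 * B (inv _) (inv g2)", symmetric])
  also have "\<dots> = (\<Sum>g1\<in>carrier G. \<Sum>g2\<in>carrier G. chi c g1 * chi c' g2 * B (inv (inv g1)) (inv (inv g2)))"
    using c by (intro sum.cong refl) (simp add: chi_inv)
  also have "\<dots> = 0"
    by (rule chi_orthogonal_left[OF c, of "\<lambda>a b. B (inv a) (inv b)"]) (simp add: B inv_mult_group)
  finally show ?thesis .
qed

end

section \<open>Moments, laws and independence\<close>

definition has_exp_moment :: "'w measure \<Rightarrow> ('w \<Rightarrow> real) \<Rightarrow> bool" where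
  "has_exp_moment M U \<longleftrightarrow> U \<in> borel_measurable M \<and> (\<exists>a>0. integrable M (\<lambda>\<omega>. exp (a * \<bar>U \<omega>\<bar>)))"

text \<open>Where the exponential is not integrable this is the default value 0 of the integral; it
  is evaluated only in a strip around the imaginary axis given by an exponential moment.\<close>

definition mgf :: "'w measure \<Rightarrow> ('w \<Rightarrow> real) \<Rightarrow> complex \<Rightarrow> complex" where
  "mgf M U z = (\<integral>\<omega>. exp (z * of_real (U \<omega>)) \<partial>M)"

definition moment_fps :: "'w measure \<Rightarrow> ('w \<Rightarrow> real) \<Rightarrow> complex fps" where
  "moment_fps M U = Abs_fps (\<lambda>n. complex_of_real (\<integral>\<omega>. U \<omega> ^ n \<partial>M) / fact n)"

lemma sum_power_fact_le_exp:
  assumes "0 \<le> (x::real)"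
  shows "(\<Sum>i<n. x ^ i / fact i) \<le> exp x"
  unfolding exp_def using assms summable_exp_generic[of x]
  by (simp add: divide_inverse_commute) (rule sum_le_suminf, auto simp: summable_exp)

text \<open>Taylor expansion around an arbitrary point \<open>z\<close> of the strip: exp(a |U|)
  dominates all partial sums of the norms, so sum and integral may be exchanged. Varying
  \<open>z\<close> gives holomorphy, and z = 0 gives the moment series.\<close>

lemma mgf_sums:
  assumes U: "U \<in> borel_measurable M" and a: "integrable M (\<lambda>\<omega>. exp (a * \<bar>U \<omega>\<bar>))"
    and w: "\<bar>Re z\<bar> + norm w \<le> a"
  shows "(\<lambda>n. (\<integral>\<omega>. exp (z * of_real (U \<omega>)) * of_real (U \<omega>) ^ n \<partial>M) / fact n * w ^ n) sums mgf M U (z + w)"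
proof -
  define f where "f n \<omega> = exp (z * of_real (U \<omega>)) * of_real (U \<omega>) ^ n * w ^ n / fact n" for n \<omega>
  have m: "f n \<in> borel_measurable M" for n unfolding f_def using U by measurable
  have norm_f: "norm (f n \<omega>) = exp (Re z * U \<omega>) * ((\<bar>U \<omega>\<bar> * norm w) ^ n / fact n)" for n \<omega>
    by (simp add: f_def norm_mult norm_divide norm_power power_mult_distrib)
  have bound: "(\<Sum>i<n. norm (f i \<omega>)) \<le> exp (a * \<bar>U \<omega>\<bar>)" for n \<omega>
  proof -
    have "(\<Sum>i<n. norm (f i \<omega>)) = exp (Re z * U \<omega>) * (\<Sum>i<n. (\<bar>U \<omega>\<bar> * norm w) ^ i / fact i)"
      by (simp only: norm_f sum_distrib_left)
    also have "\<dots> \<le> exp (\<bar>Re z\<bar> * \<bar>U \<omega>\<bar>) * exp (\<bar>U \<omega>\<bar> * norm w)"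
    proof (intro mult_mono)
      have "Re z * U \<omega> \<le> \<bar>Re z\<bar> * \<bar>U \<omega>\<bar>" by (metis abs_ge_self abs_mult)
      thus "exp (Re z * U \<omega>) \<le> exp (\<bar>Re z\<bar> * \<bar>U \<omega>\<bar>)" by simp
    qed (auto intro!: sum_power_fact_le_exp sum_nonneg)
    also have "\<dots> = exp ((\<bar>Re z\<bar> + norm w) * \<bar>U \<omega>\<bar>)" by (simp add: exp_add[symmetric] algebra_simps)
    also have "\<dots> \<le> exp (a * \<bar>U \<omega>\<bar>)" using w by (simp add: mult_right_mono)
    finally show ?thesis .
  qed
  have int: "integrable M (f n)" for n
  proof (rule Bochner_Integration.integrable_bound[OF a m], rule AE_I2)
    fix \<omega>
    have "norm (f n \<omega>) \<le> (\<Sum>i<Suc n. norm (f i \<omega>))" by (intro member_le_sum) auto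
    also have "\<dots> \<le> exp (a * \<bar>U \<omega>\<bar>)" by (rule bound)
    finally show "norm (f n \<omega>) \<le> norm (exp (a * \<bar>U \<omega>\<bar>))" by simp
  qed
  have sums_f: "(\<lambda>n. f n \<omega>) sums exp ((z + w) * of_real (U \<omega>))" for \<omega>
  proof -
    have "(\<lambda>n. exp (z * of_real (U \<omega>)) * ((w * of_real (U \<omega>)) ^ n /\<^sub>R fact n)) sums
        (exp (z * of_real (U \<omega>)) * exp (w * of_real (U \<omega>)))"
      by (intro sums_mult exp_converges)
    thus ?thesis by (simp add: f_def exp_add[symmetric] algebra_simps power_mult_distrib scaleR_conv_of_real divide_inverse)
  qed
  have "(\<lambda>n. integral\<^sup>L M (f n)) sums (\<integral>\<omega>. (\<Sum>n. f n \<omega>) \<partial>M)"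
  proof (rule sums_integral[OF int])
    show "AE x in M. summable (\<lambda>i. norm (f i x))"
      by (intro AE_I2 summableI_nonneg_bounded[OF _ bound]) auto
    show "summable (\<lambda>i. \<integral>x. norm (f i x) \<partial>M)"
    proof (rule summableI_nonneg_bounded)
      fix n
      have "(\<Sum>i<n. \<integral>x. norm (f i x) \<partial>M) = (\<integral>x. (\<Sum>i<n. norm (f i x)) \<partial>M)"
        using int by (subst Bochner_Integration.integral_sum) auto
      also have "\<dots> \<le> (\<integral>\<omega>. exp (a * \<bar>U \<omega>\<bar>) \<partial>M)"
        using int a bound by (intro integral_mono) auto
      finally show "(\<Sum>i<n. \<integral>x. norm (f i x) \<partial>M) \<le> (\<integral>\<omega>. exp (a * \<bar>U \<omega>\<bar>) \<partial>M)" .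
    qed auto
  qed
  moreover have "(\<integral>\<omega>. (\<Sum>n. f n \<omega>) \<partial>M) = mgf M U (z + w)"
    unfolding mgf_def using sums_f by (simp add: sums_iff)
  moreover have "integral\<^sup>L M (f n) = (\<integral>\<omega>. exp (z * of_real (U \<omega>)) * of_real (U \<omega>) ^ n \<partial>M) / fact n * w ^ n" for n
    unfolding f_def by simp
  ultimately show ?thesis by simp
qed

lemma open_strip: "open {z. \<bar>Re z\<bar> < a}"
  by (intro open_Collect_less continuous_intros)

lemma mgf_holomorphic:
  assumes U: "U \<in> borel_measurable M" and a: "integrable M (\<lambda>\<omega>. exp (a * \<bar>U \<omega>\<bar>))"
  shows "mgf M U holomorphic_on {z. \<bar>Re z\<bar> < a}"
proof -
  have "mgf M U field_differentiable at z" if z: "\<bar>Re z\<bar> < a" for z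
  proof -
    define r where "r = a - \<bar>Re z\<bar>"
    have "mgf M U holomorphic_on ball z r"
    proof (rule power_series_holomorphic)
      fix w assume "w \<in> ball z r"
      hence "\<bar>Re z\<bar> + norm (w - z) \<le> a" by (simp add: r_def dist_norm norm_minus_commute)
      from mgf_sums[OF U a this]
      show "(\<lambda>n. (\<integral>\<omega>. exp (z * of_real (U \<omega>)) * of_real (U \<omega>) ^ n \<partial>M) / fact n * (w - z) ^ n) sums mgf M U w" by simp
    qed
    thus ?thesis using z by (intro holomorphic_on_imp_differentiable_at[of _ "ball z r"]) (auto simp: r_def)
  qed
  thus ?thesis using open_strip by (auto simp: holomorphic_on_open field_differentiable_def)
qed

lemma mgf_has_fps_expansion:
  assumes "has_exp_moment M U"
  shows "mgf M U has_fps_expansion moment_fps M U"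
proof (rule has_fps_expansionI)
  from assms obtain a where a: "a > 0" "integrable M (\<lambda>\<omega>. exp (a * \<bar>U \<omega>\<bar>))" and U: "U \<in> borel_measurable M"
    unfolding has_exp_moment_def by blast
  have "eventually (\<lambda>w. w \<in> ball 0 a) (nhds (0::complex))"
    using a(1) by (intro eventually_nhds_in_open) auto
  thus "\<forall>\<^sub>F w in nhds 0. (\<lambda>n. fps_nth (moment_fps M U) n * w ^ n) sums mgf M U w"
  proof eventually_elim
    case (elim w)
    hence "\<bar>Re 0\<bar> + norm w \<le> a" by simp
    from mgf_sums[OF U a(2) this]
    have *: "(\<lambda>n. (\<integral>\<omega>. complex_of_real (U \<omega>) ^ n \<partial>M) / fact n * w ^ n) sums mgf M U w" by simp
    have "(\<integral>\<omega>. complex_of_real (U \<omega>) ^ n \<partial>M) = of_real (\<integral>\<omega>. U \<omega> ^ n \<partial>M)" for n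
      by (simp only: of_real_power[symmetric] integral_complex_of_real)
    with * show ?case by (simp add: moment_fps_def)
  qed
qed

lemma has_exp_moment_add:
  assumes "has_exp_moment M U" "has_exp_moment M V"
  shows "has_exp_moment M (\<lambda>\<omega>. U \<omega> + V \<omega>)"
proof -
  from assms obtain a b where a: "a > 0" "integrable M (\<lambda>\<omega>. exp (a * \<bar>U \<omega>\<bar>))" and U[measurable]: "U \<in> borel_measurable M"
    and b: "b > 0" "integrable M (\<lambda>\<omega>. exp (b * \<bar>V \<omega>\<bar>))" and V[measurable]: "V \<in> borel_measurable M"
    unfolding has_exp_moment_def by blast
  \<comment> \<open>Halving allows c |U + V| \<le> 2 c max(|U|, |V|), so one of the two given
    exponentials dominates.\<close>
  define c where "c = min a b / 2"
  have c: "c > 0" "2 * c \<le> a" "2 * c \<le> b" using a(1) b(1) by (auto simp: c_def)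
  have "integrable M (\<lambda>\<omega>. exp (c * \<bar>U \<omega> + V \<omega>\<bar>))"
  proof (rule Bochner_Integration.integrable_bound[OF Bochner_Integration.integrable_add[OF a(2) b(2)]])
    show "AE \<omega> in M. norm (exp (c * \<bar>U \<omega> + V \<omega>\<bar>)) \<le> norm (exp (a * \<bar>U \<omega>\<bar>) + exp (b * \<bar>V \<omega>\<bar>))"
    proof (rule AE_I2)
      fix \<omega>
      have "c * \<bar>U \<omega> + V \<omega>\<bar> \<le> max (a * \<bar>U \<omega>\<bar>) (b * \<bar>V \<omega>\<bar>)"
      proof -
        have "c * \<bar>U \<omega> + V \<omega>\<bar> \<le> c * (\<bar>U \<omega>\<bar> + \<bar>V \<omega>\<bar>)" using c(1) by (intro mult_left_mono) auto
        also have "\<dots> \<le> c * (2 * max \<bar>U \<omega>\<bar> \<bar>V \<omega>\<bar>)" using c(1) by (intro mult_left_mono) auto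
        also have "\<dots> = (2 * c) * max \<bar>U \<omega>\<bar> \<bar>V \<omega>\<bar>" by simp
        also have "\<dots> \<le> max (a * \<bar>U \<omega>\<bar>) (b * \<bar>V \<omega>\<bar>)"
        proof (cases "\<bar>U \<omega>\<bar> \<le> \<bar>V \<omega>\<bar>")
          case True
          thus ?thesis using mult_right_mono[OF c(3), of "\<bar>V \<omega>\<bar>"] by (simp add: max_def)
        next
          case False
          thus ?thesis using mult_right_mono[OF c(2), of "\<bar>U \<omega>\<bar>"] by (simp add: max_def)
        qed
        finally show ?thesis .
      qed
      hence "exp (c * \<bar>U \<omega> + V \<omega>\<bar>) \<le> max (exp (a * \<bar>U \<omega>\<bar>)) (exp (b * \<bar>V \<omega>\<bar>))"
        by (auto simp: max_def split: if_splits)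
      also have "\<dots> \<le> exp (a * \<bar>U \<omega>\<bar>) + exp (b * \<bar>V \<omega>\<bar>)" by (simp add: max_def)
      finally show "norm (exp (c * \<bar>U \<omega> + V \<omega>\<bar>)) \<le> norm (exp (a * \<bar>U \<omega>\<bar>) + exp (b * \<bar>V \<omega>\<bar>))" by simp
    qed
  qed measurable
  thus ?thesis unfolding has_exp_moment_def using c(1) by auto
qed

lemma has_exp_moment_cmult:
  assumes "has_exp_moment M U"
  shows "has_exp_moment M (\<lambda>\<omega>. t * U \<omega>)"
proof -
  from assms obtain a where a: "a > 0" "integrable M (\<lambda>\<omega>. exp (a * \<bar>U \<omega>\<bar>))" and U[measurable]: "U \<in> borel_measurable M"
    unfolding has_exp_moment_def by blast
  \<comment> \<open>The summand 1 covers t = 0.\<close>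
  define c where "c = a / (\<bar>t\<bar> + 1)"
  have c: "c > 0" "c * \<bar>t\<bar> \<le> a" using a(1) by (auto simp: c_def field_simps)
  have "integrable M (\<lambda>\<omega>. exp (c * \<bar>t * U \<omega>\<bar>))"
  proof (rule Bochner_Integration.integrable_bound[OF a(2)])
    show "AE \<omega> in M. norm (exp (c * \<bar>t * U \<omega>\<bar>)) \<le> norm (exp (a * \<bar>U \<omega>\<bar>))"
      using mult_right_mono[OF c(2)] by (auto simp: abs_mult mult.assoc[symmetric])
  qed measurable
  thus ?thesis unfolding has_exp_moment_def using c(1) by auto
qed

lemma (in prob_space) has_exp_moment_sum:
  "finite I \<Longrightarrow> (\<And>i. i \<in> I \<Longrightarrow> has_exp_moment M (U i)) \<Longrightarrow> has_exp_moment M (\<lambda>\<omega>. \<Sum>i\<in>I. U i \<omega>)"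
proof (induction I rule: finite_induct)
  case empty
  show ?case unfolding has_exp_moment_def by (auto intro!: exI[of _ 1])
next
  case (insert i I)
  thus ?case using has_exp_moment_add[of M "U i" "\<lambda>\<omega>. \<Sum>i\<in>I. U i \<omega>"] by simp
qed

lemma has_exp_moment_mono:
  assumes V: "has_exp_moment M V" and U: "U \<in> borel_measurable M" and le: "\<And>\<omega>. \<omega> \<in> space M \<Longrightarrow> \<bar>U \<omega>\<bar> \<le> \<bar>V \<omega>\<bar>"
  shows "has_exp_moment M U"
proof -
  from V obtain a where a: "a > 0" "integrable M (\<lambda>\<omega>. exp (a * \<bar>V \<omega>\<bar>))" unfolding has_exp_moment_def by blast
  have "integrable M (\<lambda>\<omega>. exp (a * \<bar>U \<omega>\<bar>))"
    by (rule Bochner_Integration.integrable_bound[OF a(2)]) (use U le a(1) in auto)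
  thus ?thesis unfolding has_exp_moment_def using U a(1) by auto
qed

text \<open>The moment generating functions extend holomorphically to a strip around the imaginary axis, so
  a formal identity between moment series carries over to the characteristic functions.\<close>

lemma char_prod_of_moment_fps:
  assumes J: "finite J" and V: "\<And>j. j \<in> J \<Longrightarrow> has_exp_moment M (V j)" and U: "has_exp_moment N U"
    and eq: "moment_fps N U = (\<Prod>j\<in>J. moment_fps M (V j))"
  shows "mgf N U (\<i> * of_real t) = (\<Prod>j\<in>J. mgf M (V j) (\<i> * of_real t))"
proof -
  have "\<exists>a. \<forall>j\<in>J. a j > 0 \<and> integrable M (\<lambda>\<omega>. exp (a j * \<bar>V j \<omega>\<bar>))"
    using V unfolding has_exp_moment_def by (intro bchoice) blast
  then obtain a where a: "\<And>j. j \<in> J \<Longrightarrow> a j > 0" "\<And>j. j \<in> J \<Longrightarrow> integrable M (\<lambda>\<omega>. exp (a j * \<bar>V j \<omega>\<bar>))" by blast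
  from U obtain b where b: "b > 0" "integrable N (\<lambda>\<omega>. exp (b * \<bar>U \<omega>\<bar>))" and Um: "U \<in> borel_measurable N"
    unfolding has_exp_moment_def by blast
  \<comment> \<open>A common width of the strips; inserting \<open>b\<close> keeps the set nonempty
    for empty \<open>J\<close>.\<close>
  define r where "r = Min (insert b (a ` J))"
  have r: "r > 0" "r \<le> b" "\<And>j. j \<in> J \<Longrightarrow> r \<le> a j" using J a(1) b(1) by (auto simp: r_def)
  have holU: "mgf N U holomorphic_on {z. \<bar>Re z\<bar> < r}"
    using r by (intro holomorphic_on_subset[OF mgf_holomorphic[OF Um b(2)]]) auto
  have holV: "(\<lambda>z. \<Prod>j\<in>J. mgf M (V j) z) holomorphic_on {z. \<bar>Re z\<bar> < r}"
  proof (rule holomorphic_on_prod)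
    fix j assume j: "j \<in> J"
    have "V j \<in> borel_measurable M" using V[OF j] unfolding has_exp_moment_def by blast
    from mgf_holomorphic[OF this a(2)[OF j]]
    show "mgf M (V j) holomorphic_on {z. \<bar>Re z\<bar> < r}"
      by (rule holomorphic_on_subset) (use r(3)[OF j] in auto)
  qed
  have "(\<lambda>z. \<Prod>j\<in>J. mgf M (V j) z) has_fps_expansion (\<Prod>j\<in>J. moment_fps M (V j))"
    using V by (intro has_fps_expansion_prod mgf_has_fps_expansion) auto
  hence "eventually (\<lambda>z. eval_fps (moment_fps N U) z = (\<Prod>j\<in>J. mgf M (V j) z)) (nhds 0)"
    unfolding eq[symmetric] has_fps_expansion_def by blast
  moreover have "eventually (\<lambda>z. eval_fps (moment_fps N U) z = mgf N U z) (nhds 0)"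
    using mgf_has_fps_expansion[OF U] unfolding has_fps_expansion_def by blast
  moreover have "eventually (\<lambda>z. z \<in> {z. \<bar>Re z\<bar> < r}) (nhds 0)"
    using r(1) by (intro eventually_nhds_in_open open_strip) auto
  ultimately have "eventually (\<lambda>z. mgf N U z = (\<Prod>j\<in>J. mgf M (V j) z) \<and> \<bar>Re z\<bar> < r) (nhds 0)"
    by eventually_elim auto
  then obtain S where S: "open S" "0 \<in> S" "\<And>z. z \<in> S \<Longrightarrow> mgf N U z = (\<Prod>j\<in>J. mgf M (V j) z) \<and> \<bar>Re z\<bar> < r"
    unfolding eventually_nhds by blast
  have conv: "convex {z. \<bar>Re z\<bar> < r}"
  proof -
    have "{z. \<bar>Re z\<bar> < r} = {z. Re z < r} \<inter> {z. Re z > - r}" by auto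
    thus ?thesis by (simp add: convex_Int convex_halfspace_Re_lt convex_halfspace_Re_gt)
  qed
  \<comment> \<open>Identity theorem: both sides are holomorphic on a connected strip and agree near
    0, hence also on the imaginary axis.\<close>
  show ?thesis
    by (rule analytic_continuation_open[OF S(1) open_strip[of r] _ _ _ holU holV])
       (use S conv r(1) in \<open>auto intro: convex_connected\<close>)
qed

lemma char_distr_eq_mgf:
  assumes "U \<in> borel_measurable M"
  shows "char (distr M borel U) t = mgf M U (\<i> * of_real t)"
  using assms by (simp add: char_def mgf_def integral_distr mult.assoc)

text \<open>Moment determinacy in the presence of an exponential moment: the case of a single
  factor, followed by uniqueness of characteristic functions.\<close>

lemma distr_eq_of_moment_fps:
  assumes M: "prob_space M" and N: "prob_space N" and U: "has_exp_moment M U" and V: "has_exp_moment N V"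
    and eq: "moment_fps M U = moment_fps N V"
  shows "distr M borel U = distr N borel V"
proof (rule Levy_uniqueness)
  have m: "U \<in> borel_measurable M" "V \<in> borel_measurable N" using U V unfolding has_exp_moment_def by auto
  show "real_distribution (distr M borel U)" "real_distribution (distr N borel V)"
    using m M N by (auto intro!: prob_space.real_distribution_distr)
  show "char (distr M borel U) = char (distr N borel V)"
  proof
    fix t show "char (distr M borel U) t = char (distr N borel V) t"
      using char_prod_of_moment_fps[of "{()}" N "\<lambda>_. V" M U t] V U eq m by (simp add: char_distr_eq_mgf)
  qed
qed

lemma moment_fps_distr_cong:
  assumes "U \<in> borel_measurable M" "V \<in> borel_measurable N" "distr M borel U = distr N borel V"
  shows "moment_fps M U = moment_fps N V"
proof -
  have "(\<integral>\<omega>. U \<omega> ^ n \<partial>M) = (\<integral>\<omega>. V \<omega> ^ n \<partial>N)" for n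
  proof -
    have "(\<integral>\<omega>. U \<omega> ^ n \<partial>M) = (\<integral>x. x ^ n \<partial>distr M borel U)" using assms(1) by (subst integral_distr) auto
    also have "\<dots> = (\<integral>\<omega>. V \<omega> ^ n \<partial>N)" unfolding assms(3) using assms(2) by (subst integral_distr) auto
    finally show ?thesis .
  qed
  thus ?thesis by (simp add: moment_fps_def)
qed

section \<open>Independence from factorizing characteristic functions\<close>

context prob_space begin

text \<open>\<open>g\<close> is read as a change of measure. The factorization says that
  \<open>V\<close> has the same characteristic function under the tilted measure as under
  \<open>M\<close>, so its law is unchanged, and expectations of indicators of \<open>V\<close>
  factorize as well.\<close>

lemma char_factor_real:
  assumes V[measurable]: "V \<in> borel_measurable M" and g[measurable]: "g \<in> borel_measurable M"
    and g1: "\<And>\<omega>. \<bar>g \<omega>\<bar> \<le> (1::real)"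
    and char: "\<And>s. (\<integral>\<omega>. of_real (g \<omega>) * iexp (s * V \<omega>) \<partial>M) = of_real (\<integral>\<omega>. g \<omega> \<partial>M) * (\<integral>\<omega>. iexp (s * V \<omega>) \<partial>M)"
    and A[measurable]: "A \<in> sets borel"
  shows "(\<integral>\<omega>. g \<omega> * indicator A (V \<omega>) \<partial>M) = (\<integral>\<omega>. g \<omega> \<partial>M) * measure M (V -` A \<inter> space M)"
proof -
  have int_g: "integrable M g" by (rule integrable_const_bound[of _ 1]) (use g1 in auto)
  define m where "m = (\<integral>\<omega>. g \<omega> \<partial>M)"
  have "\<bar>m\<bar> \<le> 1"
  proof -
    have "norm m \<le> (\<integral>\<omega>. norm (g \<omega>) \<partial>M)" unfolding m_def by (rule integral_norm_bound)
    also have "\<dots> \<le> (\<integral>\<omega>. 1 \<partial>M)" using g1 int_g by (intro integral_mono) auto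
    finally show ?thesis by (simp add: prob_space)
  qed
  hence m2: "2 + m > 0" by linarith
  \<comment> \<open>Since |g| \<le> 1, adding 2 makes the density positive; dividing by 2 + m
    normalizes it.\<close>
  define h where "h \<omega> = (2 + g \<omega>) / (2 + m)" for \<omega>
  have g2: "0 < 2 + g \<omega>" for \<omega> using g1[of \<omega>] by linarith
  have h0: "0 \<le> h \<omega>" for \<omega> unfolding h_def using m2 g2[of \<omega>] by simp
  have h[measurable]: "h \<in> borel_measurable M" unfolding h_def by measurable
  have int_h: "integrable M h" unfolding h_def using int_g by simp
  have h_one: "(\<integral>\<omega>. h \<omega> \<partial>M) = 1"
    unfolding h_def using int_g m2 by (simp add: prob_space m_def[symmetric])
  define N where "N = density M (\<lambda>\<omega>. ennreal (h \<omega>))"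
  have N: "prob_space N"
  proof
    have "emeasure N (space N) = (\<integral>\<^sup>+\<omega>. ennreal (h \<omega>) \<partial>M)"
      unfolding N_def by (subst emeasure_density) (auto intro!: nn_integral_cong)
    also have "\<dots> = ennreal (\<integral>\<omega>. h \<omega> \<partial>M)" using int_h h0 by (intro nn_integral_eq_integral) auto
    finally show "emeasure N (space N) = 1" by (simp add: h_one)
  qed
  have VN: "V \<in> borel_measurable N" by (simp add: N_def)
  have "distr N borel V = distr M borel V"
  proof (rule Levy_uniqueness)
    show "real_distribution (distr N borel V)" by (rule prob_space.real_distribution_distr[OF N VN])
    show "real_distribution (distr M borel V)" by (rule real_distribution_distr[OF V])
    show "char (distr N borel V) = char (distr M borel V)"
    proof
      fix s
      have ie: "integrable M (\<lambda>\<omega>. iexp (s * V \<omega>))" by (rule integrable_iexp) auto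
      have ig: "integrable M (\<lambda>\<omega>. of_real (g \<omega>) * iexp (s * V \<omega>))"
        by (rule integrable_const_bound[of _ 1]) (use g1 in \<open>auto simp: norm_mult\<close>)
      have "char (distr N borel V) s = (\<integral>\<omega>. iexp (s * V \<omega>) \<partial>N)" using VN by (simp add: char_def integral_distr)
      also have "\<dots> = (\<integral>\<omega>. h \<omega> *\<^sub>R iexp (s * V \<omega>) \<partial>M)"
        unfolding N_def using h0 by (subst integral_density) auto
      also have "\<dots> = (\<integral>\<omega>. (2 * iexp (s * V \<omega>) + of_real (g \<omega>) * iexp (s * V \<omega>)) / of_real (2 + m) \<partial>M)"
        by (intro Bochner_Integration.integral_cong refl) (simp add: h_def scaleR_conv_of_real distrib_right)
      also have "\<dots> = (2 * (\<integral>\<omega>. iexp (s * V \<omega>) \<partial>M) + (\<integral>\<omega>. of_real (g \<omega>) * iexp (s * V \<omega>) \<partial>M)) / of_real (2 + m)"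
        using ie ig by simp
      also have "\<dots> = (of_real (2 + m) * (\<integral>\<omega>. iexp (s * V \<omega>) \<partial>M)) / of_real (2 + m)"
        unfolding char m_def by (simp add: distrib_right)
      also have "\<dots> = char (distr M borel V) s"
        using m2 V by (simp add: char_def integral_distr del: of_real_add)
      finally show "char (distr N borel V) s = char (distr M borel V) s" .
    qed
  qed
  hence "measure N (V -` A \<inter> space N) = measure M (V -` A \<inter> space M)"
    using measure_distr[OF VN A] measure_distr[OF V A] by simp
  moreover have "measure N (V -` A \<inter> space N) = (\<integral>\<omega>. h \<omega> * indicator A (V \<omega>) \<partial>M)"
  proof -
    have S: "V -` A \<inter> space M \<in> sets M" by measurable
    have "measure N (V -` A \<inter> space N) = (\<integral>\<omega>. indicator A (V \<omega>) \<partial>N)"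
    proof -
      have "(\<integral>\<omega>. indicator A (V \<omega>) \<partial>N) = (\<integral>\<omega>. indicator (V -` A \<inter> space N) \<omega> \<partial>N :: real)"
        by (intro Bochner_Integration.integral_cong refl) (auto simp: indicator_def)
      also have "\<dots> = measure N (V -` A \<inter> space N)" by simp
      finally show ?thesis by simp
    qed
    also have "\<dots> = (\<integral>\<omega>. h \<omega> *\<^sub>R indicator A (V \<omega>) \<partial>M)"
      unfolding N_def using h0 by (subst integral_density) auto
    finally show ?thesis by simp
  qed
  moreover have "(\<integral>\<omega>. h \<omega> * indicator A (V \<omega>) \<partial>M) =
      (2 * measure M (V -` A \<inter> space M) + (\<integral>\<omega>. g \<omega> * indicator A (V \<omega>) \<partial>M)) / (2 + m)"
  proof -
    have i1: "integrable M (\<lambda>\<omega>. indicator A (V \<omega>) :: real)"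
      by (rule integrable_const_bound[of _ 1]) auto
    have i2: "integrable M (\<lambda>\<omega>. g \<omega> * indicator A (V \<omega>))"
      by (rule integrable_const_bound[of _ 1]) (use g1 in \<open>auto simp: indicator_def\<close>)
    have i3: "(\<integral>\<omega>. indicator A (V \<omega>) \<partial>M) = measure M (V -` A \<inter> space M)"
    proof -
      have "(\<integral>\<omega>. indicator A (V \<omega>) \<partial>M) = (\<integral>\<omega>. indicator (V -` A \<inter> space M) \<omega> \<partial>M :: real)"
        by (intro Bochner_Integration.integral_cong refl) (auto simp: indicator_def)
      thus ?thesis by simp
    qed
    have "(\<integral>\<omega>. h \<omega> * indicator A (V \<omega>) \<partial>M) = (\<integral>\<omega>. (2 * indicator A (V \<omega>) + g \<omega> * indicator A (V \<omega>)) / (2 + m) \<partial>M)"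
      by (intro Bochner_Integration.integral_cong refl) (simp add: h_def distrib_right)
    thus ?thesis using i1 i2 i3 by simp
  qed
  ultimately have "measure M (V -` A \<inter> space M) * (2 + m) = 2 * measure M (V -` A \<inter> space M) + (\<integral>\<omega>. g \<omega> * indicator A (V \<omega>) \<partial>M)"
    using m2 by (simp add: field_simps)
  thus ?thesis by (simp add: m_def[symmetric] algebra_simps)
qed

text \<open>Real and imaginary part are treated separately. The conjugate of \<open>g\<close>
  satisfies the same factorization because conjugation turns the exponential at s into the one at
  -s, and s is arbitrary.\<close>

lemma char_factor_complex:
  assumes V[measurable]: "V \<in> borel_measurable M" and g[measurable]: "g \<in> borel_measurable M"
    and g1: "\<And>\<omega>. cmod (g \<omega>) \<le> 1"
    and char: "\<And>s. (\<integral>\<omega>. g \<omega> * iexp (s * V \<omega>) \<partial>M) = (\<integral>\<omega>. g \<omega> \<partial>M) * (\<integral>\<omega>. iexp (s * V \<omega>) \<partial>M)"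
    and A[measurable]: "A \<in> sets borel"
  shows "(\<integral>\<omega>. g \<omega> * of_real (indicator A (V \<omega>)) \<partial>M) = (\<integral>\<omega>. g \<omega> \<partial>M) * of_real (measure M (V -` A \<inter> space M))"
proof -
  define e where "e s \<omega> = iexp (s * V \<omega>)" for s \<omega>
  have e_m[measurable]: "e s \<in> borel_measurable M" for s unfolding e_def by measurable
  have e1: "cmod (e s \<omega>) = 1" and cnj_e: "cnj (e s \<omega>) = e (- s) \<omega>" for s \<omega>
    by (simp_all add: e_def exp_cnj)
  have cnj_m[measurable]: "(\<lambda>\<omega>. cnj (g \<omega>)) \<in> borel_measurable M"
    using measurable_compose[OF g, of cnj borel] borel_measurable_continuous_onI[OF continuous_on_cnj[OF continuous_on_id]]
    by simp
  note char = char[folded e_def]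
  have int_g: "integrable M g" by (rule integrable_const_bound[of _ 1]) (use g1 in auto)
  have ie: "integrable M (e s)" for s
    by (rule integrable_const_bound[of _ 1]) (use e1 in auto)
  have ig: "integrable M (\<lambda>\<omega>. g \<omega> * e s \<omega>)" for s
    by (rule integrable_const_bound[of _ 1]) (use g1 in \<open>auto simp: norm_mult e1\<close>)
  have icg: "integrable M (\<lambda>\<omega>. cnj (g \<omega>) * e s \<omega>)" for s
    by (rule integrable_const_bound[of _ 1]) (use g1 in \<open>auto simp: norm_mult e1\<close>)
  have char': "(\<integral>\<omega>. cnj (g \<omega>) * e s \<omega> \<partial>M) = cnj (\<integral>\<omega>. g \<omega> \<partial>M) * (\<integral>\<omega>. e s \<omega> \<partial>M)" for s
  proof -
    have "(\<integral>\<omega>. cnj (g \<omega>) * e s \<omega> \<partial>M) = (\<integral>\<omega>. cnj (g \<omega> * e (- s) \<omega>) \<partial>M)"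
      by (intro Bochner_Integration.integral_cong refl) (simp add: cnj_e)
    also have "\<dots> = cnj (\<integral>\<omega>. g \<omega> * e (- s) \<omega> \<partial>M)" by (rule integral_bounded_linear[OF bounded_linear_cnj ig])
    also have "\<dots> = cnj (\<integral>\<omega>. g \<omega> \<partial>M) * cnj (\<integral>\<omega>. e (- s) \<omega> \<partial>M)" by (simp add: char)
    also have "cnj (\<integral>\<omega>. e (- s) \<omega> \<partial>M) = (\<integral>\<omega>. cnj (e (- s) \<omega>) \<partial>M)"
      by (rule integral_bounded_linear[OF bounded_linear_cnj ie, symmetric])
    also have "\<dots> = (\<integral>\<omega>. e s \<omega> \<partial>M)" by (simp add: cnj_e)
    finally show ?thesis .
  qed
  have half: "complex_of_real (2 * x) * \<i> * y / (2 * \<i>) = of_real x * y" for x y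
    by (simp add: field_simps)
  have re: "(\<integral>\<omega>. Re (g \<omega>) * indicator A (V \<omega>) \<partial>M) = (\<integral>\<omega>. Re (g \<omega>) \<partial>M) * measure M (V -` A \<inter> space M)"
  proof (rule char_factor_real[OF V _ _ _ A, folded e_def])
    show "\<bar>Re (g \<omega>)\<bar> \<le> 1" for \<omega> using abs_Re_le_cmod[of "g \<omega>"] g1[of \<omega>] by linarith
    fix s
    have "(\<integral>\<omega>. of_real (Re (g \<omega>)) * e s \<omega> \<partial>M) = (\<integral>\<omega>. (g \<omega> * e s \<omega> + cnj (g \<omega>) * e s \<omega>) / 2 \<partial>M)"
      by (intro Bochner_Integration.integral_cong refl)
        (simp add: distrib_right[symmetric] complex_add_cnj)
    also have "\<dots> = ((\<integral>\<omega>. g \<omega> * e s \<omega> \<partial>M) + (\<integral>\<omega>. cnj (g \<omega>) * e s \<omega> \<partial>M)) / 2"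
      using ig icg by simp
    also have "\<dots> = of_real (\<integral>\<omega>. Re (g \<omega>) \<partial>M) * (\<integral>\<omega>. e s \<omega> \<partial>M)"
      unfolding char char' integral_Re[OF int_g] distrib_right[symmetric] complex_add_cnj by simp
    finally show "(\<integral>\<omega>. of_real (Re (g \<omega>)) * e s \<omega> \<partial>M) = of_real (\<integral>\<omega>. Re (g \<omega>) \<partial>M) * (\<integral>\<omega>. e s \<omega> \<partial>M)" .
  qed measurable
  have im: "(\<integral>\<omega>. Im (g \<omega>) * indicator A (V \<omega>) \<partial>M) = (\<integral>\<omega>. Im (g \<omega>) \<partial>M) * measure M (V -` A \<inter> space M)"
  proof (rule char_factor_real[OF V _ _ _ A, folded e_def])
    show "\<bar>Im (g \<omega>)\<bar> \<le> 1" for \<omega> using abs_Im_le_cmod[of "g \<omega>"] g1[of \<omega>] by linarith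
    fix s
    have "(\<integral>\<omega>. of_real (Im (g \<omega>)) * e s \<omega> \<partial>M) = (\<integral>\<omega>. (g \<omega> * e s \<omega> - cnj (g \<omega>) * e s \<omega>) / (2 * \<i>) \<partial>M)"
      by (intro Bochner_Integration.integral_cong refl)
        (simp only: left_diff_distrib[symmetric] complex_diff_cnj half)
    also have "\<dots> = ((\<integral>\<omega>. g \<omega> * e s \<omega> \<partial>M) - (\<integral>\<omega>. cnj (g \<omega>) * e s \<omega> \<partial>M)) / (2 * \<i>)"
      using ig icg by (subst integral_divide_zero) simp
    also have "\<dots> = of_real (\<integral>\<omega>. Im (g \<omega>) \<partial>M) * (\<integral>\<omega>. e s \<omega> \<partial>M)"
      unfolding char char' integral_Im[OF int_g] left_diff_distrib[symmetric] complex_diff_cnj by (rule half)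
    finally show "(\<integral>\<omega>. of_real (Im (g \<omega>)) * e s \<omega> \<partial>M) = of_real (\<integral>\<omega>. Im (g \<omega>) \<partial>M) * (\<integral>\<omega>. e s \<omega> \<partial>M)" .
  qed measurable
  have int: "integrable M (\<lambda>\<omega>. g \<omega> * of_real (indicator A (V \<omega>)))"
    by (rule integrable_const_bound[of _ 1]) (use g1 in \<open>auto simp: norm_mult indicator_def\<close>)
  show ?thesis
  proof (rule complex_eqI)
    show "Re (\<integral>\<omega>. g \<omega> * of_real (indicator A (V \<omega>)) \<partial>M) = Re ((\<integral>\<omega>. g \<omega> \<partial>M) * of_real (measure M (V -` A \<inter> space M)))"
      using re integral_Re[OF int] integral_Re[OF int_g] by simp
    show "Im (\<integral>\<omega>. g \<omega> * of_real (indicator A (V \<omega>)) \<partial>M) = Im ((\<integral>\<omega>. g \<omega> \<partial>M) * of_real (measure M (V -` A \<inter> space M)))"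
      using im integral_Im[OF int] integral_Im[OF int_g] by simp
  qed
qed

text \<open>Kac's theorem, by replacing the exponentials with indicators one coordinate at a time.\<close>

lemma indep_vars_of_char:
  fixes V :: "'i \<Rightarrow> 'a \<Rightarrow> real"
  assumes J: "finite J" and V[measurable]: "\<And>j. j \<in> J \<Longrightarrow> V j \<in> borel_measurable M"
    and char: "\<And>t. (\<integral>\<omega>. iexp (\<Sum>j\<in>J. t j * V j \<omega>) \<partial>M) = (\<Prod>j\<in>J. \<integral>\<omega>. iexp (t j * V j \<omega>) \<partial>M)"
  shows "indep_vars (\<lambda>_. borel) V J"
proof -
  define P where "P A j = measure M (V j -` A j \<inter> space M)" for A :: "'i \<Rightarrow> real set" and j
  define E where "E t j = (\<integral>\<omega>. iexp (t j * V j \<omega>) \<partial>M)" for t :: "'i \<Rightarrow> real" and j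
  define I where "I A B \<omega> = (\<Prod>j\<in>B. of_real (indicator (A j) (V j \<omega>)) :: complex)" for A B \<omega>
  \<comment> \<open>Coordinates in \<open>B\<close> carry indicators, the others still carry
    exponentials. The frequencies \<open>t\<close> stay general because moving one more coordinate
    into \<open>B\<close> uses the identity at every frequency of that coordinate.\<close>
  have step: "(\<integral>\<omega>. I A B \<omega> * iexp (\<Sum>j\<in>J - B. t j * V j \<omega>) \<partial>M) = (\<Prod>j\<in>B. of_real (P A j)) * (\<Prod>j\<in>J - B. E t j)"
    if B: "finite B" "B \<subseteq> J" and A: "\<And>j. j \<in> J \<Longrightarrow> A j \<in> sets borel" for A B t
    using B
  proof (induction B arbitrary: t rule: finite_induct)
    case empty
    thus ?case using char[of t] by (simp add: I_def E_def)
  next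
    case (insert k B)
    hence k: "k \<in> J" "k \<notin> B" and BJ: "B \<subseteq> J" by auto
    have JB: "J - B = insert k (J - insert k B)" using k by auto
    have fJ: "finite (J - insert k B)" using J by simp
    \<comment> \<open>Everything except the coordinate \<open>k\<close> that is exchanged next. The
      induction hypothesis at \<open>t(k := s)\<close>, for all s, is the factorization needed to
      replace its exponential by an indicator.\<close>
    define g where "g \<omega> = I A B \<omega> * iexp (\<Sum>j\<in>J - insert k B. t j * V j \<omega>)" for \<omega>
    have [measurable]: "(\<lambda>\<omega>. indicator (A j) (V j \<omega>) :: real) \<in> borel_measurable M" if "j \<in> J" for j
      using V[OF that] A[OF that] by measurable
    have g_m: "g \<in> borel_measurable M" unfolding g_def I_def
      using BJ by (intro borel_measurable_times borel_measurable_prod borel_measurable_of_real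
          borel_measurable_exp borel_measurable_const borel_measurable_sum V) auto
    have I1: "norm (I A B \<omega>) \<le> 1" for \<omega>
      unfolding I_def prod_norm[symmetric] by (intro prod_le_1) (auto simp: indicator_def)
    have g1: "cmod (g \<omega>) \<le> 1" for \<omega>
      unfolding g_def norm_mult using I1[of \<omega>] by simp
    have gs: "(\<integral>\<omega>. g \<omega> * iexp (s * V k \<omega>) \<partial>M) = (\<Prod>j\<in>B. of_real (P A j)) * ((\<integral>\<omega>. iexp (s * V k \<omega>) \<partial>M) * (\<Prod>j\<in>J - insert k B. E t j))" for s
    proof -
      have "(\<integral>\<omega>. g \<omega> * iexp (s * V k \<omega>) \<partial>M) = (\<integral>\<omega>. I A B \<omega> * iexp (\<Sum>j\<in>J - B. (t(k := s)) j * V j \<omega>) \<partial>M)"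
      proof (intro Bochner_Integration.integral_cong refl)
        fix \<omega>
        have "(\<Sum>j\<in>J - B. (t(k := s)) j * V j \<omega>) = s * V k \<omega> + (\<Sum>j\<in>J - insert k B. t j * V j \<omega>)"
          unfolding JB using fJ by (subst sum.insert) (auto intro!: sum.cong)
        thus "g \<omega> * iexp (s * V k \<omega>) = I A B \<omega> * iexp (\<Sum>j\<in>J - B. (t(k := s)) j * V j \<omega>)"
          by (simp add: g_def exp_add[symmetric] algebra_simps)
      qed
      also have "\<dots> = (\<Prod>j\<in>B. of_real (P A j)) * (\<Prod>j\<in>J - B. E (t(k := s)) j)" by (rule insert.IH[OF BJ])
      also have "(\<Prod>j\<in>J - B. E (t(k := s)) j) = (\<integral>\<omega>. iexp (s * V k \<omega>) \<partial>M) * (\<Prod>j\<in>J - insert k B. E t j)"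
        unfolding JB using fJ by (subst prod.insert) (auto simp: E_def intro!: prod.cong)
      finally show ?thesis .
    qed
    have g0: "(\<integral>\<omega>. g \<omega> \<partial>M) = (\<Prod>j\<in>B. of_real (P A j)) * (\<Prod>j\<in>J - insert k B. E t j)"
      using gs[of 0] by (simp add: prob_space)
    have "(\<integral>\<omega>. g \<omega> * of_real (indicator (A k) (V k \<omega>)) \<partial>M) = (\<integral>\<omega>. g \<omega> \<partial>M) * of_real (P A k)"
      unfolding P_def by (rule char_factor_complex[OF V[OF k(1)] g_m g1 _ A[OF k(1)]]) (simp only: gs g0 mult_ac)
    moreover have "I A (insert k B) \<omega> * iexp (\<Sum>j\<in>J - insert k B. t j * V j \<omega>) = g \<omega> * of_real (indicator (A k) (V k \<omega>))" for \<omega>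
      unfolding g_def I_def using insert.hyps k by simp
    ultimately show ?case using insert.hyps k by (simp add: g0)
  qed
  show ?thesis unfolding indep_vars_def2
  proof (intro conjI ballI indep_setsI)
    fix A L assume L: "L \<noteq> {}" "L \<subseteq> J" "finite L" and AL: "\<forall>j\<in>L. A j \<in> {V j -` B \<inter> space M |B. B \<in> sets borel}"
    then have "\<forall>j\<in>L. \<exists>B. B \<in> sets borel \<and> A j = V j -` B \<inter> space M" by blast
    then obtain B where B: "\<And>j. j \<in> L \<Longrightarrow> B j \<in> sets borel" "\<And>j. j \<in> L \<Longrightarrow> A j = V j -` B j \<inter> space M"
      using bchoice by metis
    \<comment> \<open>Coordinates outside \<open>L\<close> get the whole line, as
      \<open>step\<close> asks for Borel sets on all of \<open>J\<close>; with frequencies 0 the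
      remaining exponentials are 1.\<close>
    define B' where "B' j = (if j \<in> L then B j else UNIV)" for j
    have "complex_of_real (prob (\<Inter>j\<in>L. A j)) = (\<integral>\<omega>. I B' L \<omega> \<partial>M)"
    proof -
      have "A j \<in> events" if "j \<in> L" for j
        unfolding B(2)[OF that] using B(1)[OF that] V[of j] that L by (intro measurable_sets[of _ _ borel]) auto
      hence S: "(\<Inter>j\<in>L. A j) \<in> events" using L by (intro sets.finite_INT) auto
      have "(\<integral>\<omega>. I B' L \<omega> \<partial>M) = (\<integral>\<omega>. complex_of_real (indicator (\<Inter>j\<in>L. A j) \<omega>) \<partial>M)"
      proof (intro Bochner_Integration.integral_cong refl)
        fix \<omega> assume w: "\<omega> \<in> space M"
        have "I B' L \<omega> = of_real (\<Prod>j\<in>L. indicator (A j) \<omega>)"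
          unfolding I_def of_real_prod using w B(2) by (intro prod.cong refl) (auto simp: B'_def indicator_def)
        also have "(\<Prod>j\<in>L. indicator (A j) \<omega> :: real) = indicator (\<Inter>j\<in>L. A j) \<omega>"
          using L by (auto simp: indicator_def prod_zero_iff)
        finally show "I B' L \<omega> = complex_of_real (indicator (\<Inter>j\<in>L. A j) \<omega>)" .
      qed
      thus ?thesis using S by (simp add: integral_complex_of_real)
    qed
    also have "\<dots> = (\<Prod>j\<in>L. of_real (P B' j))"
      using step[of L B' "\<lambda>_. 0"] L B(1) by (simp add: B'_def E_def prob_space)
    also have "\<dots> = complex_of_real (\<Prod>j\<in>L. prob (A j))"
      unfolding of_real_prod by (intro prod.cong refl) (simp add: P_def B'_def B(2))
    finally show "prob (\<Inter>j\<in>L. A j) = (\<Prod>j\<in>L. prob (A j))" by (simp only: of_real_eq_iff)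
  qed (use V in auto)
qed

lemma indep_vars_of_moment_fps:
  fixes V :: "'i \<Rightarrow> 'a \<Rightarrow> real"
  assumes J: "finite J" and V: "\<And>j. j \<in> J \<Longrightarrow> has_exp_moment M (V j)"
    and eq: "\<And>t. moment_fps M (\<lambda>\<omega>. \<Sum>j\<in>J. t j * V j \<omega>) = (\<Prod>j\<in>J. moment_fps M (\<lambda>\<omega>. t j * V j \<omega>))"
  shows "indep_vars (\<lambda>_. borel) V J"
proof (rule indep_vars_of_char[OF J])
  show "V j \<in> borel_measurable M" if "j \<in> J" for j using V[OF that] unfolding has_exp_moment_def by blast
  fix t
  \<comment> \<open>The coefficients \<open>t\<close> are part of the random variables, so the
    characteristic functions are compared at the single point 1.\<close>
  have "mgf M (\<lambda>\<omega>. \<Sum>j\<in>J. t j * V j \<omega>) (\<i> * of_real 1) = (\<Prod>j\<in>J. mgf M (\<lambda>\<omega>. t j * V j \<omega>) (\<i> * of_real 1))"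
    using J V eq[of t] by (intro char_prod_of_moment_fps) (auto intro!: has_exp_moment_sum has_exp_moment_cmult)
  thus "(\<integral>\<omega>. iexp (\<Sum>j\<in>J. t j * V j \<omega>) \<partial>M) = (\<Prod>j\<in>J. \<integral>\<omega>. iexp (t j * V j \<omega>) \<partial>M)"
    by (simp add: mgf_def)
qed

end

section \<open>Gaussian spaces\<close>

lemma (in prob_space) centered_normal_cases:
  assumes "centered_normal M U"
  obtains (zero) "AE \<omega> in M. U \<omega> = 0" | (normal) \<sigma> where "0 < \<sigma>" "distributed M lborel U (normal_density 0 \<sigma>)"
proof -
  from assms obtain \<sigma> where U[measurable]: "U \<in> borel_measurable M" and \<sigma>: "\<sigma> \<ge> 0"
    and d: "distr M borel U = (if \<sigma> = 0 then return borel 0 else density lborel (normal_density 0 \<sigma>))"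
    unfolding centered_normal_def by blast
  show ?thesis
  proof (cases "\<sigma> = 0")
    case True
    have "AE x in distr M borel U. x = 0" using d True by (subst d) (simp add: AE_return)
    hence "AE \<omega> in M. U \<omega> = 0" by (subst (asm) AE_distr_iff) auto
    thus ?thesis by (rule zero)
  next
    case False
    have "distr M lborel U = distr M borel U" by (rule distr_cong) auto
    hence "distributed M lborel U (normal_density 0 \<sigma>)" unfolding distributed_def using d False by auto
    thus ?thesis using normal \<sigma> False by (metis order_less_le)
  qed
qed

text \<open>Completing the exponent: with q = 1 - \<sigma>^2/2 the product is a Gaussian of
  deviation \<sigma> / sqrt q up to normalization. \<sigma> \<le> 1 gives q \<ge> 1/2, so the change
  1 / sqrt q of the normalizing constant is at most 2.\<close>

lemma normal_density_exp_square:
  assumes "0 < \<sigma>" "\<sigma> \<le> 1"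
  shows "exp (x\<^sup>2 / 4) * normal_density 0 \<sigma> x \<le> 2 * normal_density 0 (\<sigma> / sqrt (1 - \<sigma>\<^sup>2 / 2)) x"
proof -
  define q where "q = 1 - \<sigma>\<^sup>2 / 2"
  have "\<sigma>\<^sup>2 \<le> 1" using assms by (simp add: power_le_one)
  hence q: "q \<ge> 1 / 2" by (simp add: q_def)
  have "exp (x\<^sup>2 / 4) * normal_density 0 \<sigma> x = 1 / sqrt (2 * pi * \<sigma>\<^sup>2) * exp (x\<^sup>2 / 4 + - x\<^sup>2 / (2 * \<sigma>\<^sup>2))"
    by (simp add: normal_density_def exp_add[symmetric])
  also have "x\<^sup>2 / 4 + - x\<^sup>2 / (2 * \<sigma>\<^sup>2) = - x\<^sup>2 / (2 * (\<sigma> / sqrt q)\<^sup>2)"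
    using assms q by (simp add: power_divide field_simps q_def)
  also have "1 / sqrt (2 * pi * \<sigma>\<^sup>2) \<le> 2 * (1 / sqrt (2 * pi * (\<sigma> / sqrt q)\<^sup>2))"
  proof -
    have "sqrt (2 * pi * (\<sigma> / sqrt q)\<^sup>2) = sqrt (2 * pi * \<sigma>\<^sup>2) / sqrt q"
      using q by (simp add: power_divide real_sqrt_divide[symmetric])
    moreover have "1 \<le> 2 * sqrt q"
    proof -
      have "1 / 2 \<le> sqrt q" using q by (intro real_le_rsqrt) (simp add: power2_eq_square)
      thus ?thesis by simp
    qed
    moreover have "0 < sqrt (2 * pi * \<sigma>\<^sup>2)" using assms by simp
    ultimately show ?thesis using divide_right_mono[of 1 "2 * sqrt q" "sqrt (2 * pi * \<sigma>\<^sup>2)"] by simp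
  qed
  finally show ?thesis unfolding normal_density_def q_def by (simp add: mult_right_mono)
qed

text \<open>The facts about the normal law on which the Gaussian spaces are built, with one \<sigma>
  shared by variance, characteristic function and exponential square bound. The same formulas cover
  the degenerate case \<sigma> = 0.\<close>

lemma (in prob_space) centered_normal_facts:
  assumes cn: "centered_normal M U"
  shows "U \<in> borel_measurable M"
    and "\<exists>\<sigma>\<ge>0. (\<integral>\<omega>. (U \<omega>)\<^sup>2 \<partial>M) = \<sigma>\<^sup>2 \<and> integrable M (\<lambda>\<omega>. (U \<omega>)\<^sup>2) \<and> (\<integral>\<omega>. iexp (U \<omega>) \<partial>M) = exp (- of_real (\<sigma>\<^sup>2) / 2)
      \<and> (\<sigma> \<le> 1 \<longrightarrow> (\<integral>\<^sup>+\<omega>. ennreal (exp ((U \<omega>)\<^sup>2 / 4)) \<partial>M) \<le> 2)"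
proof -
  show U[measurable]: "U \<in> borel_measurable M" using cn unfolding centered_normal_def by blast
  from cn show "\<exists>\<sigma>\<ge>0. (\<integral>\<omega>. (U \<omega>)\<^sup>2 \<partial>M) = \<sigma>\<^sup>2 \<and> integrable M (\<lambda>\<omega>. (U \<omega>)\<^sup>2) \<and> (\<integral>\<omega>. iexp (U \<omega>) \<partial>M) = exp (- of_real (\<sigma>\<^sup>2) / 2)
      \<and> (\<sigma> \<le> 1 \<longrightarrow> (\<integral>\<^sup>+\<omega>. ennreal (exp ((U \<omega>)\<^sup>2 / 4)) \<partial>M) \<le> 2)"
  proof (cases rule: centered_normal_cases)
    case zero
    have "(\<integral>\<omega>. (U \<omega>)\<^sup>2 \<partial>M) = (\<integral>\<omega>. 0 \<partial>M)" using zero by (intro integral_cong_AE) auto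
    moreover have "integrable M (\<lambda>\<omega>. (U \<omega>)\<^sup>2)"
      using zero by (subst integrable_cong_AE[where g = "\<lambda>_. 0"]) auto
    moreover have "(\<integral>\<omega>. iexp (U \<omega>) \<partial>M) = (\<integral>\<omega>. 1 \<partial>M)" using zero by (intro integral_cong_AE) auto
    moreover have "(\<integral>\<^sup>+\<omega>. ennreal (exp ((U \<omega>)\<^sup>2 / 4)) \<partial>M) = (\<integral>\<^sup>+\<omega>. 1 \<partial>M)" using zero by (intro nn_integral_cong_AE) auto
    ultimately show ?thesis by (intro exI[of _ 0]) (auto simp: prob_space emeasure_space_1)
  next
    case (normal \<sigma>)
    have sq: "(\<integral>\<omega>. (U \<omega>)\<^sup>2 \<partial>M) = \<sigma>\<^sup>2"
    proof -
      have "(\<integral>\<omega>. (U \<omega>)\<^sup>2 \<partial>M) = (\<integral>x. normal_density 0 \<sigma> x * x\<^sup>2 \<partial>lborel)"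
        using normal by (subst distributed_integral[OF normal(2), symmetric]) auto
      also have "\<dots> = \<sigma>\<^sup>2" using integral_normal_moment_even[OF normal(1), of 0 1] by simp
      finally show ?thesis .
    qed
    have int: "integrable M (\<lambda>\<omega>. (U \<omega>)\<^sup>2)"
      using distributed_integrable[OF normal(2), of "\<lambda>x. x\<^sup>2"] integrable_normal_moment[OF normal(1), of 0 2] by simp
    have ch: "(\<integral>\<omega>. iexp (U \<omega>) \<partial>M) = exp (- of_real (\<sigma>\<^sup>2) / 2)"
    proof -
      have d: "distributed M lborel (\<lambda>\<omega>. U \<omega> / \<sigma>) std_normal_density"
        using normal_standard_normal_convert[OF normal(1), of U 0] normal(2) by simp
      have "distr M borel (\<lambda>\<omega>. U \<omega> / \<sigma>) = distr M lborel (\<lambda>\<omega>. U \<omega> / \<sigma>)" by (rule distr_cong) auto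
      also have "\<dots> = density lborel std_normal_density" using d unfolding distributed_def by simp
      finally have "char (distr M borel (\<lambda>\<omega>. U \<omega> / \<sigma>)) \<sigma> = of_real (exp (- \<sigma>\<^sup>2 / 2))"
        by (simp add: char_std_normal_distribution)
      moreover have "char (distr M borel (\<lambda>\<omega>. U \<omega> / \<sigma>)) \<sigma> = (\<integral>\<omega>. iexp (U \<omega>) \<partial>M)"
        using normal(1) by (simp add: char_def integral_distr)
      ultimately show ?thesis by (simp add: exp_of_real[symmetric])
    qed
    have nn: "(\<integral>\<^sup>+\<omega>. ennreal (exp ((U \<omega>)\<^sup>2 / 4)) \<partial>M) \<le> 2" if s1: "\<sigma> \<le> 1"
    proof -
      define s where "s = \<sigma> / sqrt (1 - \<sigma>\<^sup>2 / 2)"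
      have "\<sigma>\<^sup>2 \<le> 1" using normal s1 by (simp add: power_le_one)
      hence s: "s > 0" using normal(1) by (simp add: s_def)
      have "(\<integral>\<^sup>+\<omega>. ennreal (exp ((U \<omega>)\<^sup>2 / 4)) \<partial>M) = (\<integral>\<^sup>+x. ennreal (normal_density 0 \<sigma> x) * ennreal (exp (x\<^sup>2 / 4)) \<partial>lborel)"
        by (subst distributed_nn_integral[OF normal(2), symmetric]) auto
      also have "\<dots> \<le> (\<integral>\<^sup>+x. ennreal (2 * normal_density 0 s x) \<partial>lborel)"
        unfolding s_def using normal_density_exp_square[OF normal(1) s1]
        by (intro nn_integral_mono) (auto simp: ennreal_mult'[symmetric] mult.commute intro!: ennreal_leI)
      also have "\<dots> = ennreal (\<integral>x. 2 * normal_density 0 s x \<partial>lborel)"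
        using s by (intro nn_integral_eq_integral) auto
      also have "\<dots> = 2" using s by simp
      finally show ?thesis .
    qed
    show ?thesis using normal(1) sq int ch nn by (intro exI[of _ \<sigma>]) auto
  qed
qed

text \<open>A class closed under sums and products; it settles the integrability questions in the
  calculus below.\<close>

definition all_moments :: "'w measure \<Rightarrow> ('w \<Rightarrow> real) \<Rightarrow> bool" where
  "all_moments M U \<longleftrightarrow> U \<in> borel_measurable M \<and> (\<forall>p. integrable M (\<lambda>\<omega>. \<bar>U \<omega>\<bar> ^ p))"

lemma power_le_fact_exp: "0 \<le> (x::real) \<Longrightarrow> x ^ n \<le> fact n * exp x"
proof -
  assume x: "0 \<le> x"
  have "x ^ n / fact n \<le> (\<Sum>i<Suc n. x ^ i / fact i)" using x by (intro member_le_sum) auto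
  also have "\<dots> \<le> exp x" by (rule sum_power_fact_le_exp[OF x])
  finally show ?thesis by (simp add: field_simps)
qed

lemma has_exp_moment_all_moments:
  assumes "has_exp_moment M U"
  shows "all_moments M U"
proof -
  from assms obtain a where U[measurable]: "U \<in> borel_measurable M" and a: "a > 0" "integrable M (\<lambda>\<omega>. exp (a * \<bar>U \<omega>\<bar>))"
    unfolding has_exp_moment_def by blast
  have "integrable M (\<lambda>\<omega>. \<bar>U \<omega>\<bar> ^ p)" for p
  proof (rule Bochner_Integration.integrable_bound)
    show "integrable M (\<lambda>\<omega>. fact p / a ^ p * exp (a * \<bar>U \<omega>\<bar>))" using a by simp
    have "\<bar>U \<omega>\<bar> ^ p \<le> fact p / a ^ p * exp (a * \<bar>U \<omega>\<bar>)" for \<omega>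
      using power_le_fact_exp[of "a * \<bar>U \<omega>\<bar>" p] a(1) by (simp add: power_mult_distrib field_simps)
    thus "AE \<omega> in M. norm (\<bar>U \<omega>\<bar> ^ p) \<le> norm (fact p / a ^ p * exp (a * \<bar>U \<omega>\<bar>))"
      using a(1) by (intro AE_I2) (simp add: abs_mult)
  qed measurable
  thus ?thesis unfolding all_moments_def using U by blast
qed

lemma all_moments_mult:
  assumes "all_moments M U" "all_moments M V"
  shows "all_moments M (\<lambda>\<omega>. U \<omega> * V \<omega>)"
proof -
  have [measurable]: "U \<in> borel_measurable M" "V \<in> borel_measurable M" using assms unfolding all_moments_def by auto
  have "integrable M (\<lambda>\<omega>. \<bar>U \<omega> * V \<omega>\<bar> ^ p)" for p
  proof (rule Bochner_Integration.integrable_bound)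
    show "integrable M (\<lambda>\<omega>. \<bar>U \<omega>\<bar> ^ (2 * p) + \<bar>V \<omega>\<bar> ^ (2 * p))"
      using assms unfolding all_moments_def by (intro Bochner_Integration.integrable_add) blast+
    have "\<bar>U \<omega> * V \<omega>\<bar> ^ p \<le> \<bar>U \<omega>\<bar> ^ (2 * p) + \<bar>V \<omega>\<bar> ^ (2 * p)" for \<omega>
    proof -
      have "x * y \<le> x\<^sup>2 + y\<^sup>2" if "0 \<le> x" "0 \<le> y" for x y :: real
        using sum_squares_bound[of x y] mult_nonneg_nonneg[OF that] by linarith
      from this[of "\<bar>U \<omega>\<bar> ^ p" "\<bar>V \<omega>\<bar> ^ p"] show ?thesis by (simp add: abs_mult power_mult_distrib power_mult[symmetric] mult.commute)
    qed
    thus "AE \<omega> in M. norm (\<bar>U \<omega> * V \<omega>\<bar> ^ p) \<le> norm (\<bar>U \<omega>\<bar> ^ (2 * p) + \<bar>V \<omega>\<bar> ^ (2 * p))"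
      by (intro AE_I2) (simp add: add_nonneg_nonneg)
  qed measurable
  thus ?thesis unfolding all_moments_def by auto
qed

lemma (in prob_space) all_moments_const: "all_moments M (\<lambda>_. c)"
  unfolding all_moments_def by auto

lemma (in prob_space) all_moments_power: "all_moments M U \<Longrightarrow> all_moments M (\<lambda>\<omega>. U \<omega> ^ n)"
  by (induction n) (auto simp: all_moments_const intro: all_moments_mult)

lemma all_moments_integrable:
  assumes "all_moments M U"
  shows "integrable M U"
proof -
  have "integrable M (\<lambda>\<omega>. \<bar>U \<omega>\<bar> ^ 1)" using assms unfolding all_moments_def by blast
  thus ?thesis by (rule Bochner_Integration.integrable_bound) (use assms in \<open>auto simp: all_moments_def\<close>)
qed

section \<open>Differentiation of Fourier integrals along a sequence\<close>

lemma cmod_iexp_diff_le: "cmod (iexp x - 1) \<le> \<bar>x\<bar>"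
  using iexp_approx1[of x 0] by (simp add: norm_minus_commute)

text \<open>Difference quotients are taken along 1/(n + 1), so that dominated convergence and
  uniqueness of sequential limits apply to them directly.\<close>

lemma seq_derivative:
  fixes f :: "complex \<Rightarrow> complex"
  assumes "(f has_field_derivative D) (at 0)"
  shows "(\<lambda>n. (f (of_real (1 / real (Suc n))) - f 0) * of_real (real (Suc n))) \<longlonglongrightarrow> D"
proof -
  have lim: "(\<lambda>n. complex_of_real (1 / real (Suc n))) \<longlonglongrightarrow> of_real 0"
    using LIMSEQ_inverse_real_of_nat by (intro tendsto_of_real) (simp add: inverse_eq_divide)
  have "filterlim (\<lambda>n. complex_of_real (1 / real (Suc n))) (at 0) sequentially"
    unfolding filterlim_at using lim by (auto simp: of_real_eq_0_iff simp del: of_real_divide of_real_of_nat_eq of_nat_Suc)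
  from filterlim_compose[OF DERIV_D[OF assms] this]
  show ?thesis by (simp add: field_simps)
qed

text \<open>Differentiation under the integral sign: |exp(i x) - 1| \<le> |x| dominates the
  difference quotients by |W G|.\<close>

lemma (in prob_space) iexp_seq_derivative:
  assumes W: "integrable M W" and G[measurable]: "G \<in> borel_measurable M" and S[measurable]: "S \<in> borel_measurable M"
    and WG: "integrable M (\<lambda>\<omega>. W \<omega> * G \<omega>)"
  shows "(\<lambda>n. ((\<integral>\<omega>. of_real (W \<omega>) * iexp (S \<omega> + 1 / real (Suc n) * G \<omega>) \<partial>M) - (\<integral>\<omega>. of_real (W \<omega>) * iexp (S \<omega>) \<partial>M)) * of_real (real (Suc n)))
     \<longlonglongrightarrow> \<i> * (\<integral>\<omega>. of_real (W \<omega> * G \<omega>) * iexp (S \<omega>) \<partial>M)"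
proof -
  have Wm[measurable]: "W \<in> borel_measurable M" using W by simp
  have int: "integrable M (\<lambda>\<omega>. of_real (W \<omega>) * iexp (X \<omega>))" if [measurable]: "X \<in> borel_measurable M" for X
    by (rule Bochner_Integration.integrable_bound[OF W]) (auto simp: norm_mult)
  define f where "f n \<omega> = of_real (W \<omega>) * iexp (S \<omega>) * ((iexp (1 / real (Suc n) * G \<omega>) - 1) * of_real (real (Suc n)))" for n \<omega>
  have "(\<lambda>n. integral\<^sup>L M (f n)) \<longlonglongrightarrow> (\<integral>\<omega>. \<i> * (of_real (W \<omega> * G \<omega>) * iexp (S \<omega>)) \<partial>M)"
  proof (rule integral_dominated_convergence)
    show "integrable M (\<lambda>\<omega>. \<bar>W \<omega> * G \<omega>\<bar>)" using WG by simp
    show "AE \<omega> in M. (\<lambda>n. f n \<omega>) \<longlonglongrightarrow> \<i> * (of_real (W \<omega> * G \<omega>) * iexp (S \<omega>))"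
    proof (rule AE_I2)
      fix \<omega>
      have "((\<lambda>z. exp (\<i> * z * of_real (G \<omega>))) has_field_derivative \<i> * of_real (G \<omega>)) (at 0)"
        by (auto intro!: derivative_eq_intros)
      from tendsto_mult_left[OF seq_derivative[OF this], of "of_real (W \<omega>) * iexp (S \<omega>)"]
      show "(\<lambda>n. f n \<omega>) \<longlonglongrightarrow> \<i> * (of_real (W \<omega> * G \<omega>) * iexp (S \<omega>))" by (simp add: f_def mult_ac)
    qed
    show "AE \<omega> in M. norm (f n \<omega>) \<le> \<bar>W \<omega> * G \<omega>\<bar>" for n
    proof (rule AE_I2)
      fix \<omega>
      have "norm (f n \<omega>) = \<bar>W \<omega>\<bar> * (cmod (iexp (1 / real (Suc n) * G \<omega>) - 1) * real (Suc n))"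
        by (simp add: f_def norm_mult del: of_nat_Suc)
      also have "\<dots> \<le> \<bar>W \<omega>\<bar> * (\<bar>1 / real (Suc n) * G \<omega>\<bar> * real (Suc n))"
        by (intro mult_left_mono mult_right_mono cmod_iexp_diff_le) auto
      also have "\<dots> = \<bar>W \<omega> * G \<omega>\<bar>" by (simp add: abs_mult del: of_nat_Suc)
      finally show "norm (f n \<omega>) \<le> \<bar>W \<omega> * G \<omega>\<bar>" .
    qed
    show "f n \<in> borel_measurable M" for n unfolding f_def by measurable
    show "(\<lambda>\<omega>. \<i> * (of_real (W \<omega> * G \<omega>) * iexp (S \<omega>))) \<in> borel_measurable M" by measurable
  qed
  moreover have "integral\<^sup>L M (f n) = ((\<integral>\<omega>. of_real (W \<omega>) * iexp (S \<omega> + 1 / real (Suc n) * G \<omega>) \<partial>M) - (\<integral>\<omega>. of_real (W \<omega>) * iexp (S \<omega>) \<partial>M)) * of_real (real (Suc n))" for n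
  proof -
    have "integral\<^sup>L M (f n) = (\<integral>\<omega>. (of_real (W \<omega>) * iexp (S \<omega> + 1 / real (Suc n) * G \<omega>) - of_real (W \<omega>) * iexp (S \<omega>)) * of_real (real (Suc n)) \<partial>M)"
      by (intro Bochner_Integration.integral_cong refl) (simp add: f_def algebra_simps exp_add)
    also have "\<dots> = ((\<integral>\<omega>. of_real (W \<omega>) * iexp (S \<omega> + 1 / real (Suc n) * G \<omega>) \<partial>M) - (\<integral>\<omega>. of_real (W \<omega>) * iexp (S \<omega>) \<partial>M)) * of_real (real (Suc n))"
      by (subst integral_mult_left_zero, subst Bochner_Integration.integral_diff[OF int int]) auto
    finally show ?thesis .
  qed
  ultimately show ?thesis by simp
qed

text \<open>Joint Gaussianity is encoded as closure of a set of centered normal variables under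
  linear combinations.\<close>

locale gauss_space = prob_space M for M :: "'w measure" +
  fixes H :: "('w \<Rightarrow> real) set"
  assumes normal: "U \<in> H \<Longrightarrow> centered_normal M U"
    and zero_H: "(\<lambda>_. 0) \<in> H"
    and add_H: "U \<in> H \<Longrightarrow> V \<in> H \<Longrightarrow> (\<lambda>\<omega>. U \<omega> + V \<omega>) \<in> H"
    and scale_H: "U \<in> H \<Longrightarrow> (\<lambda>\<omega>. a * U \<omega>) \<in> H"
begin

lemma H_measurable: "U \<in> H \<Longrightarrow> U \<in> borel_measurable M"
  using centered_normal_facts(1)[OF normal] .

lemma H_exp_square:
  assumes U: "U \<in> H" and le: "(\<integral>\<omega>. (U \<omega>)\<^sup>2 \<partial>M) \<le> 1"
  shows "(\<integral>\<^sup>+\<omega>. ennreal (exp ((U \<omega>)\<^sup>2 / 4)) \<partial>M) \<le> 2"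
proof -
  obtain \<sigma> where s: "\<sigma> \<ge> 0" "(\<integral>\<omega>. (U \<omega>)\<^sup>2 \<partial>M) = \<sigma>\<^sup>2"
     "\<sigma> \<le> 1 \<longrightarrow> (\<integral>\<^sup>+\<omega>. ennreal (exp ((U \<omega>)\<^sup>2 / 4)) \<partial>M) \<le> 2"
    using centered_normal_facts(2)[OF normal[OF U]] by blast
  have "\<sigma> \<le> 1" using le s by (metis abs_le_square_iff abs_of_nonneg one_power2 zero_le_one)
  thus ?thesis using s by blast
qed

lemma H_char: "U \<in> H \<Longrightarrow> (\<integral>\<omega>. iexp (U \<omega>) \<partial>M) = exp (- of_real (\<integral>\<omega>. (U \<omega>)\<^sup>2 \<partial>M) / 2)"
  using centered_normal_facts(2)[OF normal, of U] by auto

lemma H_all_moments: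
  assumes U: "U \<in> H"
  shows "all_moments M U"
proof -
  obtain \<sigma> where s: "\<sigma> \<ge> 0" "(\<integral>\<omega>. (U \<omega>)\<^sup>2 \<partial>M) = \<sigma>\<^sup>2"
    using centered_normal_facts(2)[OF normal[OF U]] by blast
  \<comment> \<open>Scaling to deviation at most 1, as the exponential square bound requires; the
    summand 1 covers \<sigma> = 0.\<close>
  define b where "b = 1 / (\<sigma> + 1)"
  define V where "V \<omega> = b * U \<omega>" for \<omega>
  have b: "b > 0" "b * \<sigma> \<le> 1" using s(1) by (auto simp: b_def field_simps)
  have V: "V \<in> H" unfolding V_def by (rule scale_H[OF U])
  have [measurable]: "V \<in> borel_measurable M" by (rule H_measurable[OF V])
  have "(\<integral>\<omega>. (V \<omega>)\<^sup>2 \<partial>M) = (b * \<sigma>)\<^sup>2" by (simp add: V_def power_mult_distrib s(2))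
  also have "\<dots> \<le> 1" using b s(1) by (intro power_le_one) auto
  finally have "(\<integral>\<^sup>+\<omega>. ennreal (exp ((V \<omega>)\<^sup>2 / 4)) \<partial>M) \<le> 2" by (rule H_exp_square[OF V])
  hence int: "integrable M (\<lambda>\<omega>. exp ((V \<omega>)\<^sup>2 / 4))"
    by (intro integrableI_bounded) (auto simp: less_top[symmetric] top_unique)
  have "integrable M (\<lambda>\<omega>. exp (1 * \<bar>V \<omega>\<bar>))"
  proof (rule Bochner_Integration.integrable_bound)
    show "integrable M (\<lambda>\<omega>. exp 1 * exp ((V \<omega>)\<^sup>2 / 4))" using int by simp
    \<comment> \<open>This is (|V|/2 - 1)^2 \<ge> 0; it trades the square in the exponent for a
      linear term.\<close>
    have "\<bar>V \<omega>\<bar> \<le> 1 + (V \<omega>)\<^sup>2 / 4" for \<omega>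
      using zero_le_power2[of "\<bar>V \<omega>\<bar> / 2 - 1"] by (simp add: power2_diff power_divide)
    thus "AE \<omega> in M. norm (exp (1 * \<bar>V \<omega>\<bar>)) \<le> norm (exp 1 * exp ((V \<omega>)\<^sup>2 / 4))"
      by (intro AE_I2) (simp add: exp_add[symmetric])
  qed measurable
  hence "has_exp_moment M V" unfolding has_exp_moment_def by (intro conjI exI[of _ 1]) auto
  hence "has_exp_moment M (\<lambda>\<omega>. 1 / b * V \<omega>)" by (rule has_exp_moment_cmult)
  thus ?thesis using b by (intro has_exp_moment_all_moments) (simp add: V_def)
qed

definition lprod :: "('w \<Rightarrow> real) list \<Rightarrow> 'w \<Rightarrow> real" where
  "lprod L \<omega> = prod_list (map (\<lambda>V. V \<omega>) L)"

text \<open>\<open>del W L\<close> is the derivative of the product of \<open>L\<close> in the Cameron-Martin direction of \<open>W\<close>.\<close>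

fun del :: "('w \<Rightarrow> real) \<Rightarrow> ('w \<Rightarrow> real) list \<Rightarrow> 'w \<Rightarrow> real" where
  "del W [] \<omega> = 0"
| "del W (V # L) \<omega> = expectation (\<lambda>\<omega>. W \<omega> * V \<omega>) * lprod L \<omega> + V \<omega> * del W L \<omega>"

lemma lprod_simps [simp]: "lprod [] = (\<lambda>_. 1)" "lprod (V # L) \<omega> = V \<omega> * lprod L \<omega>"
  by (auto simp: lprod_def)

lemma all_moments_lprod: "set L \<subseteq> H \<Longrightarrow> all_moments M (lprod L)"
proof (induction L)
  case (Cons V L)
  have "lprod (V # L) = (\<lambda>\<omega>. V \<omega> * lprod L \<omega>)" by auto
  thus ?case using Cons H_all_moments by (auto intro: all_moments_mult)
qed (auto simp: all_moments_const)

lemma all_moments_add: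
  assumes "all_moments M U" "all_moments M V"
  shows "all_moments M (\<lambda>\<omega>. U \<omega> + V \<omega>)"
proof -
  have [measurable]: "U \<in> borel_measurable M" "V \<in> borel_measurable M" using assms unfolding all_moments_def by auto
  have "integrable M (\<lambda>\<omega>. \<bar>U \<omega> + V \<omega>\<bar> ^ p)" for p
  proof (rule Bochner_Integration.integrable_bound)
    show "integrable M (\<lambda>\<omega>. 2 ^ p * (\<bar>U \<omega>\<bar> ^ p + \<bar>V \<omega>\<bar> ^ p))"
      using assms unfolding all_moments_def by (intro integrable_mult_right Bochner_Integration.integrable_add) blast+
    have "\<bar>U \<omega> + V \<omega>\<bar> ^ p \<le> 2 ^ p * (\<bar>U \<omega>\<bar> ^ p + \<bar>V \<omega>\<bar> ^ p)" for \<omega>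
    proof -
      have "\<bar>U \<omega> + V \<omega>\<bar> ^ p \<le> (2 * max \<bar>U \<omega>\<bar> \<bar>V \<omega>\<bar>) ^ p" by (intro power_mono) auto
      also have "\<dots> = 2 ^ p * max \<bar>U \<omega>\<bar> \<bar>V \<omega>\<bar> ^ p" by (rule power_mult_distrib)
      also have "max \<bar>U \<omega>\<bar> \<bar>V \<omega>\<bar> ^ p \<le> \<bar>U \<omega>\<bar> ^ p + \<bar>V \<omega>\<bar> ^ p" by (auto simp: max_def)
      finally show ?thesis by simp
    qed
    thus "AE \<omega> in M. norm (\<bar>U \<omega> + V \<omega>\<bar> ^ p) \<le> norm (2 ^ p * (\<bar>U \<omega>\<bar> ^ p + \<bar>V \<omega>\<bar> ^ p))"
      by (intro AE_I2) (simp add: add_nonneg_nonneg)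
  qed measurable
  thus ?thesis unfolding all_moments_def by auto
qed

lemma all_moments_del:
  assumes W: "W \<in> H"
  shows "set L \<subseteq> H \<Longrightarrow> all_moments M (del W L)"
proof (induction L)
  case Nil
  have "del W [] = (\<lambda>_. 0)" by auto
  thus ?case by (simp add: all_moments_const)
next
  case (Cons V L)
  have "del W (V # L) = (\<lambda>\<omega>. expectation (\<lambda>\<omega>. W \<omega> * V \<omega>) * lprod L \<omega> + V \<omega> * del W L \<omega>)" by auto
  thus ?case using Cons H_all_moments
    by (auto intro!: all_moments_add all_moments_mult all_moments_const all_moments_lprod)
qed

lemma H_product_integrable: "U \<in> H \<Longrightarrow> V \<in> H \<Longrightarrow> integrable M (\<lambda>\<omega>. U \<omega> * V \<omega>)"
  by (intro all_moments_integrable all_moments_mult H_all_moments)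

lemma H_expectation_add_scale:
  assumes "W \<in> H" "S \<in> H" "V \<in> H"
  shows "expectation (\<lambda>\<omega>. W \<omega> * (S \<omega> + a * V \<omega>)) = expectation (\<lambda>\<omega>. W \<omega> * S \<omega>) + a * expectation (\<lambda>\<omega>. W \<omega> * V \<omega>)"
proof -
  have "(\<lambda>\<omega>. W \<omega> * (S \<omega> + a * V \<omega>)) = (\<lambda>\<omega>. W \<omega> * S \<omega> + a * (W \<omega> * V \<omega>))" by (auto simp: algebra_simps)
  thus ?thesis using assms H_product_integrable by simp
qed

text \<open>The exponential factor makes the induction on \<open>L\<close> work: a further factor \<open>V\<close> arises by
  differentiating in the direction \<open>S + a V\<close>.\<close>

lemma isserlis_iexp:
  assumes W: "W \<in> H" and L: "set L \<subseteq> H" and S: "S \<in> H"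
  shows "(\<integral>\<omega>. of_real (W \<omega> * lprod L \<omega>) * iexp (S \<omega>) \<partial>M) =
    (\<integral>\<omega>. of_real (del W L \<omega>) * iexp (S \<omega>) \<partial>M) + \<i> * of_real (expectation (\<lambda>\<omega>. W \<omega> * S \<omega>)) * (\<integral>\<omega>. of_real (lprod L \<omega>) * iexp (S \<omega>) \<partial>M)"
  using L S
proof (induction L arbitrary: S)
  case Nil
  hence S: "S \<in> H" by simp
  have Sm: "S \<in> borel_measurable M" and Wm: "W \<in> borel_measurable M" using S W H_measurable by auto
  define s c w where "s = expectation (\<lambda>\<omega>. (S \<omega>)\<^sup>2)" and "c = expectation (\<lambda>\<omega>. W \<omega> * S \<omega>)" and "w = expectation (\<lambda>\<omega>. (W \<omega>)\<^sup>2)"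
  \<comment> \<open>The characteristic function of S + a W as an explicit function of
    \<open>a\<close>; the right side is entire in \<open>a\<close>. Comparing its derivative at 0
    with differentiation under the integral gives the claim for the empty product.\<close>
  have F: "(\<integral>\<omega>. of_real 1 * iexp (S \<omega> + a * W \<omega>) \<partial>M) = exp (- (of_real s + 2 * of_real a * of_real c + (of_real a)\<^sup>2 * of_real w) / 2)" for a
  proof -
    have m: "(\<lambda>\<omega>. S \<omega> + a * W \<omega>) \<in> H" using S W by (intro add_H scale_H)
    have v: "expectation (\<lambda>\<omega>. (S \<omega> + a * W \<omega>)\<^sup>2) = s + 2 * a * c + a\<^sup>2 * w"
    proof -
      have "(\<lambda>\<omega>. (S \<omega> + a * W \<omega>)\<^sup>2) = (\<lambda>\<omega>. S \<omega> * S \<omega> + 2 * a * (W \<omega> * S \<omega>) + a\<^sup>2 * (W \<omega> * W \<omega>))"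
        by (auto simp: algebra_simps power2_eq_square)
      thus ?thesis using H_product_integrable S W unfolding s_def c_def w_def by (simp add: power2_eq_square)
    qed
    show ?thesis using H_char[OF m] unfolding v
      by (simp only: of_real_add of_real_mult of_real_power of_real_numeral of_real_1 mult_1_left)
  qed
  have "(\<lambda>n. ((\<integral>\<omega>. of_real 1 * iexp (S \<omega> + 1 / real (Suc n) * W \<omega>) \<partial>M) - (\<integral>\<omega>. of_real 1 * iexp (S \<omega>) \<partial>M)) * of_real (real (Suc n)))
     \<longlonglongrightarrow> \<i> * (\<integral>\<omega>. of_real (1 * W \<omega>) * iexp (S \<omega>) \<partial>M)"
    by (rule iexp_seq_derivative[OF _ Wm Sm]) (use all_moments_integrable[OF H_all_moments[OF W]] in auto)
  moreover have "((\<lambda>z. exp (- (of_real s + 2 * z * of_real c + z\<^sup>2 * of_real w) / 2)) has_field_derivative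
      - of_real c * exp (- of_real s / 2)) (at 0)"
    by (auto intro!: derivative_eq_intros)
  from seq_derivative[OF this]
  have "(\<lambda>n. ((\<integral>\<omega>. of_real 1 * iexp (S \<omega> + 1 / real (Suc n) * W \<omega>) \<partial>M) - (\<integral>\<omega>. of_real 1 * iexp (S \<omega>) \<partial>M)) * of_real (real (Suc n)))
     \<longlonglongrightarrow> - of_real c * exp (- of_real s / 2)"
    unfolding F using F[of 0] by simp
  ultimately have "\<i> * (\<integral>\<omega>. of_real (1 * W \<omega>) * iexp (S \<omega>) \<partial>M) = - of_real c * exp (- of_real s / 2)"
    by (rule LIMSEQ_unique)
  hence "- \<i> * (\<i> * (\<integral>\<omega>. of_real (1 * W \<omega>) * iexp (S \<omega>) \<partial>M)) = - \<i> * (- of_real c * exp (- of_real s / 2))" by simp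
  hence "(\<integral>\<omega>. of_real (W \<omega>) * iexp (S \<omega>) \<partial>M) = \<i> * of_real c * exp (- of_real s / 2)" by (simp add: mult.assoc[symmetric])
  thus ?case using F[of 0] by (simp add: c_def)
next
  case (Cons V L)
  hence V: "V \<in> H" and L: "set L \<subseteq> H" and S: "S \<in> H" by auto
  have Sm: "S \<in> borel_measurable M" and Vm: "V \<in> borel_measurable M" using S V H_measurable by auto
  define c d where "c = expectation (\<lambda>\<omega>. W \<omega> * S \<omega>)" and "d = expectation (\<lambda>\<omega>. W \<omega> * V \<omega>)"
  define a where "a n = 1 / real (Suc n)" for n
  define F where "F a U = (\<integral>\<omega>. of_real (U \<omega>) * iexp (S \<omega> + a * V \<omega>) \<partial>M)" for a and U :: "'w \<Rightarrow> real"
  have D: "(\<lambda>n. (F (a n) U - F 0 U) * of_real (real (Suc n))) \<longlonglongrightarrow> \<i> * F 0 (\<lambda>\<omega>. U \<omega> * V \<omega>)" if "all_moments M U" for U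
    using iexp_seq_derivative[OF all_moments_integrable[OF that] Vm Sm
        all_moments_integrable[OF all_moments_mult[OF that H_all_moments[OF V]]]]
    by (simp add: F_def a_def)
  \<comment> \<open>The induction hypothesis in the direction S + a V, where the covariance with
    \<open>W\<close> is affine in \<open>a\<close>.\<close>
  have IH: "F a (\<lambda>\<omega>. W \<omega> * lprod L \<omega>) = F a (del W L) + \<i> * of_real (c + a * d) * F a (lprod L)" for a
    unfolding F_def c_def d_def H_expectation_add_scale[OF W S V, symmetric]
    by (rule Cons.IH[OF L]) (intro add_H scale_H S V)
  have mL: "all_moments M (lprod L)" by (rule all_moments_lprod[OF L])
  \<comment> \<open>Continuity at 0, obtained as difference quotient times increment.\<close>
  have lim0: "(\<lambda>n. F (a n) (lprod L)) \<longlonglongrightarrow> F 0 (lprod L)"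
  proof -
    have "(\<lambda>n. complex_of_real (a n)) \<longlonglongrightarrow> of_real 0"
      unfolding a_def using LIMSEQ_inverse_real_of_nat by (intro tendsto_of_real) (simp add: inverse_eq_divide)
    from tendsto_add[OF tendsto_mult[OF D[OF mL] this] tendsto_const[of "F 0 (lprod L)"]]
    show ?thesis by (simp add: a_def mult.assoc field_simps del: of_nat_Suc)
  qed
  have l1: "(\<lambda>n. (F (a n) (\<lambda>\<omega>. W \<omega> * lprod L \<omega>) - F 0 (\<lambda>\<omega>. W \<omega> * lprod L \<omega>)) * of_real (real (Suc n)))
     \<longlonglongrightarrow> \<i> * F 0 (\<lambda>\<omega>. W \<omega> * lprod L \<omega> * V \<omega>)"
    by (intro D all_moments_mult H_all_moments W mL)
  \<comment> \<open>The product rule on the right side of \<open>IH\<close>: the derivative of the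
    affine coefficient produces the pairing of \<open>W\<close> with the new factor
    \<open>V\<close>.\<close>
  have l2: "(\<lambda>n. (F (a n) (del W L) - F 0 (del W L)) * of_real (real (Suc n)) +
      \<i> * of_real c * ((F (a n) (lprod L) - F 0 (lprod L)) * of_real (real (Suc n))) + \<i> * of_real d * F (a n) (lprod L))
     \<longlonglongrightarrow> \<i> * F 0 (\<lambda>\<omega>. del W L \<omega> * V \<omega>) + \<i> * of_real c * (\<i> * F 0 (\<lambda>\<omega>. lprod L \<omega> * V \<omega>)) + \<i> * of_real d * F 0 (lprod L)"
    by (intro tendsto_intros D all_moments_del[OF W L] mL lim0)
  have l3: "(F (a n) (\<lambda>\<omega>. W \<omega> * lprod L \<omega>) - F 0 (\<lambda>\<omega>. W \<omega> * lprod L \<omega>)) * of_real (real (Suc n)) =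
     (F (a n) (del W L) - F 0 (del W L)) * of_real (real (Suc n)) +
      \<i> * of_real c * ((F (a n) (lprod L) - F 0 (lprod L)) * of_real (real (Suc n))) + \<i> * of_real d * F (a n) (lprod L)" for n
  proof -
    have one: "complex_of_nat (Suc n) * complex_of_real (a n) = 1" by (simp add: a_def del: of_nat_Suc)
    have *: "\<i> * of_real (a n * d) * F (a n) (lprod L) * of_real (real (Suc n)) = \<i> * of_real d * F (a n) (lprod L)"
      by (simp add: mult_ac del: of_nat_Suc) (use one in blast)
    show ?thesis unfolding IH *[symmetric] by (simp add: algebra_simps del: of_nat_Suc)
  qed
  have "F 0 (\<lambda>\<omega>. W \<omega> * lprod L \<omega> * V \<omega>) = - \<i> * (\<i> * F 0 (\<lambda>\<omega>. W \<omega> * lprod L \<omega> * V \<omega>))" by simp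
  also note LIMSEQ_unique[OF l1[unfolded l3] l2]
  finally have eq: "F 0 (\<lambda>\<omega>. W \<omega> * lprod L \<omega> * V \<omega>) =
      F 0 (\<lambda>\<omega>. del W L \<omega> * V \<omega>) + of_real d * F 0 (lprod L) + \<i> * of_real c * F 0 (\<lambda>\<omega>. lprod L \<omega> * V \<omega>)"
    by (simp add: algebra_simps)
  have "F 0 (del W (V # L)) = F 0 (\<lambda>\<omega>. del W L \<omega> * V \<omega>) + of_real d * F 0 (lprod L)"
  proof -
    have i: "integrable M (\<lambda>\<omega>. of_real (U \<omega>) * iexp (S \<omega>))" if "all_moments M U" for U
      by (rule Bochner_Integration.integrable_bound[OF all_moments_integrable[OF that]])
         (use that Sm in \<open>auto simp: norm_mult all_moments_def\<close>)
    have "F 0 (del W (V # L)) = (\<integral>\<omega>. of_real (del W L \<omega> * V \<omega>) * iexp (S \<omega>) + of_real d * (of_real (lprod L \<omega>) * iexp (S \<omega>)) \<partial>M)"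
      unfolding F_def by (intro Bochner_Integration.integral_cong refl) (simp add: d_def algebra_simps)
    also have "\<dots> = F 0 (\<lambda>\<omega>. del W L \<omega> * V \<omega>) + of_real d * F 0 (lprod L)"
      unfolding F_def using i[OF mL] i[OF all_moments_mult[OF all_moments_del[OF W L] H_all_moments[OF V]]] by simp
    finally show ?thesis .
  qed
  with eq show ?case by (simp add: F_def c_def mult_ac)
qed

corollary isserlis:
  assumes W: "W \<in> H" and L: "set L \<subseteq> H"
  shows "expectation (\<lambda>\<omega>. W \<omega> * lprod L \<omega>) = expectation (del W L)"
  using isserlis_iexp[OF W L zero_H] by (simp add: integral_complex_of_real del: of_real_mult)

end

section \<open>Quadratic functionals of Gaussian processes\<close>

text \<open>Cauchy-Schwarz from nonnegativity of the quadratic form in (a, b) given by the integral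
  of (a f + b g)^2.\<close>

lemma integral_mult_le_sqrt:
  fixes f g :: "'a \<Rightarrow> real"
  assumes f: "integrable M (\<lambda>x. (f x)\<^sup>2)" and g: "integrable M (\<lambda>x. (g x)\<^sup>2)" and fg: "integrable M (\<lambda>x. f x * g x)"
  shows "\<bar>\<integral>x. f x * g x \<partial>M\<bar> \<le> sqrt (\<integral>x. (f x)\<^sup>2 \<partial>M) * sqrt (\<integral>x. (g x)\<^sup>2 \<partial>M)"
proof -
  define u v c where "u = (\<integral>x. (f x)\<^sup>2 \<partial>M)" and "v = (\<integral>x. (g x)\<^sup>2 \<partial>M)" and "c = (\<integral>x. f x * g x \<partial>M)"
  have u: "u \<ge> 0" and v: "v \<ge> 0" by (auto simp: u_def v_def)
  have *: "0 \<le> a\<^sup>2 * u + 2 * (a * b) * c + b\<^sup>2 * v" for a b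
  proof -
    have "0 \<le> (\<integral>x. (a * f x + b * g x)\<^sup>2 \<partial>M)" by simp
    also have "(\<integral>x. (a * f x + b * g x)\<^sup>2 \<partial>M) = (\<integral>x. a\<^sup>2 * (f x)\<^sup>2 + 2 * (a * b) * (f x * g x) + b\<^sup>2 * (g x)\<^sup>2 \<partial>M)"
      by (intro Bochner_Integration.integral_cong refl) (simp add: power2_eq_square algebra_simps)
    also have "\<dots> = a\<^sup>2 * u + 2 * (a * b) * c + b\<^sup>2 * v" using f g fg by (simp add: u_def v_def c_def)
    finally show ?thesis .
  qed
  have "c\<^sup>2 \<le> u * v"
  proof (cases "v = 0")
    case True
    have "c = 0"
    proof (rule ccontr)
      assume "c \<noteq> 0"
      \<comment> \<open>With v = 0 this choice gives the form the value u - (u + 1) = -1.\<close>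
      with *[of 1 "- (u + 1) / (2 * c)"] True u show False by (simp add: field_simps)
    qed
    thus ?thesis using True by simp
  next
    case False
    have "0 \<le> v\<^sup>2 * u - 2 * v * c\<^sup>2 + c\<^sup>2 * v" using *[of v "- c"] by (simp add: power2_eq_square algebra_simps)
    hence "0 \<le> v * (u * v - c\<^sup>2)" by (simp add: power2_eq_square algebra_simps)
    thus ?thesis using False v by (simp add: zero_le_mult_iff)
  qed
  hence "\<bar>c\<bar> \<le> sqrt (u * v)" by (simp add: real_le_rsqrt)
  thus ?thesis by (simp add: u_def v_def c_def real_sqrt_mult)
qed

text \<open>A finite family of uncorrelated Gaussian processes with finite energy and arbitrary real
  weights. It is used for the polarized components with signed weights, for all isotypic components
  of \<open>Z1\<close> together, and for \<open>Z1\<close> alone.\<close>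

locale gauss_quadratic = gauss_space M H for M :: "'w measure" and H +
  fixes mu :: "'y measure" and K :: "'k set" and t :: "'k \<Rightarrow> real" and Z :: "'k \<Rightarrow> 'y \<Rightarrow> 'w \<Rightarrow> real"
  assumes mu_sf: "sigma_finite_measure mu" and finK: "finite K"
    and Z_H: "k \<in> K \<Longrightarrow> y \<in> space mu \<Longrightarrow> Z k y \<in> H"
    and Z_meas: "k \<in> K \<Longrightarrow> (\<lambda>(y, \<omega>). Z k y \<omega>) \<in> borel_measurable (mu \<Otimes>\<^sub>M M)"
    and Z_paths: "k \<in> K \<Longrightarrow> \<omega> \<in> space M \<Longrightarrow> integrable mu (\<lambda>y. (Z k y \<omega>)\<^sup>2)"
    and energy: "k \<in> K \<Longrightarrow> integrable mu (\<lambda>y. expectation (\<lambda>\<omega>. Z k y \<omega> * Z k y \<omega>))"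
    and uncorrelated: "k \<in> K \<Longrightarrow> l \<in> K \<Longrightarrow> k \<noteq> l \<Longrightarrow> x \<in> space mu \<Longrightarrow> y \<in> space mu \<Longrightarrow> expectation (\<lambda>\<omega>. Z k x \<omega> * Z l y \<omega>) = 0"
begin

sublocale mu: sigma_finite_measure mu by (rule mu_sf)
sublocale P: pair_sigma_finite M mu ..

definition "R k x y = expectation (\<lambda>\<omega>. Z k x \<omega> * Z k y \<omega>)"
definition "Q k \<omega> = (\<integral>y. (Z k y \<omega>)\<^sup>2 \<partial>mu)"
definition "Qt \<omega> = (\<Sum>k\<in>K. t k * Q k \<omega>)"

lemma Z_meas': "k \<in> K \<Longrightarrow> (\<lambda>(\<omega>, y). Z k y \<omega>) \<in> borel_measurable (M \<Otimes>\<^sub>M mu)"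
  using measurable_pair_swap[OF Z_meas] by (simp add: case_prod_beta')

lemma Z_path_meas: "k \<in> K \<Longrightarrow> \<omega> \<in> space M \<Longrightarrow> (\<lambda>y. Z k y \<omega>) \<in> borel_measurable mu"
  using measurable_compose[OF measurable_Pair1' Z_meas', of \<omega> k] by simp

lemma Q_meas: "k \<in> K \<Longrightarrow> Q k \<in> borel_measurable M"
  unfolding Q_def[abs_def] using Z_meas'[of k]
  by (intro mu.borel_measurable_lebesgue_integral) (simp add: case_prod_beta')

lemma Q_nonneg: "0 \<le> Q k \<omega>" by (simp add: Q_def)

text \<open>Jensen's inequality for \<open>exp\<close> and the probability measure proportional to \<open>(R(y,y) + w(y)) \<mu>(dy)\<close>
  bounds the exponential moments of \<open>Q\<close> by those of standardized Gaussian variables; the positive weight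
  \<open>w\<close> avoids division by zero.\<close>

lemma Q_exp_moment:
  assumes k: "k \<in> K"
  shows "has_exp_moment M (Q k)"
proof -
  obtain w :: "'y \<Rightarrow> real" where w: "w \<in> borel_measurable mu" "\<And>y. 0 < w y" "integrable mu w"
    by (rule mu.obtain_positive_integrable_function) blast
  define r where "r y = R k y y + w y" for y
  have R0: "0 \<le> R k y y" for y unfolding R_def by simp
  have r0: "0 < r y" for y using R0[of y] w(2)[of y] by (simp add: r_def)
  have int_r: "integrable mu r" unfolding r_def using energy[OF k] w(3) by (simp add: R_def)
  have [measurable]: "r \<in> borel_measurable mu" using int_r by simp
  have Qm[measurable]: "Q k \<in> borel_measurable M" by (rule Q_meas[OF k])
  define T where "T = (\<integral>y. r y \<partial>mu)"
  show ?thesis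
  proof (cases "T = 0")
    case True
    have "AE y in mu. r y = 0"
      using integral_nonneg_eq_0_iff_AE[OF int_r] r0 True by (simp add: T_def less_imp_le)
    \<comment> \<open>A strictly positive function with vanishing integral: \<open>mu\<close> is the
      null measure.\<close>
    hence "AE y in mu. False" using r0 by (auto simp: less_le)
    hence "Q k \<omega> = 0" for \<omega> unfolding Q_def by (intro integral_eq_zero_AE) auto
    hence "Q k = (\<lambda>_. 0)" by auto
    thus ?thesis unfolding has_exp_moment_def by (auto intro!: exI[of _ 1])
  next
    case False
    hence T: "T > 0" using r0 by (simp add: T_def less_le integral_nonneg less_imp_le)
    define N where "N = density mu (\<lambda>y. ennreal (r y / T))"
    have N: "prob_space N"
    proof
      have "emeasure N (space N) = (\<integral>\<^sup>+y. ennreal (r y / T) \<partial>mu)"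
        unfolding N_def by (subst emeasure_density) (auto intro!: nn_integral_cong)
      also have "\<dots> = ennreal (\<integral>y. r y / T \<partial>mu)"
        using int_r r0 T by (intro nn_integral_eq_integral) (auto intro!: AE_I2 divide_nonneg_nonneg less_imp_le)
      finally show "emeasure N (space N) = 1" using T by (simp add: T_def)
    qed
    have jensen: "ennreal (exp (Q k \<omega> / (4 * T))) \<le> (\<integral>\<^sup>+y. ennreal (r y / T) * ennreal (exp ((Z k y \<omega> / sqrt (r y))\<^sup>2 / 4)) \<partial>mu)"
      if \<omega>: "\<omega> \<in> space M" for \<omega>
    proof -
      have [measurable]: "(\<lambda>y. Z k y \<omega>) \<in> borel_measurable mu" by (rule Z_path_meas[OF k \<omega>])
      define X where "X y = (Z k y \<omega> / sqrt (r y))\<^sup>2 / 4" for y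
      have rX: "r y * X y = (Z k y \<omega>)\<^sup>2 / 4" for y
        using r0[of y] by (simp add: X_def power_divide)
      have Xm[measurable]: "X \<in> borel_measurable mu" unfolding X_def by measurable
      have XN: "X \<in> borel_measurable N" by (simp add: N_def)
      have rT: "AE y in mu. 0 \<le> r y / T" using r0 T by (intro AE_I2 divide_nonneg_nonneg less_imp_le)
      have int_X: "integrable N X" unfolding N_def
        using rT by (subst integrable_density) (auto simp: rX intro!: integrable_divide_zero Z_paths[OF k \<omega>])
      have EX: "(\<integral>y. X y \<partial>N) = Q k \<omega> / (4 * T)" unfolding N_def
        using rT by (subst integral_density) (auto simp: rX Q_def)
      have nnN: "(\<integral>\<^sup>+y. ennreal (exp (X y)) \<partial>N) = (\<integral>\<^sup>+y. ennreal (r y / T) * ennreal (exp (X y)) \<partial>mu)"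
        unfolding N_def by (subst nn_integral_density) auto
      have "ennreal (exp (\<integral>y. X y \<partial>N)) \<le> (\<integral>\<^sup>+y. ennreal (exp (X y)) \<partial>N)"
      proof (cases "(\<integral>\<^sup>+y. ennreal (exp (X y)) \<partial>N) = \<infinity>")
        case False
        have int_e: "integrable N (\<lambda>y. exp (X y))"
          using False XN by (intro integrableI_bounded) (auto simp: less_top[symmetric])
        have "exp (\<integral>y. X y \<partial>N) \<le> (\<integral>y. exp (X y) \<partial>N)"
          using prob_space.jensens_inequality[OF N int_X, of UNIV] int_e exp_convex by simp
        hence "ennreal (exp (\<integral>y. X y \<partial>N)) \<le> ennreal (\<integral>y. exp (X y) \<partial>N)" by (rule ennreal_leI)
        also have "\<dots> = (\<integral>\<^sup>+y. ennreal (exp (X y)) \<partial>N)" using int_e by (intro nn_integral_eq_integral[symmetric]) auto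
        finally show ?thesis .
      qed simp
      thus ?thesis unfolding EX nnN by (simp add: X_def)
    qed
    have "(\<integral>\<^sup>+\<omega>. ennreal (exp (Q k \<omega> / (4 * T))) \<partial>M)
      \<le> (\<integral>\<^sup>+\<omega>. (\<integral>\<^sup>+y. ennreal (r y / T) * ennreal (exp ((Z k y \<omega> / sqrt (r y))\<^sup>2 / 4)) \<partial>mu) \<partial>M)"
      by (intro nn_integral_mono jensen)
    also have "\<dots> = (\<integral>\<^sup>+y. (\<integral>\<^sup>+\<omega>. ennreal (r y / T) * ennreal (exp ((Z k y \<omega> / sqrt (r y))\<^sup>2 / 4)) \<partial>M) \<partial>mu)"
    proof (rule P.Fubini'[symmetric])
      have [measurable]: "(\<lambda>x. Z k (snd x) (fst x)) \<in> borel_measurable (M \<Otimes>\<^sub>M mu)"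
        using Z_meas'[OF k] by (simp add: case_prod_beta')
      show "(\<lambda>(\<omega>, y). ennreal (r y / T) * ennreal (exp ((Z k y \<omega> / sqrt (r y))\<^sup>2 / 4))) \<in> borel_measurable (M \<Otimes>\<^sub>M mu)"
        unfolding case_prod_beta' by measurable
    qed
    also have "\<dots> \<le> (\<integral>\<^sup>+y. ennreal (r y / T) * 2 \<partial>mu)"
    proof (rule nn_integral_mono)
      fix y assume y: "y \<in> space mu"
      \<comment> \<open>The standardized variable; r(y) \<ge> R(y, y) makes its variance at most 1,
        so the expectation of its exponential square is at most 2 uniformly in
        \<open>y\<close>.\<close>
      have ZH: "(\<lambda>\<omega>. 1 / sqrt (r y) * Z k y \<omega>) \<in> H" by (intro scale_H Z_H k y)
      have [measurable]: "Z k y \<in> borel_measurable M" by (intro H_measurable Z_H k y)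
      have "(\<integral>\<omega>. (1 / sqrt (r y) * Z k y \<omega>)\<^sup>2 \<partial>M) = R k y y / r y"
        using r0[of y] by (simp add: power_divide R_def power2_eq_square)
      also have "\<dots> \<le> 1" using r0[of y] w(2)[of y] by (simp add: r_def)
      finally have "(\<integral>\<^sup>+\<omega>. ennreal (exp ((Z k y \<omega> / sqrt (r y))\<^sup>2 / 4)) \<partial>M) \<le> 2"
        using H_exp_square[OF ZH] by simp
      thus "(\<integral>\<^sup>+\<omega>. ennreal (r y / T) * ennreal (exp ((Z k y \<omega> / sqrt (r y))\<^sup>2 / 4)) \<partial>M) \<le> ennreal (r y / T) * 2"
        by (subst nn_integral_cmult) (auto intro: mult_left_mono)
    qed
    also have "\<dots> = (\<integral>\<^sup>+y. ennreal (r y / T) \<partial>mu) * 2" by (rule nn_integral_multc) measurable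
    also have "(\<integral>\<^sup>+y. ennreal (r y / T) \<partial>mu) = ennreal (\<integral>y. r y / T \<partial>mu)"
      using int_r r0 T by (intro nn_integral_eq_integral) (auto intro!: AE_I2 divide_nonneg_nonneg less_imp_le)
    finally have "(\<integral>\<^sup>+\<omega>. ennreal (exp (Q k \<omega> / (4 * T))) \<partial>M) < \<infinity>"
      by (rule le_less_trans) (auto simp: ennreal_mult_less_top)
    hence "integrable M (\<lambda>\<omega>. exp (1 / (4 * T) * \<bar>Q k \<omega>\<bar>))"
      by (intro integrableI_bounded) (auto simp: Q_nonneg)
    thus ?thesis unfolding has_exp_moment_def using T by (intro conjI exI[of _ "1 / (4 * T)"]) auto
  qed
qed

lemma Qt_exp_moment: "has_exp_moment M Qt"
  unfolding Qt_def[abs_def] by (intro has_exp_moment_sum finK has_exp_moment_cmult Q_exp_moment)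

lemma Qt_all_moments: "all_moments M Qt" by (rule has_exp_moment_all_moments[OF Qt_exp_moment])
lemma Q_all_moments: "k \<in> K \<Longrightarrow> all_moments M (Q k)" by (rule has_exp_moment_all_moments[OF Q_exp_moment])

lemma all_moments_mono:
  assumes "all_moments M V" "U \<in> borel_measurable M" "\<And>\<omega>. \<omega> \<in> space M \<Longrightarrow> \<bar>U \<omega>\<bar> \<le> V \<omega>"
  shows "all_moments M U"
proof -
  have [measurable]: "U \<in> borel_measurable M" by (rule assms(2))
  have "integrable M (\<lambda>\<omega>. \<bar>U \<omega>\<bar> ^ p)" for p
  proof (rule Bochner_Integration.integrable_bound)
    show "integrable M (\<lambda>\<omega>. \<bar>V \<omega>\<bar> ^ p)" using assms(1) unfolding all_moments_def by blast
    show "AE \<omega> in M. norm (\<bar>U \<omega>\<bar> ^ p) \<le> norm (\<bar>V \<omega>\<bar> ^ p)"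
    proof (rule AE_I2)
      fix \<omega> assume "\<omega> \<in> space M"
      hence "\<bar>U \<omega>\<bar> \<le> \<bar>V \<omega>\<bar>" using assms(3)[of \<omega>] by linarith
      thus "norm (\<bar>U \<omega>\<bar> ^ p) \<le> norm (\<bar>V \<omega>\<bar> ^ p)" by (simp add: power_mono)
    qed
  qed measurable
  thus ?thesis unfolding all_moments_def using assms(2) by blast
qed

text \<open>The pathwise bound \<open>B\<close> with all moments supplies joint integrability
  against any \<open>U\<close> with all moments, via integrability of the product B U.\<close>

lemma fubini:
  fixes f :: "'y \<Rightarrow> 'w \<Rightarrow> real"
  assumes f: "(\<lambda>(\<omega>, y). f y \<omega>) \<in> borel_measurable (M \<Otimes>\<^sub>M mu)"
    and int: "\<And>\<omega>. \<omega> \<in> space M \<Longrightarrow> integrable mu (\<lambda>y. f y \<omega>)"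
    and B: "all_moments M B" "\<And>\<omega>. \<omega> \<in> space M \<Longrightarrow> (\<integral>y. \<bar>f y \<omega>\<bar> \<partial>mu) \<le> B \<omega>"
  shows "all_moments M (\<lambda>\<omega>. \<integral>y. f y \<omega> \<partial>mu)"
    and "all_moments M U \<Longrightarrow> integrable mu (\<lambda>y. expectation (\<lambda>\<omega>. f y \<omega> * U \<omega>))"
    and "all_moments M U \<Longrightarrow> (\<integral>y. expectation (\<lambda>\<omega>. f y \<omega> * U \<omega>) \<partial>mu) = expectation (\<lambda>\<omega>. (\<integral>y. f y \<omega> \<partial>mu) * U \<omega>)"
proof -
  have f'[measurable]: "(\<lambda>x. f (snd x) (fst x)) \<in> borel_measurable (M \<Otimes>\<^sub>M mu)" using f by (simp add: case_prod_beta')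
  show "all_moments M (\<lambda>\<omega>. \<integral>y. f y \<omega> \<partial>mu)"
  proof (rule all_moments_mono[OF B(1)])
    show "(\<lambda>\<omega>. \<integral>y. f y \<omega> \<partial>mu) \<in> borel_measurable M"
      by (rule mu.borel_measurable_lebesgue_integral) (simp add: case_prod_beta')
    fix \<omega> assume w: "\<omega> \<in> space M"
    have "\<bar>\<integral>y. f y \<omega> \<partial>mu\<bar> \<le> (\<integral>y. \<bar>f y \<omega>\<bar> \<partial>mu)" using integral_norm_bound[of mu "\<lambda>y. f y \<omega>"] by simp
    thus "\<bar>\<integral>y. f y \<omega> \<partial>mu\<bar> \<le> B \<omega>" using B(2)[OF w] by linarith
  qed
  assume U: "all_moments M U"
  hence [measurable]: "U \<in> borel_measurable M" unfolding all_moments_def by blast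
  have I: "integrable (M \<Otimes>\<^sub>M mu) (\<lambda>(\<omega>, y). f y \<omega> * U \<omega>)"
  proof (rule P.Fubini_integrable)
    show "(\<lambda>(\<omega>, y). f y \<omega> * U \<omega>) \<in> borel_measurable (M \<Otimes>\<^sub>M mu)" unfolding case_prod_beta' by measurable
    show "integrable M (\<lambda>\<omega>. \<integral>y. norm (case (\<omega>, y) of (\<omega>, y) \<Rightarrow> f y \<omega> * U \<omega>) \<partial>mu)"
    proof (rule Bochner_Integration.integrable_bound)
      show "integrable M (\<lambda>\<omega>. B \<omega> * U \<omega>)" by (rule all_moments_integrable[OF all_moments_mult[OF B(1) U]])
      show "(\<lambda>\<omega>. \<integral>y. norm (case (\<omega>, y) of (\<omega>, y) \<Rightarrow> f y \<omega> * U \<omega>) \<partial>mu) \<in> borel_measurable M"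
        by (rule mu.borel_measurable_lebesgue_integral) (simp add: case_prod_beta')
      show "AE \<omega> in M. norm (\<integral>y. norm (case (\<omega>, y) of (\<omega>, y) \<Rightarrow> f y \<omega> * U \<omega>) \<partial>mu) \<le> norm (B \<omega> * U \<omega>)"
      proof (rule AE_I2)
        fix \<omega> assume w: "\<omega> \<in> space M"
        have "norm (\<integral>y. norm (case (\<omega>, y) of (\<omega>, y) \<Rightarrow> f y \<omega> * U \<omega>) \<partial>mu) = (\<integral>y. \<bar>f y \<omega>\<bar> \<partial>mu) * \<bar>U \<omega>\<bar>"
          by (simp add: abs_mult)
        also have "\<dots> \<le> \<bar>B \<omega>\<bar> * \<bar>U \<omega>\<bar>" using B(2)[OF w] by (intro mult_right_mono) auto
        finally show "norm (\<integral>y. norm (case (\<omega>, y) of (\<omega>, y) \<Rightarrow> f y \<omega> * U \<omega>) \<partial>mu) \<le> norm (B \<omega> * U \<omega>)"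
          by (simp add: abs_mult)
      qed
    qed
    show "AE \<omega> in M. integrable mu (\<lambda>y. case (\<omega>, y) of (\<omega>, y) \<Rightarrow> f y \<omega> * U \<omega>)"
      using int by (intro AE_I2) auto
  qed
  show "integrable mu (\<lambda>y. expectation (\<lambda>\<omega>. f y \<omega> * U \<omega>))"
    using P.integrable_snd[OF I] by simp
  show "(\<integral>y. expectation (\<lambda>\<omega>. f y \<omega> * U \<omega>) \<partial>mu) = expectation (\<lambda>\<omega>. (\<integral>y. f y \<omega> \<partial>mu) * U \<omega>)"
    using P.Fubini_integral[OF I] by simp
qed

lemma fubini_square:
  assumes k: "k \<in> K" and U: "all_moments M U"
  shows "integrable mu (\<lambda>y. expectation (\<lambda>\<omega>. (Z k y \<omega>)\<^sup>2 * U \<omega>))"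
    and "(\<integral>y. expectation (\<lambda>\<omega>. (Z k y \<omega>)\<^sup>2 * U \<omega>) \<partial>mu) = expectation (\<lambda>\<omega>. Q k \<omega> * U \<omega>)"
proof -
  have [measurable]: "(\<lambda>x. Z k (snd x) (fst x)) \<in> borel_measurable (M \<Otimes>\<^sub>M mu)"
    using Z_meas'[OF k] by (simp add: case_prod_beta')
  have 1: "(\<lambda>(\<omega>, y). (Z k y \<omega>)\<^sup>2) \<in> borel_measurable (M \<Otimes>\<^sub>M mu)" unfolding case_prod_beta' by measurable
  have 2: "(\<integral>y. \<bar>(Z k y \<omega>)\<^sup>2\<bar> \<partial>mu) \<le> Q k \<omega>" for \<omega> by (simp add: Q_def)
  show "integrable mu (\<lambda>y. expectation (\<lambda>\<omega>. (Z k y \<omega>)\<^sup>2 * U \<omega>))"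
    by (rule fubini(2)[OF 1 Z_paths[OF k] Q_all_moments[OF k] 2 U])
  show "(\<integral>y. expectation (\<lambda>\<omega>. (Z k y \<omega>)\<^sup>2 * U \<omega>) \<partial>mu) = expectation (\<lambda>\<omega>. Q k \<omega> * U \<omega>)"
    unfolding Q_def by (rule fubini(3)[OF 1 Z_paths[OF k] Q_all_moments[OF k] 2 U])
qed

text \<open>The dominating variable is the integral of h^2 plus \<open>Q k\<close>, from |h Z| \<le>
  h^2 + Z^2.\<close>

lemma fubini_linear:
  assumes k: "k \<in> K" and h: "h \<in> borel_measurable mu" "integrable mu (\<lambda>y. (h y)\<^sup>2)"
  shows "all_moments M (\<lambda>\<omega>. \<integral>y. h y * Z k y \<omega> \<partial>mu)"
    and "all_moments M U \<Longrightarrow> integrable mu (\<lambda>y. h y * expectation (\<lambda>\<omega>. Z k y \<omega> * U \<omega>))"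
    and "all_moments M U \<Longrightarrow> (\<integral>y. h y * expectation (\<lambda>\<omega>. Z k y \<omega> * U \<omega>) \<partial>mu) = expectation (\<lambda>\<omega>. (\<integral>y. h y * Z k y \<omega> \<partial>mu) * U \<omega>)"
proof -
  note [measurable] = h(1)
  have [measurable]: "(\<lambda>x. Z k (snd x) (fst x)) \<in> borel_measurable (M \<Otimes>\<^sub>M mu)"
    using Z_meas'[OF k] by (simp add: case_prod_beta')
  have 1: "(\<lambda>(\<omega>, y). h y * Z k y \<omega>) \<in> borel_measurable (M \<Otimes>\<^sub>M mu)" unfolding case_prod_beta' by measurable
  have bound: "\<bar>h y * Z k y \<omega>\<bar> \<le> (h y)\<^sup>2 + (Z k y \<omega>)\<^sup>2" for y \<omega>
  proof -
    have "0 \<le> \<bar>h y\<bar> * \<bar>Z k y \<omega>\<bar>" by simp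
    moreover have "2 * (\<bar>h y\<bar> * \<bar>Z k y \<omega>\<bar>) \<le> (h y)\<^sup>2 + (Z k y \<omega>)\<^sup>2"
      using sum_squares_bound[of "\<bar>h y\<bar>" "\<bar>Z k y \<omega>\<bar>"] by (simp add: mult.assoc)
    ultimately show ?thesis unfolding abs_mult by linarith
  qed
  have 2: "integrable mu (\<lambda>y. h y * Z k y \<omega>)" if w: "\<omega> \<in> space M" for \<omega>
  proof (rule Bochner_Integration.integrable_bound)
    show "integrable mu (\<lambda>y. (h y)\<^sup>2 + (Z k y \<omega>)\<^sup>2)" using h Z_paths[OF k w] by simp
    show "(\<lambda>y. h y * Z k y \<omega>) \<in> borel_measurable mu" using Z_path_meas[OF k w] by measurable
    show "AE y in mu. norm (h y * Z k y \<omega>) \<le> norm ((h y)\<^sup>2 + (Z k y \<omega>)\<^sup>2)"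
      using bound by (intro AE_I2) (simp add: add_nonneg_nonneg)
  qed
  have 3: "all_moments M (\<lambda>\<omega>. (\<integral>y. (h y)\<^sup>2 \<partial>mu) + Q k \<omega>)"
    by (intro all_moments_add all_moments_const Q_all_moments k)
  have 4: "(\<integral>y. \<bar>h y * Z k y \<omega>\<bar> \<partial>mu) \<le> (\<integral>y. (h y)\<^sup>2 \<partial>mu) + Q k \<omega>" if w: "\<omega> \<in> space M" for \<omega>
  proof -
    have "(\<integral>y. \<bar>h y * Z k y \<omega>\<bar> \<partial>mu) \<le> (\<integral>y. (h y)\<^sup>2 + (Z k y \<omega>)\<^sup>2 \<partial>mu)"
      using 2[OF w] h Z_paths[OF k w] bound by (intro integral_mono) auto
    thus ?thesis unfolding Q_def using h Z_paths[OF k w] by simp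
  qed
  show "all_moments M (\<lambda>\<omega>. \<integral>y. h y * Z k y \<omega> \<partial>mu)" by (rule fubini(1)[OF 1 2 3 4])
  show "integrable mu (\<lambda>y. h y * expectation (\<lambda>\<omega>. Z k y \<omega> * U \<omega>))" if U: "all_moments M U"
    using fubini(2)[OF 1 2 3 4 U] by (simp add: mult.assoc)
  show "(\<integral>y. h y * expectation (\<lambda>\<omega>. Z k y \<omega> * U \<omega>) \<partial>mu) = expectation (\<lambda>\<omega>. (\<integral>y. h y * Z k y \<omega> \<partial>mu) * U \<omega>)"
    if U: "all_moments M U"
    using fubini(3)[OF 1 2 3 4 U] by (simp add: mult.assoc)
qed

lemma cross_cov_meas:
  assumes k: "k \<in> K" and W: "W \<in> H"
  shows "(\<lambda>y. expectation (\<lambda>\<omega>. W \<omega> * Z k y \<omega>)) \<in> borel_measurable mu"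
proof (rule borel_measurable_lebesgue_integral)
  have [measurable]: "(\<lambda>x. Z k (fst x) (snd x)) \<in> borel_measurable (mu \<Otimes>\<^sub>M M)"
    using Z_meas[OF k] by (simp add: case_prod_beta')
  have [measurable]: "W \<in> borel_measurable M" by (rule H_measurable[OF W])
  show "(\<lambda>(y, \<omega>). W \<omega> * Z k y \<omega>) \<in> borel_measurable (mu \<Otimes>\<^sub>M M)" unfolding case_prod_beta' by measurable
qed

lemma H_square_integrable: "U \<in> H \<Longrightarrow> integrable M (\<lambda>\<omega>. (U \<omega>)\<^sup>2)"
  using H_product_integrable[of U U] by (simp add: power2_eq_square)

lemma H_cauchy_schwarz:
  assumes "U \<in> H" "V \<in> H"
  shows "\<bar>expectation (\<lambda>\<omega>. U \<omega> * V \<omega>)\<bar> \<le> sqrt (expectation (\<lambda>\<omega>. U \<omega> * U \<omega>)) * sqrt (expectation (\<lambda>\<omega>. V \<omega> * V \<omega>))"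
  using integral_mult_le_sqrt[OF H_square_integrable[OF assms(1)] H_square_integrable[OF assms(2)] H_product_integrable[OF assms]]
  by (simp add: power2_eq_square)

lemma cross_cov_square:
  assumes k: "k \<in> K" and W: "W \<in> H"
  shows "integrable mu (\<lambda>y. (expectation (\<lambda>\<omega>. W \<omega> * Z k y \<omega>))\<^sup>2)"
proof (rule Bochner_Integration.integrable_bound)
  show "integrable mu (\<lambda>y. expectation (\<lambda>\<omega>. W \<omega> * W \<omega>) * expectation (\<lambda>\<omega>. Z k y \<omega> * Z k y \<omega>))"
    using energy[OF k] by simp
  show "(\<lambda>y. (expectation (\<lambda>\<omega>. W \<omega> * Z k y \<omega>))\<^sup>2) \<in> borel_measurable mu"
    using cross_cov_meas[OF k W] by measurable
  show "AE y in mu. norm ((expectation (\<lambda>\<omega>. W \<omega> * Z k y \<omega>))\<^sup>2) \<le> norm (expectation (\<lambda>\<omega>. W \<omega> * W \<omega>) * expectation (\<lambda>\<omega>. Z k y \<omega> * Z k y \<omega>))"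
  proof (rule AE_I2)
    fix y assume y: "y \<in> space mu"
    have "(expectation (\<lambda>\<omega>. W \<omega> * Z k y \<omega>))\<^sup>2 \<le> (sqrt (expectation (\<lambda>\<omega>. W \<omega> * W \<omega>)) * sqrt (expectation (\<lambda>\<omega>. Z k y \<omega> * Z k y \<omega>)))\<^sup>2"
      using H_cauchy_schwarz[OF W Z_H[OF k y]] by (intro power2_le_iff_abs_le[THEN iffD2]) auto
    also have "\<dots> = expectation (\<lambda>\<omega>. W \<omega> * W \<omega>) * expectation (\<lambda>\<omega>. Z k y \<omega> * Z k y \<omega>)"
      by (simp add: power_mult_distrib)
    finally show "norm ((expectation (\<lambda>\<omega>. W \<omega> * Z k y \<omega>))\<^sup>2) \<le> norm (expectation (\<lambda>\<omega>. W \<omega> * W \<omega>) * expectation (\<lambda>\<omega>. Z k y \<omega> * Z k y \<omega>))"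
      by simp
  qed
qed

text \<open>Half the derivative of \<open>Qt\<close> in the Cameron-Martin direction of \<open>W\<close>.\<close>

definition "DQ W \<omega> = (\<Sum>k\<in>K. t k * (\<integral>y. expectation (\<lambda>\<omega>. W \<omega> * Z k y \<omega>) * Z k y \<omega> \<partial>mu))"

lemma all_moments_sum: "finite I \<Longrightarrow> (\<And>i. i \<in> I \<Longrightarrow> all_moments M (U i)) \<Longrightarrow> all_moments M (\<lambda>\<omega>. \<Sum>i\<in>I. U i \<omega>)"
  by (induction I rule: finite_induct) (auto simp: all_moments_const intro: all_moments_add)

lemma DQ_all_moments: "W \<in> H \<Longrightarrow> all_moments M (DQ W)"
  unfolding DQ_def[abs_def]
  by (intro all_moments_sum finK all_moments_mult all_moments_const fubini_linear(1) cross_cov_meas cross_cov_square)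

lemma expectation_Qt_mult:
  assumes U: "all_moments M U"
  shows "expectation (\<lambda>\<omega>. Qt \<omega> * U \<omega>) = (\<Sum>k\<in>K. t k * (\<integral>x. expectation (\<lambda>\<omega>. (Z k x \<omega>)\<^sup>2 * U \<omega>) \<partial>mu))"
proof -
  have "expectation (\<lambda>\<omega>. Qt \<omega> * U \<omega>) = expectation (\<lambda>\<omega>. \<Sum>k\<in>K. t k * (Q k \<omega> * U \<omega>))"
    by (simp add: Qt_def sum_distrib_right mult.assoc)
  also have "\<dots> = (\<Sum>k\<in>K. t k * expectation (\<lambda>\<omega>. Q k \<omega> * U \<omega>))"
    using all_moments_integrable[OF all_moments_mult[OF Q_all_moments U]]
    by (subst Bochner_Integration.integral_sum) auto
  finally show ?thesis by (simp add: fubini_square(2)[OF _ U])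
qed

lemma expectation_DQ_mult:
  assumes W: "W \<in> H" and U: "all_moments M U"
  shows "expectation (\<lambda>\<omega>. DQ W \<omega> * U \<omega>) = (\<Sum>k\<in>K. t k * (\<integral>x. expectation (\<lambda>\<omega>. W \<omega> * Z k x \<omega>) * expectation (\<lambda>\<omega>. Z k x \<omega> * U \<omega>) \<partial>mu))"
proof -
  have "expectation (\<lambda>\<omega>. DQ W \<omega> * U \<omega>) = expectation (\<lambda>\<omega>. \<Sum>k\<in>K. t k * ((\<integral>y. expectation (\<lambda>\<omega>. W \<omega> * Z k y \<omega>) * Z k y \<omega> \<partial>mu) * U \<omega>))"
    by (simp add: DQ_def sum_distrib_right mult.assoc)
  also have "\<dots> = (\<Sum>k\<in>K. t k * expectation (\<lambda>\<omega>. (\<integral>y. expectation (\<lambda>\<omega>. W \<omega> * Z k y \<omega>) * Z k y \<omega> \<partial>mu) * U \<omega>))"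
    using all_moments_integrable[OF all_moments_mult[OF fubini_linear(1)[OF _ cross_cov_meas[OF _ W] cross_cov_square[OF _ W]] U]]
    by (subst Bochner_Integration.integral_sum) auto
  finally show ?thesis by (simp add: fubini_linear(3)[OF _ cross_cov_meas[OF _ W] cross_cov_square[OF _ W] U])
qed

text \<open>Induction on the power of \<open>Qt\<close>: one factor is written as integrals of
  squares, the two copies of \<open>Z k x\<close> join the list \<open>L\<close>, and after the
  induction hypothesis Fubini takes them out again. Pairing \<open>W\<close> with either copy gives
  2 \<open>DQ W\<close>, raising the coefficient 2 n to 2 (n + 1). Hence \<open>L\<close> is kept
  general.\<close>

lemma integration_by_parts:
  assumes W: "W \<in> H"
  shows "set L \<subseteq> H \<Longrightarrow> expectation (\<lambda>\<omega>. W \<omega> * lprod L \<omega> * Qt \<omega> ^ n) =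
    expectation (\<lambda>\<omega>. del W L \<omega> * Qt \<omega> ^ n) + 2 * real n * expectation (\<lambda>\<omega>. DQ W \<omega> * (lprod L \<omega> * Qt \<omega> ^ (n - 1)))"
proof (induction n arbitrary: L)
  case 0
  thus ?case using isserlis[OF W] by simp
next
  case (Suc n)
  note L = Suc.prems
  note am = all_moments_mult all_moments_power all_moments_lprod[OF L] all_moments_del[OF W L] H_all_moments[OF W]
    DQ_all_moments[OF W] Qt_all_moments
  have step: "expectation (\<lambda>\<omega>. (Z k x \<omega>)\<^sup>2 * (W \<omega> * lprod L \<omega> * Qt \<omega> ^ n)) =
      2 * (expectation (\<lambda>\<omega>. W \<omega> * Z k x \<omega>) * expectation (\<lambda>\<omega>. Z k x \<omega> * (lprod L \<omega> * Qt \<omega> ^ n)))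
      + expectation (\<lambda>\<omega>. (Z k x \<omega>)\<^sup>2 * (del W L \<omega> * Qt \<omega> ^ n))
      + 2 * real n * expectation (\<lambda>\<omega>. (Z k x \<omega>)\<^sup>2 * (DQ W \<omega> * (lprod L \<omega> * Qt \<omega> ^ (n - 1))))"
    if k: "k \<in> K" and x: "x \<in> space mu" for k x
  proof -
    have ZH: "Z k x \<in> H" by (rule Z_H[OF k x])
    note am' = H_all_moments[OF ZH]
    have "expectation (\<lambda>\<omega>. (Z k x \<omega>)\<^sup>2 * (W \<omega> * lprod L \<omega> * Qt \<omega> ^ n)) = expectation (\<lambda>\<omega>. W \<omega> * lprod (Z k x # Z k x # L) \<omega> * Qt \<omega> ^ n)"
      by (simp add: power2_eq_square mult_ac)
    also have "\<dots> = expectation (\<lambda>\<omega>. del W (Z k x # Z k x # L) \<omega> * Qt \<omega> ^ n) +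
       2 * real n * expectation (\<lambda>\<omega>. DQ W \<omega> * (lprod (Z k x # Z k x # L) \<omega> * Qt \<omega> ^ (n - 1)))"
      by (rule Suc.IH) (use L ZH in auto)
    also have "expectation (\<lambda>\<omega>. del W (Z k x # Z k x # L) \<omega> * Qt \<omega> ^ n) =
      expectation (\<lambda>\<omega>. 2 * expectation (\<lambda>\<omega>. W \<omega> * Z k x \<omega>) * (Z k x \<omega> * (lprod L \<omega> * Qt \<omega> ^ n)) + (Z k x \<omega>)\<^sup>2 * (del W L \<omega> * Qt \<omega> ^ n))"
      by (intro Bochner_Integration.integral_cong refl) (simp add: power2_eq_square algebra_simps)
    also have "\<dots> = 2 * (expectation (\<lambda>\<omega>. W \<omega> * Z k x \<omega>) * expectation (\<lambda>\<omega>. Z k x \<omega> * (lprod L \<omega> * Qt \<omega> ^ n)))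
      + expectation (\<lambda>\<omega>. (Z k x \<omega>)\<^sup>2 * (del W L \<omega> * Qt \<omega> ^ n))"
    proof -
      have "integrable M (\<lambda>\<omega>. Z k x \<omega> * (lprod L \<omega> * Qt \<omega> ^ n))" "integrable M (\<lambda>\<omega>. (Z k x \<omega>)\<^sup>2 * (del W L \<omega> * Qt \<omega> ^ n))"
        by (intro all_moments_integrable am am')+
      thus ?thesis by simp
    qed
    also have "(\<lambda>\<omega>. DQ W \<omega> * (lprod (Z k x # Z k x # L) \<omega> * Qt \<omega> ^ (n - 1))) = (\<lambda>\<omega>. (Z k x \<omega>)\<^sup>2 * (DQ W \<omega> * (lprod L \<omega> * Qt \<omega> ^ (n - 1))))"
      by (auto simp: power2_eq_square mult_ac)
    finally show ?thesis .
  qed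
  \<comment> \<open>At n = 0 the truncated exponent n - 1 breaks the identity of the expectations;
    the factor n makes both sides vanish there.\<close>
  have last: "expectation (\<lambda>\<omega>. Qt \<omega> * (DQ W \<omega> * (lprod L \<omega> * Qt \<omega> ^ (n - 1)))) * real n =
     expectation (\<lambda>\<omega>. DQ W \<omega> * (lprod L \<omega> * Qt \<omega> ^ n)) * real n"
  proof (cases n)
    case (Suc m)
    thus ?thesis by (simp add: mult_ac)
  qed simp
  have "expectation (\<lambda>\<omega>. W \<omega> * lprod L \<omega> * Qt \<omega> ^ Suc n) = expectation (\<lambda>\<omega>. Qt \<omega> * (W \<omega> * lprod L \<omega> * Qt \<omega> ^ n))"
    by (simp add: mult_ac)
  also have "\<dots> = (\<Sum>k\<in>K. t k * (\<integral>x. expectation (\<lambda>\<omega>. (Z k x \<omega>)\<^sup>2 * (W \<omega> * lprod L \<omega> * Qt \<omega> ^ n)) \<partial>mu))"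
    by (intro expectation_Qt_mult am)
  also have "\<dots> = (\<Sum>k\<in>K. 2 * (t k * (\<integral>x. expectation (\<lambda>\<omega>. W \<omega> * Z k x \<omega>) * expectation (\<lambda>\<omega>. Z k x \<omega> * (lprod L \<omega> * Qt \<omega> ^ n)) \<partial>mu))
     + t k * (\<integral>x. expectation (\<lambda>\<omega>. (Z k x \<omega>)\<^sup>2 * (del W L \<omega> * Qt \<omega> ^ n)) \<partial>mu)
     + 2 * real n * (t k * (\<integral>x. expectation (\<lambda>\<omega>. (Z k x \<omega>)\<^sup>2 * (DQ W \<omega> * (lprod L \<omega> * Qt \<omega> ^ (n - 1)))) \<partial>mu)))"
  proof (rule sum.cong[OF refl])
    fix k assume k: "k \<in> K"
    have i1: "integrable mu (\<lambda>x. expectation (\<lambda>\<omega>. W \<omega> * Z k x \<omega>) * expectation (\<lambda>\<omega>. Z k x \<omega> * (lprod L \<omega> * Qt \<omega> ^ n)))"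
      by (intro fubini_linear(2) cross_cov_meas cross_cov_square k W am)
    have i2: "integrable mu (\<lambda>x. expectation (\<lambda>\<omega>. (Z k x \<omega>)\<^sup>2 * (del W L \<omega> * Qt \<omega> ^ n)))"
      by (intro fubini_square(1) k am)
    have i3: "integrable mu (\<lambda>x. expectation (\<lambda>\<omega>. (Z k x \<omega>)\<^sup>2 * (DQ W \<omega> * (lprod L \<omega> * Qt \<omega> ^ (n - 1)))))"
      by (intro fubini_square(1) k am)
    have "(\<integral>x. expectation (\<lambda>\<omega>. (Z k x \<omega>)\<^sup>2 * (W \<omega> * lprod L \<omega> * Qt \<omega> ^ n)) \<partial>mu) =
       (\<integral>x. 2 * (expectation (\<lambda>\<omega>. W \<omega> * Z k x \<omega>) * expectation (\<lambda>\<omega>. Z k x \<omega> * (lprod L \<omega> * Qt \<omega> ^ n)))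
      + expectation (\<lambda>\<omega>. (Z k x \<omega>)\<^sup>2 * (del W L \<omega> * Qt \<omega> ^ n))
      + 2 * real n * expectation (\<lambda>\<omega>. (Z k x \<omega>)\<^sup>2 * (DQ W \<omega> * (lprod L \<omega> * Qt \<omega> ^ (n - 1)))) \<partial>mu)"
      by (intro Bochner_Integration.integral_cong refl step k)
    also have "\<dots> = 2 * (\<integral>x. expectation (\<lambda>\<omega>. W \<omega> * Z k x \<omega>) * expectation (\<lambda>\<omega>. Z k x \<omega> * (lprod L \<omega> * Qt \<omega> ^ n)) \<partial>mu)
       + (\<integral>x. expectation (\<lambda>\<omega>. (Z k x \<omega>)\<^sup>2 * (del W L \<omega> * Qt \<omega> ^ n)) \<partial>mu)
       + 2 * real n * (\<integral>x. expectation (\<lambda>\<omega>. (Z k x \<omega>)\<^sup>2 * (DQ W \<omega> * (lprod L \<omega> * Qt \<omega> ^ (n - 1)))) \<partial>mu)"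
      using i1 i2 i3 by simp
    finally show "t k * (\<integral>x. expectation (\<lambda>\<omega>. (Z k x \<omega>)\<^sup>2 * (W \<omega> * lprod L \<omega> * Qt \<omega> ^ n)) \<partial>mu) =
       2 * (t k * (\<integral>x. expectation (\<lambda>\<omega>. W \<omega> * Z k x \<omega>) * expectation (\<lambda>\<omega>. Z k x \<omega> * (lprod L \<omega> * Qt \<omega> ^ n)) \<partial>mu))
     + t k * (\<integral>x. expectation (\<lambda>\<omega>. (Z k x \<omega>)\<^sup>2 * (del W L \<omega> * Qt \<omega> ^ n)) \<partial>mu)
     + 2 * real n * (t k * (\<integral>x. expectation (\<lambda>\<omega>. (Z k x \<omega>)\<^sup>2 * (DQ W \<omega> * (lprod L \<omega> * Qt \<omega> ^ (n - 1)))) \<partial>mu))"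
      by (simp add: algebra_simps)
  qed
  also have "\<dots> = 2 * expectation (\<lambda>\<omega>. DQ W \<omega> * (lprod L \<omega> * Qt \<omega> ^ n))
     + expectation (\<lambda>\<omega>. Qt \<omega> * (del W L \<omega> * Qt \<omega> ^ n))
     + 2 * real n * expectation (\<lambda>\<omega>. Qt \<omega> * (DQ W \<omega> * (lprod L \<omega> * Qt \<omega> ^ (n - 1))))"
  proof -
    have u: "all_moments M (\<lambda>\<omega>. lprod L \<omega> * Qt \<omega> ^ n)" "all_moments M (\<lambda>\<omega>. del W L \<omega> * Qt \<omega> ^ n)"
      "all_moments M (\<lambda>\<omega>. DQ W \<omega> * (lprod L \<omega> * Qt \<omega> ^ (n - 1)))" by (intro am)+
    show ?thesis unfolding sum.distrib sum_distrib_left[symmetric] expectation_Qt_mult[OF u(2)] expectation_Qt_mult[OF u(3)]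
      expectation_DQ_mult[OF W u(1)] ..
  qed
  finally show ?case using last by (simp add: algebra_simps)
qed

end

section \<open>Contractions of the covariance and the moment recursion\<close>

context gauss_quadratic begin

lemma R_diag_nonneg: "0 \<le> R k x x" by (simp add: R_def)

lemma R_bound: "k \<in> K \<Longrightarrow> x \<in> space mu \<Longrightarrow> y \<in> space mu \<Longrightarrow> \<bar>R k x y\<bar> \<le> sqrt (R k x x) * sqrt (R k y y)"
  unfolding R_def by (intro H_cauchy_schwarz Z_H)

lemma R_meas: "k \<in> K \<Longrightarrow> (\<lambda>(x, y). R k x y) \<in> borel_measurable (mu \<Otimes>\<^sub>M mu)"
proof -
  assume k: "k \<in> K"
  have 1: "(\<lambda>x. Z k (fst (fst x)) (snd x)) \<in> borel_measurable ((mu \<Otimes>\<^sub>M mu) \<Otimes>\<^sub>M M)"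
    using measurable_compose[of "\<lambda>x. (fst (fst x), snd x)" "(mu \<Otimes>\<^sub>M mu) \<Otimes>\<^sub>M M" "mu \<Otimes>\<^sub>M M", OF _ Z_meas[OF k]] by simp
  have 2: "(\<lambda>x. Z k (snd (fst x)) (snd x)) \<in> borel_measurable ((mu \<Otimes>\<^sub>M mu) \<Otimes>\<^sub>M M)"
    using measurable_compose[of "\<lambda>x. (snd (fst x), snd x)" "(mu \<Otimes>\<^sub>M mu) \<Otimes>\<^sub>M M" "mu \<Otimes>\<^sub>M M", OF _ Z_meas[OF k]] by simp
  have "(\<lambda>p. expectation (\<lambda>\<omega>. Z k (fst p) \<omega> * Z k (snd p) \<omega>)) \<in> borel_measurable (mu \<Otimes>\<^sub>M mu)"
    by (rule borel_measurable_lebesgue_integral) (use 1 2 in \<open>simp add: case_prod_beta'\<close>)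
  thus ?thesis by (simp add: R_def case_prod_beta')
qed

lemma R_diag_integrable: "k \<in> K \<Longrightarrow> integrable mu (\<lambda>y. R k y y)"
  using energy by (simp add: R_def)

definition "Tr k = (\<integral>y. R k y y \<partial>mu)"

lemma R_section_meas: "k \<in> K \<Longrightarrow> y \<in> space mu \<Longrightarrow> R k y \<in> borel_measurable mu"
  using measurable_compose[OF measurable_Pair1' R_meas, of y k] by simp

text \<open>One contraction step: bounding \<open>f\<close> and R(y, .) by the square root of the
  diagonal makes the integrand at most a multiple of R(u, u), so each contraction costs one factor
  \<open>Tr k\<close>.\<close>

lemma mult_R_bound:
  assumes k: "k \<in> K" and y: "y \<in> space mu" and f: "f \<in> borel_measurable mu"
    and le: "\<And>u. u \<in> space mu \<Longrightarrow> \<bar>f u\<bar> \<le> c * sqrt (R k u u)"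
  shows "integrable mu (\<lambda>u. f u * R k y u)"
    and "\<bar>\<integral>u. f u * R k y u \<partial>mu\<bar> \<le> c * sqrt (R k y y) * Tr k"
proof -
  have b: "\<bar>f u * R k y u\<bar> \<le> c * sqrt (R k y y) * R k u u" if u: "u \<in> space mu" for u
  proof -
    have "\<bar>f u\<bar> * \<bar>R k y u\<bar> \<le> (c * sqrt (R k u u)) * (sqrt (R k y y) * sqrt (R k u u))"
      using order_trans[OF abs_ge_zero le[OF u]] by (intro mult_mono le R_bound k y u) auto
    also have "\<dots> = c * sqrt (R k y y) * (sqrt (R k u u) * sqrt (R k u u))" by (simp only: mult_ac)
    also have "sqrt (R k u u) * sqrt (R k u u) = R k u u" using R_diag_nonneg[of k u] by simp
    finally show ?thesis by (simp add: abs_mult)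
  qed
  have i: "integrable mu (\<lambda>u. c * sqrt (R k y y) * R k u u)" using R_diag_integrable[OF k] by simp
  show int: "integrable mu (\<lambda>u. f u * R k y u)"
  proof (rule Bochner_Integration.integrable_bound[OF i])
    show "(\<lambda>u. f u * R k y u) \<in> borel_measurable mu" using f R_section_meas[OF k y] by measurable
    show "AE u in mu. norm (f u * R k y u) \<le> norm (c * sqrt (R k y y) * R k u u)"
      using b by (intro AE_I2) (metis abs_ge_self order_trans real_norm_def)
  qed
  have "\<bar>\<integral>u. f u * R k y u \<partial>mu\<bar> \<le> (\<integral>u. \<bar>f u * R k y u\<bar> \<partial>mu)"
    using integral_norm_bound[of mu "\<lambda>u. f u * R k y u"] by simp
  also have "\<dots> \<le> (\<integral>u. c * sqrt (R k y y) * R k u u \<partial>mu)"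
    using int i b by (intro integral_mono) auto
  finally show "\<bar>\<integral>u. f u * R k y u \<partial>mu\<bar> \<le> c * sqrt (R k y y) * Tr k" by (simp add: Tr_def)
qed

text \<open>The bound is carried along with joint measurability because the next contraction needs
  both.\<close>

lemma contr_R:
  assumes k: "k \<in> K"
  shows "(\<lambda>(x, y). contr mu (Suc n) (R k) x y) \<in> borel_measurable (mu \<Otimes>\<^sub>M mu)"
    and "x \<in> space mu \<Longrightarrow> y \<in> space mu \<Longrightarrow> \<bar>contr mu (Suc n) (R k) x y\<bar> \<le> sqrt (R k x x) * Tr k ^ n * sqrt (R k y y)"
proof (induction n arbitrary: x y)
  case 0
  case 1 show ?case using R_meas[OF k] by simp
  case 2 thus ?case using R_bound[OF k] by simp
next
  case (Suc n)
  let ?C = "contr mu (Suc n) (R k)"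
  case 1
  have C: "(\<lambda>p. ?C (fst (fst p)) (snd p)) \<in> borel_measurable ((mu \<Otimes>\<^sub>M mu) \<Otimes>\<^sub>M mu)"
    using measurable_compose[of "\<lambda>x. (fst (fst x), snd x)" "(mu \<Otimes>\<^sub>M mu) \<Otimes>\<^sub>M mu" "mu \<Otimes>\<^sub>M mu", OF _ Suc.IH(1)] by simp
  have R: "(\<lambda>p. R k (snd (fst p)) (snd p)) \<in> borel_measurable ((mu \<Otimes>\<^sub>M mu) \<Otimes>\<^sub>M mu)"
    using measurable_compose[of "\<lambda>x. (snd (fst x), snd x)" "(mu \<Otimes>\<^sub>M mu) \<Otimes>\<^sub>M mu" "mu \<Otimes>\<^sub>M mu", OF _ R_meas[OF k]] by simp
  have "(\<lambda>p. \<integral>u. ?C (fst p) u * R k (snd p) u \<partial>mu) \<in> borel_measurable (mu \<Otimes>\<^sub>M mu)"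
    by (rule mu.borel_measurable_lebesgue_integral) (use borel_measurable_times[OF C R] in \<open>simp add: case_prod_beta'\<close>)
  thus ?case by (simp add: contr2_def case_prod_beta')
  case 2
  have "?C x \<in> borel_measurable mu" using measurable_compose[OF measurable_Pair1'[OF 2(1)] Suc.IH(1)] by simp
  from mult_R_bound(2)[OF k 2(2) this Suc.IH(2)[OF 2(1)]] show ?case by (simp add: contr2_def mult_ac)
qed

lemma contr_R_integrable:
  assumes k: "k \<in> K" and x: "x \<in> space mu" and y: "y \<in> space mu"
  shows "integrable mu (\<lambda>u. contr mu (Suc n) (R k) x u * R k y u)"
proof -
  have "contr mu (Suc n) (R k) x \<in> borel_measurable mu"
    using measurable_compose[OF measurable_Pair1'[OF x] contr_R(1)[OF k]] by simp
  from mult_R_bound(1)[OF k y this contr_R(2)[OF k x]] show ?thesis .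
qed

lemma contr_diag_integrable:
  assumes k: "k \<in> K"
  shows "integrable mu (\<lambda>y. contr mu (Suc n) (R k) y y)"
proof (rule Bochner_Integration.integrable_bound)
  show "integrable mu (\<lambda>y. R k y y * Tr k ^ n)" using R_diag_integrable[OF k] by simp
  have "(\<lambda>y. (y, y)) \<in> mu \<rightarrow>\<^sub>M mu \<Otimes>\<^sub>M mu" by simp
  from measurable_compose[OF this contr_R(1)[OF k, of n]]
  show "(\<lambda>y. contr mu (Suc n) (R k) y y) \<in> borel_measurable mu" by simp
  show "AE y in mu. norm (contr mu (Suc n) (R k) y y) \<le> norm (R k y y * Tr k ^ n)"
  proof (rule AE_I2)
    fix y assume y: "y \<in> space mu"
    have *: "sqrt (R k y y) * Tr k ^ n * sqrt (R k y y) = (sqrt (R k y y) * sqrt (R k y y)) * Tr k ^ n" by (simp only: mult_ac)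
    have "\<bar>contr mu (Suc n) (R k) y y\<bar> \<le> R k y y * Tr k ^ n"
      using contr_R(2)[OF k y y, of n] R_diag_nonneg[of k y] unfolding * by simp
    thus "norm (contr mu (Suc n) (R k) y y) \<le> norm (R k y y * Tr k ^ n)" unfolding real_norm_def by linarith
  qed
qed

text \<open>Two-point function of \<open>Z k\<close> weighted by the n-th power of
  \<open>Qt\<close>; the integrals over its diagonal, weighted by \<open>t k\<close>, sum up to the
  next moment of \<open>Qt\<close>.\<close>

definition "A k n x y = expectation (\<lambda>\<omega>. Z k x \<omega> * (Z k y \<omega> * Qt \<omega> ^ n))"
definition "mom n = expectation (\<lambda>\<omega>. Qt \<omega> ^ n)"

text \<open>Integration by parts in the direction \<open>Z k y\<close> with the one-element list
  [\<open>Z k x\<close>]. In \<open>DQ\<close> the processes other than \<open>Z k\<close> drop out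
  because they are uncorrelated with it.\<close>

lemma A_rec:
  assumes k: "k \<in> K" and x: "x \<in> space mu" and y: "y \<in> space mu"
  shows "A k n x y = R k x y * mom n + 2 * real n * (t k * (\<integral>u. R k y u * A k (n - 1) x u \<partial>mu))"
proof -
  have Zx: "Z k x \<in> H" and Zy: "Z k y \<in> H" using Z_H k x y by auto
  have U: "all_moments M (\<lambda>\<omega>. Z k x \<omega> * Qt \<omega> ^ (n - 1))"
    by (intro all_moments_mult H_all_moments Zx all_moments_power Qt_all_moments)
  have "A k n x y = expectation (\<lambda>\<omega>. Z k y \<omega> * lprod [Z k x] \<omega> * Qt \<omega> ^ n)" by (simp add: A_def mult_ac)
  also have "\<dots> = expectation (\<lambda>\<omega>. del (Z k y) [Z k x] \<omega> * Qt \<omega> ^ n) +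
      2 * real n * expectation (\<lambda>\<omega>. DQ (Z k y) \<omega> * (lprod [Z k x] \<omega> * Qt \<omega> ^ (n - 1)))"
    by (rule integration_by_parts[OF Zy]) (use Zx in simp)
  also have "expectation (\<lambda>\<omega>. del (Z k y) [Z k x] \<omega> * Qt \<omega> ^ n) = R k x y * mom n"
    by (simp add: R_def mom_def mult.commute)
  also have "expectation (\<lambda>\<omega>. DQ (Z k y) \<omega> * (lprod [Z k x] \<omega> * Qt \<omega> ^ (n - 1))) =
     (\<Sum>l\<in>K. t l * (\<integral>u. expectation (\<lambda>\<omega>. Z k y \<omega> * Z l u \<omega>) * expectation (\<lambda>\<omega>. Z l u \<omega> * (Z k x \<omega> * Qt \<omega> ^ (n - 1))) \<partial>mu))"
    using expectation_DQ_mult[OF Zy U] by simp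
  also have "\<dots> = (\<Sum>l\<in>K. if l = k then t k * (\<integral>u. R k y u * A k (n - 1) x u \<partial>mu) else 0)"
  proof (rule sum.cong[OF refl])
    fix l assume l: "l \<in> K"
    show "t l * (\<integral>u. expectation (\<lambda>\<omega>. Z k y \<omega> * Z l u \<omega>) * expectation (\<lambda>\<omega>. Z l u \<omega> * (Z k x \<omega> * Qt \<omega> ^ (n - 1))) \<partial>mu) =
      (if l = k then t k * (\<integral>u. R k y u * A k (n - 1) x u \<partial>mu) else 0)"
    proof (cases "l = k")
      case True
      thus ?thesis by (simp add: R_def A_def mult.left_commute)
    next
      case False
      have "(\<integral>u. expectation (\<lambda>\<omega>. Z k y \<omega> * Z l u \<omega>) * expectation (\<lambda>\<omega>. Z l u \<omega> * (Z k x \<omega> * Qt \<omega> ^ (n - 1))) \<partial>mu) = (\<integral>u. 0 \<partial>mu)"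
        using uncorrelated[OF k l False[symmetric] y] by (intro Bochner_Integration.integral_cong refl) simp
      thus ?thesis using False by simp
    qed
  qed
  also have "\<dots> = t k * (\<integral>u. R k y u * A k (n - 1) x u \<partial>mu)" using k finK by simp
  finally show ?thesis .
qed

text \<open>The recursion unrolled: every step contracts once more with \<open>R k\<close> and
  contributes 2 n \<open>t k\<close> at the current n, so j steps give the falling factorial n!/(n -
  j)!.\<close>

lemma A_eq:
  assumes k: "k \<in> K"
  shows "x \<in> space mu \<Longrightarrow> y \<in> space mu \<Longrightarrow>
    A k n x y = (\<Sum>j\<le>n. 2 ^ j * (fact n / fact (n - j)) * mom (n - j) * t k ^ j * contr mu (Suc j) (R k) x y)"
proof (induction n arbitrary: y)
  case 0
  thus ?case using A_rec[OF k, of x y 0] by simp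
next
  case (Suc n)
  note x = Suc.prems(1) and y = Suc.prems(2)
  define c where "c j = 2 ^ j * (fact n / fact (n - j)) * mom (n - j) * t k ^ j" for j
  have "(\<integral>u. R k y u * A k n x u \<partial>mu) = (\<integral>u. (\<Sum>j\<le>n. c j * (contr mu (Suc j) (R k) x u * R k y u)) \<partial>mu)"
    using Suc.IH[OF x] by (intro Bochner_Integration.integral_cong refl) (simp add: c_def sum_distrib_left mult_ac)
  also have "\<dots> = (\<Sum>j\<le>n. c j * contr mu (Suc (Suc j)) (R k) x y)"
    using contr_R_integrable[OF k x y] by (subst Bochner_Integration.integral_sum) (auto simp: contr2_def)
  finally have "A k (Suc n) x y = R k x y * mom (Suc n) + (\<Sum>j\<le>n. 2 * real (Suc n) * t k * c j * contr mu (Suc (Suc j)) (R k) x y)"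
    using A_rec[OF k x y, of "Suc n"] by (simp add: sum_distrib_left mult_ac del: of_nat_Suc contr.simps)
  also have "(\<Sum>j\<le>n. 2 * real (Suc n) * t k * c j * contr mu (Suc (Suc j)) (R k) x y) =
     (\<Sum>j\<le>n. 2 ^ Suc j * (fact (Suc n) / fact (Suc n - Suc j)) * mom (Suc n - Suc j) * t k ^ Suc j * contr mu (Suc (Suc j)) (R k) x y)"
    by (intro sum.cong refl) (simp add: c_def del: of_nat_Suc contr.simps)
  also have "R k x y * mom (Suc n) + \<dots> = (\<Sum>j\<le>Suc n. 2 ^ j * (fact (Suc n) / fact (Suc n - j)) * mom (Suc n - j) * t k ^ j * contr mu (Suc j) (R k) x y)"
    by (subst sum.atMost_Suc_shift) (simp del: fact_Suc of_nat_Suc)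
  finally show ?case .
qed

text \<open>For n \<ge> 1, the trace of the n-th power of the integral operator with kernel
  \<open>R k\<close>.\<close>

definition "trace_power k n = (\<integral>y. contr mu n (R k) y y \<partial>mu)"

lemma mom_Suc: "mom (Suc n) = (\<Sum>j\<le>n. 2 ^ j * (fact n / fact (n - j)) * mom (n - j) * (\<Sum>k\<in>K. t k ^ Suc j * trace_power k (Suc j)))"
proof -
  define c where "c j = 2 ^ j * (fact n / fact (n - j)) * mom (n - j)" for j
  have "mom (Suc n) = expectation (\<lambda>\<omega>. Qt \<omega> * Qt \<omega> ^ n)" by (simp add: mom_def)
  also have "\<dots> = (\<Sum>k\<in>K. t k * (\<integral>x. expectation (\<lambda>\<omega>. (Z k x \<omega>)\<^sup>2 * Qt \<omega> ^ n) \<partial>mu))"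
    by (intro expectation_Qt_mult all_moments_power Qt_all_moments)
  also have "\<dots> = (\<Sum>k\<in>K. \<Sum>j\<le>n. c j * (t k ^ Suc j * trace_power k (Suc j)))"
  proof (rule sum.cong[OF refl])
    fix k assume k: "k \<in> K"
    have "(\<integral>x. expectation (\<lambda>\<omega>. (Z k x \<omega>)\<^sup>2 * Qt \<omega> ^ n) \<partial>mu) = (\<integral>x. (\<Sum>j\<le>n. c j * t k ^ j * contr mu (Suc j) (R k) x x) \<partial>mu)"
    proof (rule Bochner_Integration.integral_cong[OF refl])
      fix x assume x: "x \<in> space mu"
      have "expectation (\<lambda>\<omega>. (Z k x \<omega>)\<^sup>2 * Qt \<omega> ^ n) = A k n x x" by (simp add: A_def power2_eq_square mult.assoc)
      thus "expectation (\<lambda>\<omega>. (Z k x \<omega>)\<^sup>2 * Qt \<omega> ^ n) = (\<Sum>j\<le>n. c j * t k ^ j * contr mu (Suc j) (R k) x x)"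
        using A_eq[OF k x x] by (simp add: c_def)
    qed
    also have "\<dots> = (\<Sum>j\<le>n. c j * t k ^ j * trace_power k (Suc j))"
      unfolding trace_power_def using contr_diag_integrable[OF k] by (subst Bochner_Integration.integral_sum) auto
    finally show "t k * (\<integral>x. expectation (\<lambda>\<omega>. (Z k x \<omega>)\<^sup>2 * Qt \<omega> ^ n) \<partial>mu) = (\<Sum>j\<le>n. c j * (t k ^ Suc j * trace_power k (Suc j)))"
      by (simp add: sum_distrib_left mult_ac)
  qed
  also have "\<dots> = (\<Sum>j\<le>n. c j * (\<Sum>k\<in>K. t k ^ Suc j * trace_power k (Suc j)))"
    unfolding sum_distrib_left by (rule sum.swap)
  finally show ?thesis by (simp add: c_def)
qed

text \<open>Dividing \<open>mom_Suc\<close> by n! turns it into a Cauchy product. The second factor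
  is the logarithmic derivative of the moment series: its coefficient at j is the cumulant of order
  j + 1 divided by j!.\<close>

lemma moment_fps_ode:
  "fps_deriv (moment_fps M Qt) = moment_fps M Qt * Abs_fps (\<lambda>j. complex_of_real (2 ^ j * (\<Sum>k\<in>K. t k ^ Suc j * trace_power k (Suc j))))"
proof (rule fps_ext)
  fix n
  define p where "p j = (\<Sum>k\<in>K. t k ^ Suc j * trace_power k (Suc j))" for j
  have "fps_nth (moment_fps M Qt * Abs_fps (\<lambda>j. complex_of_real (2 ^ j * p j))) n =
     (\<Sum>j=0..n. complex_of_real (2 ^ j * p j) * (of_real (mom (n - j)) / fact (n - j)))"
    by (subst mult.commute, subst fps_mult_nth) (simp add: moment_fps_def mom_def)
  also have "\<dots> = of_real ((\<Sum>j\<le>n. 2 ^ j * (fact n / fact (n - j)) * mom (n - j) * p j) / fact n)"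
    unfolding sum_divide_distrib of_real_sum atLeast0AtMost
    by (intro sum.cong refl) (simp add: of_real_fact)
  also have "\<dots> = of_real (mom (Suc n) / fact n)" unfolding mom_Suc p_def ..
  also have "\<dots> = fps_nth (fps_deriv (moment_fps M Qt)) n"
    by (simp add: moment_fps_def mom_def of_real_fact field_simps del: of_nat_Suc power_Suc)
  finally show "fps_nth (fps_deriv (moment_fps M Qt)) n =
    fps_nth (moment_fps M Qt * Abs_fps (\<lambda>j. complex_of_real (2 ^ j * (\<Sum>k\<in>K. t k ^ Suc j * trace_power k (Suc j))))) n"
    by (simp only: p_def)
qed

end

section \<open>Linear differential equations for formal power series\<close>

lemma (in prob_space) moment_fps_nth_0 [simp]: "fps_nth (moment_fps M U) 0 = 1"
  by (simp add: moment_fps_def prob_space)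

lemma fps_linear_ode_unique:
  fixes F G P :: "complex fps"
  assumes F: "fps_deriv F = F * P" and G: "fps_deriv G = G * P" and eq: "fps_nth F 0 = fps_nth G 0"
  shows "F = G"
proof (rule fps_ext)
  fix n show "fps_nth F n = fps_nth G n"
  proof (induction n rule: less_induct)
    case (less n)
    show ?case
    proof (cases n)
      case 0 thus ?thesis using eq by simp
    next
      case (Suc m)
      have "of_nat (Suc m) * fps_nth F (Suc m) = fps_nth (F * P) m" unfolding F[symmetric] by simp
      also have "\<dots> = fps_nth (G * P) m"
        unfolding fps_mult_nth using less Suc by (intro sum.cong refl) auto
      also have "\<dots> = of_nat (Suc m) * fps_nth G (Suc m)" unfolding G[symmetric] by simp
      finally show ?thesis using Suc by (simp del: of_nat_Suc)
    qed
  qed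
qed

lemma fps_linear_ode_coeffs_unique:
  fixes F P P' :: "complex fps"
  assumes "fps_deriv F = F * P" "fps_deriv F = F * P'" "fps_nth F 0 = 1"
  shows "P = P'"
proof -
  have "F \<noteq> 0" using assms(3) by auto
  thus ?thesis using assms(1,2) by (metis mult_cancel_left)
qed

text \<open>Logarithmic derivatives add up under products; this turns additive cumulants into a
  product of moment series.\<close>

lemma fps_linear_ode_prod:
  fixes F P :: "'i \<Rightarrow> complex fps"
  assumes "finite J" "\<And>j. j \<in> J \<Longrightarrow> fps_deriv (F j) = F j * P j"
  shows "fps_deriv (\<Prod>j\<in>J. F j) = (\<Prod>j\<in>J. F j) * (\<Sum>j\<in>J. P j)"
  using assms by (induction J rule: finite_induct) (auto simp: algebra_simps)

section \<open>Isotypic components of a Volterra process\<close>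

lemma L2R_mult_integrable:
  assumes "f \<in> L2R N" "g \<in> L2R N"
  shows "integrable N (\<lambda>x. f x * g x)"
proof (rule Bochner_Integration.integrable_bound)
  show "integrable N (\<lambda>x. (f x)\<^sup>2 + (g x)\<^sup>2)" "(\<lambda>x. f x * g x) \<in> borel_measurable N"
    using assms unfolding L2R_def by auto
  have "\<bar>f x * g x\<bar> \<le> (f x)\<^sup>2 + (g x)\<^sup>2" for x
  proof -
    have "0 \<le> \<bar>f x\<bar> * \<bar>g x\<bar>" by simp
    moreover have "2 * (\<bar>f x\<bar> * \<bar>g x\<bar>) \<le> (f x)\<^sup>2 + (g x)\<^sup>2"
      using sum_squares_bound[of "\<bar>f x\<bar>" "\<bar>g x\<bar>"] by (simp add: mult.assoc)
    ultimately show ?thesis unfolding abs_mult by linarith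
  qed
  thus "AE x in N. norm (f x * g x) \<le> norm ((f x)\<^sup>2 + (g x)\<^sup>2)" by (intro AE_I2) (simp add: add_nonneg_nonneg)
qed

lemma L2R_add: "f \<in> L2R N \<Longrightarrow> g \<in> L2R N \<Longrightarrow> (\<lambda>x. f x + g x) \<in> L2R N"
  using L2R_mult_integrable[of f N g] unfolding L2R_def by (auto simp: power2_sum mult.assoc)

lemma L2R_cmult: "f \<in> L2R N \<Longrightarrow> (\<lambda>x. a * f x) \<in> L2R N"
  unfolding L2R_def by (auto simp: power_mult_distrib)

lemma L2R_sum: "finite I \<Longrightarrow> (\<And>i. i \<in> I \<Longrightarrow> f i \<in> L2R N) \<Longrightarrow> (\<lambda>x. \<Sum>i\<in>I. f i x) \<in> L2R N"
proof (induction I rule: finite_induct)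
  case (insert i I)
  thus ?case using L2R_add[of "f i" N "\<lambda>x. \<Sum>i\<in>I. f i x"] by simp
qed (simp add: L2R_def)

lemma (in prob_space) centered_normal_cong_AE:
  assumes "centered_normal M V" "U \<in> borel_measurable M" "AE \<omega> in M. U \<omega> = V \<omega>"
  shows "centered_normal M U"
proof -
  have "distr M borel U = distr M borel V"
    using assms by (intro distr_cong_AE) (auto simp: centered_normal_def)
  thus ?thesis using assms unfolding centered_normal_def by simp
qed

lemma (in gauss_space) sum_H:
  "finite I \<Longrightarrow> (\<And>i. i \<in> I \<Longrightarrow> U i \<in> H) \<Longrightarrow> (\<lambda>\<omega>. \<Sum>i\<in>I. a i * U i \<omega>) \<in> H"
proof (induction I rule: finite_induct)
  case (insert i I)
  thus ?case using add_H[OF scale_H[of "U i" "a i"], of "\<lambda>\<omega>. \<Sum>i\<in>I. a i * U i \<omega>"] by simp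
qed (simp add: zero_H)

lemma (in gauss_space) expectation_sum_prod:
  assumes "finite I" "finite J" "\<And>i. i \<in> I \<Longrightarrow> U i \<in> H" "\<And>j. j \<in> J \<Longrightarrow> V j \<in> H"
  shows "expectation (\<lambda>\<omega>. (\<Sum>i\<in>I. a i * U i \<omega>) * (\<Sum>j\<in>J. b j * V j \<omega>)) =
    (\<Sum>i\<in>I. \<Sum>j\<in>J. a i * b j * expectation (\<lambda>\<omega>. U i \<omega> * V j \<omega>))"
proof -
  have "expectation (\<lambda>\<omega>. (\<Sum>i\<in>I. a i * U i \<omega>) * (\<Sum>j\<in>J. b j * V j \<omega>)) =
    expectation (\<lambda>\<omega>. \<Sum>i\<in>I. \<Sum>j\<in>J. a i * b j * (U i \<omega> * V j \<omega>))"
    by (simp add: sum_product mult_ac)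
  also have "\<dots> = (\<Sum>i\<in>I. \<Sum>j\<in>J. a i * b j * expectation (\<lambda>\<omega>. U i \<omega> * V j \<omega>))"
    using assms H_product_integrable by (simp add: Bochner_Integration.integral_sum)
  finally show ?thesis .
qed

locale volterra_action = real_char_group G + prob_space M
  for G :: "('g, 'b) monoid_scheme" (structure) and M :: "'w measure" +
  fixes act :: "'g \<Rightarrow> 'y \<Rightarrow> 'y" and Y :: "'y measure" and tau :: "'t measure"
    and X :: "('t \<Rightarrow> real) \<Rightarrow> 'w \<Rightarrow> real" and Z1 Z2 :: "'y \<Rightarrow> 'w \<Rightarrow> real"
    and \<phi>1 \<phi>2 :: "'y \<Rightarrow> 't \<Rightarrow> real" and \<rho> :: real and mu :: "'y measure"
  assumes action: "measurable_action G Y act"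
    and iso: "isonormal M tau X"
    and volt: "corr_volterra_kernels M tau X Y Z1 Z2 \<rho> \<phi>1 \<phi>2"
    and inv_law: "invariant_law G Y act M Z1 Z2"
    and mu_sets: "sets mu = sets Y"
    and mu_sf: "sigma_finite_measure mu"
    and mu_inv: "invariant_measure G act mu"
    and joint_meas: "U \<in> {Z1, Z2} \<Longrightarrow> (\<lambda>(y, \<omega>). U y \<omega>) \<in> borel_measurable (Y \<Otimes>\<^sub>M M)"
    and L2_paths: "U \<in> {Z1, Z2} \<Longrightarrow> \<omega> \<in> space M \<Longrightarrow> g \<in> carrier G \<Longrightarrow> (\<lambda>y. U (act g y) \<omega>) \<in> L2R mu"
    and energy_fin: "(\<integral>\<^sup>+y. ennreal (cov M Z1 Z1 y y) \<partial>mu) < \<infinity>"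
begin

text \<open>The linear span of the isonormal process, closed under almost sure equality because
  Z_i(y) agrees with X(\<phi>_i(y)) only almost surely. Measurability is demanded since a
  modification on a null set may lose it.\<close>

definition "GH = {U \<in> borel_measurable M. \<exists>I a. finite I \<and> I \<subseteq> L2R tau \<and> (AE \<omega> in M. U \<omega> = (\<Sum>f\<in>I. a f * X f \<omega>))}"

lemma X_meas: "f \<in> L2R tau \<Longrightarrow> X f \<in> borel_measurable M"
  and X_normal: "finite I \<Longrightarrow> I \<subseteq> L2R tau \<Longrightarrow> centered_normal M (\<lambda>\<omega>. \<Sum>f\<in>I. a f * X f \<omega>)"
  and X_cov: "f1 \<in> L2R tau \<Longrightarrow> f2 \<in> L2R tau \<Longrightarrow> expectation (\<lambda>\<omega>. X f1 \<omega> * X f2 \<omega>) = (\<integral>t. f1 t * f2 t \<partial>tau)"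
  using iso unfolding isonormal_def by blast+

lemma GH_I: "U \<in> borel_measurable M \<Longrightarrow> finite I \<Longrightarrow> I \<subseteq> L2R tau \<Longrightarrow> AE \<omega> in M. U \<omega> = (\<Sum>f\<in>I. a f * X f \<omega>) \<Longrightarrow> U \<in> GH"
  unfolding GH_def by blast

lemma GH_D:
  assumes "U \<in> GH"
  obtains I a where "finite I" "I \<subseteq> L2R tau" "AE \<omega> in M. U \<omega> = (\<Sum>f\<in>I. a f * X f \<omega>)" "U \<in> borel_measurable M"
  using assms unfolding GH_def by blast

sublocale GS: gauss_space M GH
proof
  show "centered_normal M U" if U: "U \<in> GH" for U
    using U by (rule GH_D) (metis X_normal centered_normal_cong_AE)
  show "(\<lambda>_. 0) \<in> GH" by (rule GH_I[of _ "{}"]) auto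
  show "(\<lambda>\<omega>. b * U \<omega>) \<in> GH" if U: "U \<in> GH" for U b
  proof -
    from U obtain I a where I: "finite I" "I \<subseteq> L2R tau" "AE \<omega> in M. U \<omega> = (\<Sum>f\<in>I. a f * X f \<omega>)" "U \<in> borel_measurable M"
      by (rule GH_D)
    have "AE \<omega> in M. b * U \<omega> = (\<Sum>f\<in>I. (b * a f) * X f \<omega>)"
      using I(3) by eventually_elim (simp add: sum_distrib_left mult.assoc)
    thus ?thesis using I by (intro GH_I[of _ I "\<lambda>f. b * a f"]) auto
  qed
  show "(\<lambda>\<omega>. U \<omega> + V \<omega>) \<in> GH" if U: "U \<in> GH" and V: "V \<in> GH" for U V
  proof -
    from U obtain I a where I: "finite I" "I \<subseteq> L2R tau" "AE \<omega> in M. U \<omega> = (\<Sum>f\<in>I. a f * X f \<omega>)" "U \<in> borel_measurable M"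
      by (rule GH_D)
    from V obtain J b where J: "finite J" "J \<subseteq> L2R tau" "AE \<omega> in M. V \<omega> = (\<Sum>f\<in>J. b f * X f \<omega>)" "V \<in> borel_measurable M"
      by (rule GH_D)
    define a' where "a' f = (if f \<in> I then a f else 0)" for f
    define b' where "b' f = (if f \<in> J then b f else 0)" for f
    have eI: "(\<Sum>f\<in>I. a f * X f \<omega>) = (\<Sum>f\<in>I \<union> J. a' f * X f \<omega>)" for \<omega>
      using I(1) J(1) by (intro sum.mono_neutral_cong_left) (auto simp: a'_def)
    have eJ: "(\<Sum>f\<in>J. b f * X f \<omega>) = (\<Sum>f\<in>I \<union> J. b' f * X f \<omega>)" for \<omega>
      using I(1) J(1) by (intro sum.mono_neutral_cong_left) (auto simp: b'_def)
    have "AE \<omega> in M. U \<omega> + V \<omega> = (\<Sum>f\<in>I \<union> J. (a' f + b' f) * X f \<omega>)"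
      using I(3) J(3) by eventually_elim (simp add: eI eJ sum.distrib distrib_right)
    thus ?thesis using I J by (intro GH_I[of _ "I \<union> J" "\<lambda>f. a' f + b' f"]) auto
  qed
qed

lemma X_GH: "f \<in> L2R tau \<Longrightarrow> X f \<in> GH"
  by (rule GH_I[of _ "{f}" "\<lambda>_. 1"]) (auto simp: X_meas)

lemma GH_cong: "V \<in> GH \<Longrightarrow> U \<in> borel_measurable M \<Longrightarrow> AE \<omega> in M. U \<omega> = V \<omega> \<Longrightarrow> U \<in> GH"
proof -
  assume V: "V \<in> GH" and U: "U \<in> borel_measurable M" "AE \<omega> in M. U \<omega> = V \<omega>"
  from V obtain I a where I: "finite I" "I \<subseteq> L2R tau" "AE \<omega> in M. V \<omega> = (\<Sum>f\<in>I. a f * X f \<omega>)" by (rule GH_D)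
  have "AE \<omega> in M. U \<omega> = (\<Sum>f\<in>I. a f * X f \<omega>)" using U(2) I(3) by eventually_elim simp
  thus "U \<in> GH" using I U by (intro GH_I) auto
qed

text \<open>Linearity of the isonormal process follows from its covariance: the difference
  \<open>U\<close> of the two sides is uncorrelated with every X(h), hence with itself, and so
  vanishes almost surely.\<close>

lemma X_linear:
  assumes S: "finite S" and f: "\<And>s. s \<in> S \<Longrightarrow> f s \<in> L2R tau"
  shows "AE \<omega> in M. X (\<lambda>t. \<Sum>s\<in>S. w s * f s t) \<omega> = (\<Sum>s\<in>S. w s * X (f s) \<omega>)"
proof -
  define F where "F = (\<lambda>t. \<Sum>s\<in>S. w s * f s t)"
  have F: "F \<in> L2R tau" unfolding F_def by (intro L2R_sum S L2R_cmult f)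
  define U where "U \<omega> = X F \<omega> - (\<Sum>s\<in>S. w s * X (f s) \<omega>)" for \<omega>
  have sum_GH: "(\<lambda>\<omega>. \<Sum>s\<in>S. w s * X (f s) \<omega>) \<in> GH" by (intro GS.sum_H S X_GH f)
  have U: "U \<in> GH"
    using GS.add_H[OF X_GH[OF F] GS.scale_H[OF sum_GH, of "-1"]] by (simp add: U_def[abs_def])
  have UX: "expectation (\<lambda>\<omega>. U \<omega> * X h \<omega>) = 0" if h: "h \<in> L2R tau" for h
  proof -
    have "expectation (\<lambda>\<omega>. U \<omega> * X h \<omega>) = expectation (\<lambda>\<omega>. X F \<omega> * X h \<omega> - (\<Sum>s\<in>S. w s * (X (f s) \<omega> * X h \<omega>)))"
      by (simp add: U_def left_diff_distrib sum_distrib_right mult.assoc)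
    also have "\<dots> = expectation (\<lambda>\<omega>. X F \<omega> * X h \<omega>) - (\<Sum>s\<in>S. w s * expectation (\<lambda>\<omega>. X (f s) \<omega> * X h \<omega>))"
      using GS.H_product_integrable X_GH F h f by (simp add: Bochner_Integration.integral_sum)
    also have "\<dots> = (\<integral>t. F t * h t \<partial>tau) - (\<Sum>s\<in>S. w s * (\<integral>t. f s t * h t \<partial>tau))"
      using X_cov F h f by simp
    also have "(\<Sum>s\<in>S. w s * (\<integral>t. f s t * h t \<partial>tau)) = (\<integral>t. (\<Sum>s\<in>S. w s * (f s t * h t)) \<partial>tau)"
      using L2R_mult_integrable[OF f h] by (simp add: Bochner_Integration.integral_sum)
    also have "\<dots> = (\<integral>t. F t * h t \<partial>tau)" by (simp add: F_def sum_distrib_right mult.assoc)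
    finally show ?thesis by simp
  qed
  have "expectation (\<lambda>\<omega>. U \<omega> * U \<omega>) = expectation (\<lambda>\<omega>. U \<omega> * X F \<omega> - (\<Sum>s\<in>S. w s * (U \<omega> * X (f s) \<omega>)))"
    by (rule arg_cong[of _ _ expectation], rule ext, subst (2) U_def)
       (simp add: right_diff_distrib sum_distrib_left mult_ac)
  also have "\<dots> = expectation (\<lambda>\<omega>. U \<omega> * X F \<omega>) - (\<Sum>s\<in>S. w s * expectation (\<lambda>\<omega>. U \<omega> * X (f s) \<omega>))"
    using GS.H_product_integrable U X_GH F f by (simp add: Bochner_Integration.integral_sum)
  also have "\<dots> = 0" using UX F f by simp
  finally have "AE \<omega> in M. U \<omega> * U \<omega> = 0"
    using integral_nonneg_eq_0_iff_AE[OF GS.H_product_integrable[OF U U]] by simp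
  thus ?thesis by eventually_elim (simp add: U_def F_def)
qed

lemma space_mu: "space mu = space Y" using mu_sets by (rule sets_eq_imp_space_eq)

lemma act_meas: "g \<in> carrier G \<Longrightarrow> act g \<in> Y \<rightarrow>\<^sub>M Y"
  and act_mult: "g \<in> carrier G \<Longrightarrow> h \<in> carrier G \<Longrightarrow> y \<in> space Y \<Longrightarrow> act (g \<otimes> h) y = act g (act h y)"
  and act_one: "y \<in> space Y \<Longrightarrow> act \<one> y = y"
  using action unfolding measurable_action_def by blast+

lemma act_space: "g \<in> carrier G \<Longrightarrow> y \<in> space Y \<Longrightarrow> act g y \<in> space Y"
  using measurable_space[OF act_meas] .

lemma Z_GH: "U \<in> {Z1, Z2} \<Longrightarrow> y \<in> space Y \<Longrightarrow> U y \<in> GH"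
  using volt X_GH GH_cong unfolding corr_volterra_kernels_def by blast

abbreviation "R \<equiv> cov M Z1 Z1"

lemma cov_rel:
  assumes "x \<in> space Y" "y \<in> space Y"
  shows "cov M Z2 Z2 x y = R x y" "cov M Z1 Z2 x y = \<rho> * R x y" "cov M Z2 Z1 x y = \<rho> * R x y"
  using volt assms unfolding corr_volterra_kernels_def by blast+

lemma cov_inv:
  assumes "U \<in> {Z1, Z2}" "V \<in> {Z1, Z2}" "g \<in> carrier G" "x \<in> space Y" "y \<in> space Y"
  shows "cov M U V (act g x) (act g y) = cov M U V x y"
  using inv_law assms unfolding invariant_law_def by blast

abbreviation "cmp \<equiv> iso_comp G act"

lemma iso_comp_eq: "cmp c U y \<omega> = (\<Sum>g\<in>carrier G. idem c g * U (act (inv g) y) \<omega>)"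
  by (simp add: iso_comp_def idem_def chi_def sum_distrib_left mult.assoc)

lemma iso_comp_GH: "U \<in> {Z1, Z2} \<Longrightarrow> y \<in> space Y \<Longrightarrow> cmp c U y \<in> GH"
  unfolding iso_comp_eq[abs_def] by (intro GS.sum_H fin Z_GH act_space) auto

lemma cov_iso_comp:
  assumes U: "U \<in> {Z1, Z2}" and V: "V \<in> {Z1, Z2}" and x: "x \<in> space Y" and y: "y \<in> space Y"
  shows "cov M (cmp c U) (cmp c' V) x y =
    (\<Sum>g1\<in>carrier G. \<Sum>g2\<in>carrier G. idem c g1 * idem c' g2 * cov M U V (act (inv g1) x) (act (inv g2) y))"
  unfolding cov_def iso_comp_eq using U V x y by (intro GS.expectation_sum_prod fin Z_GH act_space) auto

lemma cov_iso_comp_orthogonal: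
  assumes c: "c \<in> dual_classes G" "c' \<in> dual_classes G" "c \<noteq> c'"
    and U: "U \<in> {Z1, Z2}" and V: "V \<in> {Z1, Z2}" and x: "x \<in> space Y" and y: "y \<in> space Y"
  shows "cov M (cmp c U) (cmp c' V) x y = 0"
proof -
  define B where "B a b = cov M U V (act a x) (act b y)" for a b
  have "(\<Sum>g1\<in>carrier G. \<Sum>g2\<in>carrier G. chi c g1 * chi c' g2 * B (inv g1) (inv g2)) = 0"
    by (rule chi_orthogonal_left[OF c])
       (simp add: B_def act_mult x y cov_inv[OF U V] act_space)
  moreover have "cov M (cmp c U) (cmp c' V) x y = real (class_dim c) / real (card (carrier G)) * (real (class_dim c') / real (card (carrier G))) *
     (\<Sum>g1\<in>carrier G. \<Sum>g2\<in>carrier G. chi c g1 * chi c' g2 * B (inv g1) (inv g2))"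
    unfolding cov_iso_comp[OF U V x y] sum_distrib_left by (intro sum.cong refl) (simp add: idem_def B_def)
  ultimately show ?thesis by simp
qed

lemma kernel_comp_eq:
  assumes x: "x \<in> space Y" and y: "y \<in> space Y"
  shows "kernel_comp G act c R x y = cov M (cmp c Z1) (cmp c Z1) x y"
proof -
  have "kernel_comp G act c R x y = (\<Sum>g1\<in>carrier G. \<Sum>g2\<in>carrier G. idem c g1 * idem c g2 * R (act (inv g1) x) (act (inv g2) y))"
    unfolding kernel_comp_def sum_distrib_left
    by (intro sum.cong refl) (simp add: idem_def chi_def power2_eq_square)
  thus ?thesis using cov_iso_comp[of Z1 Z1, OF _ _ x y] by simp
qed

lemma cov_iso_comp_rel:
  assumes x: "x \<in> space Y" and y: "y \<in> space Y"
  shows "cov M (cmp c Z1) (cmp c Z1) x y = kernel_comp G act c R x y"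
    "cov M (cmp c Z2) (cmp c Z2) x y = kernel_comp G act c R x y"
    "cov M (cmp c Z1) (cmp c Z2) x y = \<rho> * kernel_comp G act c R x y"
    "cov M (cmp c Z2) (cmp c Z1) x y = \<rho> * kernel_comp G act c R x y"
  unfolding kernel_comp_eq[OF x y]
  using x y by (auto simp: cov_iso_comp cov_rel act_space sum_distrib_left intro!: sum.cong)

lemma iso_comp_meas:
  assumes U: "U \<in> {Z1, Z2}"
  shows "(\<lambda>(y, \<omega>). cmp c U y \<omega>) \<in> borel_measurable (Y \<Otimes>\<^sub>M M)"
proof -
  have "(\<lambda>p. U (act (inv g) (fst p)) (snd p)) \<in> borel_measurable (Y \<Otimes>\<^sub>M M)" if "g \<in> carrier G" for g
  proof -
    have [measurable]: "act (inv g) \<in> Y \<rightarrow>\<^sub>M Y" using that by (intro act_meas) simp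
    have "(\<lambda>p. (act (inv g) (fst p), snd p)) \<in> Y \<Otimes>\<^sub>M M \<rightarrow>\<^sub>M Y \<Otimes>\<^sub>M M" by measurable
    from measurable_compose[OF this joint_meas[OF U]] show ?thesis by simp
  qed
  thus ?thesis unfolding iso_comp_eq case_prod_beta' by (intro borel_measurable_sum borel_measurable_times) auto
qed

lemma iso_comp_L2: "U \<in> {Z1, Z2} \<Longrightarrow> \<omega> \<in> space M \<Longrightarrow> (\<lambda>y. cmp c U y \<omega>) \<in> L2R mu"
  unfolding iso_comp_eq by (intro L2R_sum fin L2R_cmult L2_paths) auto

lemma cov_meas:
  assumes U: "U \<in> {Z1, Z2}" and a: "a \<in> carrier G" and b: "b \<in> carrier G"
  shows "(\<lambda>y. cov M U U (act a y) (act b y)) \<in> borel_measurable Y"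
  unfolding cov_def
proof (rule borel_measurable_lebesgue_integral)
  have m: "(\<lambda>p. U (act g (fst p)) (snd p)) \<in> borel_measurable (Y \<Otimes>\<^sub>M M)" if "g \<in> carrier G" for g
  proof -
    have [measurable]: "act g \<in> Y \<rightarrow>\<^sub>M Y" using that by (rule act_meas)
    have "(\<lambda>p. (act g (fst p), snd p)) \<in> Y \<Otimes>\<^sub>M M \<rightarrow>\<^sub>M Y \<Otimes>\<^sub>M M" by measurable
    from measurable_compose[OF this joint_meas[OF U]] show ?thesis by simp
  qed
  show "(\<lambda>(y, \<omega>). U (act a y) \<omega> * U (act b y) \<omega>) \<in> borel_measurable (Y \<Otimes>\<^sub>M M)"
    unfolding case_prod_beta' by (intro borel_measurable_times m a b)
qed

lemma R_nonneg: "0 \<le> R y y" by (simp add: cov_def)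

lemma R_diag_integrable: "integrable mu (\<lambda>y. R y y)"
proof (rule integrableI_bounded)
  have "(\<lambda>y. R (act \<one> y) (act \<one> y)) \<in> borel_measurable Y" by (rule cov_meas) auto
  moreover have "(\<lambda>y. R (act \<one> y) (act \<one> y)) \<in> borel_measurable Y \<longleftrightarrow> (\<lambda>y. R y y) \<in> borel_measurable Y"
    by (rule measurable_cong) (simp add: act_one)
  ultimately have "(\<lambda>y. R y y) \<in> borel_measurable Y" by blast
  thus "(\<lambda>y. R y y) \<in> borel_measurable mu" using measurable_cong_sets[OF mu_sets refl] by blast
  show "(\<integral>\<^sup>+y. ennreal (norm (R y y)) \<partial>mu) < \<infinity>" using energy_fin by (simp add: R_nonneg)
qed

text \<open>The component kernel contains mixed terms R(a y, b y); Cauchy-Schwarz and invariance of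
  the law bound each of them by R(y, y).\<close>

lemma kernel_comp_diag_integrable: "integrable mu (\<lambda>y. kernel_comp G act c R y y)"
proof -
  have "integrable mu (\<lambda>y. R (act a y) (act b y))" if ab: "a \<in> carrier G" "b \<in> carrier G" for a b
  proof (rule Bochner_Integration.integrable_bound[OF R_diag_integrable])
    show "(\<lambda>y. R (act a y) (act b y)) \<in> borel_measurable mu"
      using cov_meas[of Z1 a b] ab measurable_cong_sets[OF mu_sets refl] by blast
    show "AE y in mu. norm (R (act a y) (act b y)) \<le> norm (R y y)"
    proof (rule AE_I2)
      fix y assume "y \<in> space mu"
      hence y: "y \<in> space Y" by (simp add: space_mu)
      have "\<bar>R (act a y) (act b y)\<bar> \<le> sqrt (R (act a y) (act a y)) * sqrt (R (act b y) (act b y))"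
        unfolding cov_def
        using integral_mult_le_sqrt[of M "Z1 (act a y)" "Z1 (act b y)"] GS.H_product_integrable[OF Z_GH Z_GH, of Z1 _ Z1] act_space[OF _ y] ab
        by (simp add: power2_eq_square)
      also have "\<dots> = R y y" using ab y R_nonneg[of y] by (simp add: cov_inv)
      finally show "norm (R (act a y) (act b y)) \<le> norm (R y y)" by (simp add: R_nonneg)
    qed
  qed
  thus ?thesis unfolding kernel_comp_def by simp
qed

end

section \<open>Contractions under a change of kernel, and the constants K(n, \<rho>)\<close>

lemma contr_cong:
  assumes "\<And>x y. x \<in> space mu \<Longrightarrow> y \<in> space mu \<Longrightarrow> \<Phi> x y = \<Psi> x y"
  shows "x \<in> space mu \<Longrightarrow> y \<in> space mu \<Longrightarrow> contr mu n \<Phi> x y = contr mu n \<Psi> x y"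
proof (induction n arbitrary: x y)
  case (Suc n)
  show ?case
  proof (cases n)
    case (Suc m)
    have "contr mu n \<Phi> x u * \<Phi> y u = contr mu n \<Psi> x u * \<Psi> y u" if "u \<in> space mu" for u
      using Suc.IH[OF Suc.prems(1) that] assms[OF Suc.prems(2) that] by simp
    hence "(\<integral>u. contr mu n \<Phi> x u * \<Phi> y u \<partial>mu) = (\<integral>u. contr mu n \<Psi> x u * \<Psi> y u \<partial>mu)"
      by (intro Bochner_Integration.integral_cong refl)
    thus ?thesis by (simp add: Suc contr2_def)
  qed (use assms Suc.prems in auto)
qed (use assms in auto)

lemma contr_scale: "contr mu (Suc n) (\<lambda>x y. s * \<Phi> x y) x y = s ^ Suc n * contr mu (Suc n) \<Phi> x y"
proof (induction n arbitrary: x y)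
  case (Suc n)
  show ?case
    unfolding contr.simps(3) contr2_def Suc
    by (simp add: mult_ac flip: Bochner_Integration.integral_mult_right_zero)
qed simp

lemma sum_even_odd_odd: "(\<Sum>k\<le>2 * p + 1. f k) = (\<Sum>j<Suc p. f (2 * j)) + (\<Sum>j<Suc p. f (2 * j + 1 :: nat) :: real)"
  by (induction p) auto

lemma sum_even_odd_even: "(\<Sum>k\<le>2 * p. f k) = (\<Sum>j\<le>p. f (2 * j)) + (\<Sum>j<p. f (2 * j + 1 :: nat) :: real)"
  by (induction p) auto

text \<open>Splitting the binomial expansions by parity, (1 + \<rho>)^(n-1) = S + T and (1 -
  \<rho>)^(n-1) = S - T. The closed form is then 2 S + 2 \<rho> T for even n and 2 \<rho> S + 2 T
  for odd n, which are the defining sums.\<close>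

lemma Kconst_eq:
  assumes n: "n \<ge> 1"
  shows "Kconst n \<rho> = (1 + \<rho>) ^ n + (-1) ^ n * (1 - \<rho>) ^ n"
proof -
  define m where "m = n - 1"
  have nm: "n = Suc m" using n by (simp add: m_def)
  define f where "f s k = real (m choose k) * (s * \<rho>) ^ k" for s :: real and k
  have bin: "(1 + s * \<rho>) ^ m = (\<Sum>k\<le>m. f s k)" for s
    using binomial_ring[of "s * \<rho>" 1 m] by (simp add: f_def add.commute)
  show ?thesis
  proof (cases "even n")
    case True
    then obtain p where p: "m = 2 * p + 1" using nm by (metis even_Suc oddE)
    define S T where "S = (\<Sum>j<Suc p. real (m choose (2 * j)) * \<rho> ^ (2 * j))"
      and "T = (\<Sum>j<Suc p. real (m choose (2 * j + 1)) * \<rho> ^ (2 * j + 1))"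
    have e1: "(1 + \<rho>) ^ m = S + T" using bin[of 1] unfolding p sum_even_odd_odd by (simp only: S_def T_def f_def p mult_1_left)
    have e2: "(1 - \<rho>) ^ m = S - T"
      using bin[of "-1"] unfolding p sum_even_odd_odd
      by (simp add: S_def T_def f_def p sum_negf[symmetric] power_mult_distrib)
    have e3: "Kconst n \<rho> = 2 * S + 2 * (\<rho> * T)"
    proof -
      have "n \<noteq> 1" "n div 2 = Suc p" using nm p by auto
      thus ?thesis using True unfolding Kconst_def S_def T_def sum_distrib_left m_def[symmetric]
        by (simp add: sum_distrib_left mult_ac)
    qed
    show ?thesis unfolding e3 using True by (simp add: nm e1 e2 algebra_simps)
  next
    case False
    then obtain p where p: "m = 2 * p" using nm by (metis even_Suc evenE)
    define S T where "S = (\<Sum>j\<le>p. real (m choose (2 * j)) * \<rho> ^ (2 * j))"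
      and "T = (\<Sum>j<p. real (m choose (2 * j + 1)) * \<rho> ^ (2 * j + 1))"
    have e1: "(1 + \<rho>) ^ m = S + T" using bin[of 1] unfolding p sum_even_odd_even by (simp only: S_def T_def f_def p mult_1_left)
    have e2: "(1 - \<rho>) ^ m = S - T"
      using bin[of "-1"] unfolding p sum_even_odd_even
      by (simp add: S_def T_def f_def p sum_negf[symmetric] power_mult_distrib)
    have e3: "Kconst n \<rho> = 2 * (\<rho> * S) + 2 * T"
    \<comment> \<open>\<open>Kconst\<close> has a clause of its own at n = 1, with the value of the
      formula for odd n.\<close>
    proof (cases "n = 1")
      case True
      hence "p = 0" "m = 0" using nm p by auto
      thus ?thesis using True by (simp add: Kconst_def S_def T_def)
    next
      case n1: False
      have "(n - 1) div 2 = p" using nm p by auto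
      thus ?thesis using False n1 unfolding Kconst_def S_def T_def sum_distrib_left m_def[symmetric]
        by (simp add: sum_distrib_left mult_ac)
    qed
    show ?thesis unfolding e3 using False by (simp add: nm e1 e2 algebra_simps)
  qed
qed

lemma fps_prod_nth_0: "fps_nth (\<Prod>j\<in>J. F j) 0 = (\<Prod>j\<in>J. fps_nth (F j) 0 :: complex)"
  by (induction J rule: infinite_finite_induct) auto

lemma moment_fps_cong: "(\<And>\<omega>. \<omega> \<in> space M \<Longrightarrow> U \<omega> = V \<omega>) \<Longrightarrow> moment_fps M U = moment_fps M V"
  unfolding moment_fps_def by (auto intro!: fps_ext arg_cong[of _ _ of_real] Bochner_Integration.integral_cong)

lemma has_exp_moment_cong:
  assumes V: "has_exp_moment M V" and eq: "\<And>\<omega>. \<omega> \<in> space M \<Longrightarrow> U \<omega> = V \<omega>"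
  shows "has_exp_moment M U"
proof (rule has_exp_moment_mono[OF V])
  show "U \<in> borel_measurable M"
    using V measurable_cong[of M U V borel] eq unfolding has_exp_moment_def by blast
qed (simp add: eq)

text \<open>Pointwise R(x, y)^2 \<le> R(x, x) R(y, y), so the double integral is at most the square
  of \<open>Tr k\<close>.\<close>

lemma (in gauss_quadratic) R_square_finite:
  assumes k: "k \<in> K"
  shows "(\<integral>\<^sup>+x. (\<integral>\<^sup>+y. ennreal ((R k x y)\<^sup>2) \<partial>mu) \<partial>mu) < \<infinity>"
proof -
  have [measurable]: "(\<lambda>y. R k y y) \<in> borel_measurable mu" using R_diag_integrable[OF k] by simp
  have "(\<integral>\<^sup>+x. (\<integral>\<^sup>+y. ennreal ((R k x y)\<^sup>2) \<partial>mu) \<partial>mu) \<le> (\<integral>\<^sup>+x. (\<integral>\<^sup>+y. ennreal (R k x x) * ennreal (R k y y) \<partial>mu) \<partial>mu)"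
  proof (intro nn_integral_mono)
    fix x y assume x: "x \<in> space mu" and y: "y \<in> space mu"
    have "(R k x y)\<^sup>2 \<le> (sqrt (R k x x) * sqrt (R k y y))\<^sup>2"
      using R_bound[OF k x y] by (intro power2_le_iff_abs_le[THEN iffD2]) (auto simp: R_diag_nonneg)
    also have "\<dots> = R k x x * R k y y" by (simp add: power_mult_distrib R_diag_nonneg)
    finally show "ennreal ((R k x y)\<^sup>2) \<le> ennreal (R k x x) * ennreal (R k y y)"
      by (simp add: ennreal_mult[symmetric] R_diag_nonneg ennreal_leI)
  qed
  also have "\<dots> = (\<integral>\<^sup>+y. ennreal (R k y y) \<partial>mu) * (\<integral>\<^sup>+y. ennreal (R k y y) \<partial>mu)"
    by (simp add: nn_integral_cmult nn_integral_multc)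
  also have "(\<integral>\<^sup>+y. ennreal (R k y y) \<partial>mu) = ennreal (Tr k)"
    unfolding Tr_def using R_diag_integrable[OF k] by (intro nn_integral_eq_integral) (auto simp: R_diag_nonneg)
  finally show ?thesis by (rule le_less_trans) (simp add: ennreal_mult_less_top)
qed

section \<open>Laws of the quadratic functionals of the isotypic components\<close>

context volterra_action begin

abbreviation "Rc c \<equiv> kernel_comp G act c R"

definition "Tc c n = (\<integral>y. contr mu n (Rc c) y y \<partial>mu)"

definition "V c \<omega> = (\<integral>y. cmp c Z1 y \<omega> * cmp c Z2 y \<omega> \<partial>mu)"

definition "sg s = (if s then 1 else -1 :: real)"

text \<open>By polarization \<open>V c\<close> is the difference of the squared norms of the uncorrelated processes
  \<open>W (c, True)\<close> and \<open>W (c, False)\<close>.\<close>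

definition "W k y \<omega> = (\<Sum>i\<in>UNIV. (if i then 1 / 2 else sg (snd k) / 2) * cmp (fst k) (if i then Z1 else Z2) y \<omega>)"

lemma W_eq: "W k y \<omega> = (cmp (fst k) Z1 y \<omega> + sg (snd k) * cmp (fst k) Z2 y \<omega>) / 2"
  by (simp add: W_def UNIV_bool algebra_simps add_divide_distrib)

lemma W_cov:
  assumes x: "x \<in> space Y" and y: "y \<in> space Y"
  shows "expectation (\<lambda>\<omega>. W k x \<omega> * W l y \<omega>) = (cov M (cmp (fst k) Z1) (cmp (fst l) Z1) x y
    + sg (snd l) * cov M (cmp (fst k) Z1) (cmp (fst l) Z2) x y + sg (snd k) * cov M (cmp (fst k) Z2) (cmp (fst l) Z1) x y
    + sg (snd k) * sg (snd l) * cov M (cmp (fst k) Z2) (cmp (fst l) Z2) x y) / 4"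
proof -
  have "expectation (\<lambda>\<omega>. W k x \<omega> * W l y \<omega>) = (\<Sum>i\<in>UNIV. \<Sum>j\<in>UNIV. (if i then 1 / 2 else sg (snd k) / 2) * (if j then 1 / 2 else sg (snd l) / 2) *
      expectation (\<lambda>\<omega>. cmp (fst k) (if i then Z1 else Z2) x \<omega> * cmp (fst l) (if j then Z1 else Z2) y \<omega>))"
    unfolding W_def
    by (rule GS.expectation_sum_prod) (use x y in \<open>auto intro!: iso_comp_GH\<close>)
  thus ?thesis by (simp add: UNIV_bool cov_def algebra_simps add_divide_distrib)
qed

text \<open>For different classes all four covariances vanish. Within one class the signs are
  opposite: the equal variances cancel against each other, and so do the equal mixed
  covariances.\<close>

lemma W_cov_diff:
  assumes c: "fst k \<in> dual_classes G" "fst l \<in> dual_classes G" and kl: "k \<noteq> l" and x: "x \<in> space Y" and y: "y \<in> space Y"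
  shows "expectation (\<lambda>\<omega>. W k x \<omega> * W l y \<omega>) = 0"
proof (cases "fst k = fst l")
  case True
  hence "snd k \<noteq> snd l" using kl by (simp add: prod_eq_iff)
  thus ?thesis unfolding W_cov[OF x y] True cov_iso_comp_rel[OF x y] by (auto simp: sg_def)
next
  case False
  thus ?thesis unfolding W_cov[OF x y] by (simp add: cov_iso_comp_orthogonal[OF c _ _ _ x y])
qed

lemma W_cov_same:
  assumes x: "x \<in> space Y" and y: "y \<in> space Y"
  shows "expectation (\<lambda>\<omega>. W k x \<omega> * W k y \<omega>) = (1 + sg (snd k) * \<rho>) / 2 * Rc (fst k) x y"
  unfolding W_cov[OF x y] cov_iso_comp_rel[OF x y] by (auto simp: sg_def field_simps)

lemma W_quadratic:
  assumes J: "finite J" "J \<subseteq> dual_classes G"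
  shows "gauss_quadratic M GH mu (J \<times> UNIV) W"
proof
  show "finite (J \<times> (UNIV :: bool set))" using J by simp
  fix k assume "k \<in> J \<times> (UNIV :: bool set)"
  hence k: "fst k \<in> dual_classes G" using J by auto
  show "W k y \<in> GH" if "y \<in> space mu" for y
    unfolding W_def[abs_def] using that by (intro GS.sum_H iso_comp_GH) (auto simp: space_mu)
  have m1: "(\<lambda>p. cmp (fst k) Z1 (fst p) (snd p)) \<in> borel_measurable (Y \<Otimes>\<^sub>M M)"
    and m2: "(\<lambda>p. cmp (fst k) Z2 (fst p) (snd p)) \<in> borel_measurable (Y \<Otimes>\<^sub>M M)"
    using iso_comp_meas[of Z1] iso_comp_meas[of Z2] by (simp_all add: case_prod_beta')
  have "(\<lambda>(y, \<omega>). W k y \<omega>) \<in> borel_measurable (Y \<Otimes>\<^sub>M M)"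
    unfolding W_eq case_prod_beta' using m1 m2 by measurable
  thus "(\<lambda>(y, \<omega>). W k y \<omega>) \<in> borel_measurable (mu \<Otimes>\<^sub>M M)"
    using measurable_cong_sets[OF sets_pair_measure_cong[OF mu_sets refl] refl] by blast
  show "integrable mu (\<lambda>y. (W k y \<omega>)\<^sup>2)" if w: "\<omega> \<in> space M" for \<omega>
  proof -
    have "(\<lambda>y. W k y \<omega>) \<in> L2R mu"
      unfolding W_def using w by (intro L2R_sum L2R_cmult iso_comp_L2) auto
    thus ?thesis by (simp add: L2R_def)
  qed
  have "integrable mu (\<lambda>y. (1 + sg (snd k) * \<rho>) / 2 * Rc (fst k) y y)"
    using kernel_comp_diag_integrable by simp
  thus "integrable mu (\<lambda>y. expectation (\<lambda>\<omega>. W k y \<omega> * W k y \<omega>))"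
    by (subst Bochner_Integration.integrable_cong[OF refl]) (auto simp: W_cov_same space_mu)
  fix l x y assume "l \<in> J \<times> (UNIV :: bool set)" "k \<noteq> l" "x \<in> space mu" "y \<in> space mu"
  thus "expectation (\<lambda>\<omega>. W k x \<omega> * W l y \<omega>) = 0"
    using k J by (intro W_cov_diff) (auto simp: space_mu)
qed (use mu_sf in \<open>auto simp: sigma_finite_measure_def\<close>)

lemma V_polarize:
  assumes w: "\<omega> \<in> space M"
  shows "V c \<omega> = (\<integral>y. (W (c, True) y \<omega>)\<^sup>2 \<partial>mu) - (\<integral>y. (W (c, False) y \<omega>)\<^sup>2 \<partial>mu)"
proof -
  have "integrable mu (\<lambda>y. (W (c, s) y \<omega>)\<^sup>2)" for s
  proof -
    have "(\<lambda>y. W (c, s) y \<omega>) \<in> L2R mu"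
      unfolding W_def using w by (intro L2R_sum L2R_cmult iso_comp_L2) auto
    thus ?thesis by (simp add: L2R_def)
  qed
  hence "(\<integral>y. (W (c, True) y \<omega>)\<^sup>2 \<partial>mu) - (\<integral>y. (W (c, False) y \<omega>)\<^sup>2 \<partial>mu) = (\<integral>y. (W (c, True) y \<omega>)\<^sup>2 - (W (c, False) y \<omega>)\<^sup>2 \<partial>mu)"
    by simp
  also have "\<dots> = V c \<omega>" unfolding V_def
    by (intro Bochner_Integration.integral_cong refl) (simp add: W_eq sg_def power2_eq_square field_simps)
  finally show ?thesis by simp
qed

text \<open>Coefficient j is the cumulant of order j + 1 of \<open>V c\<close> divided by j!. The
  1/2 is what remains of 2^j against the factor 2^(-j-1) of the polarized covariances.\<close>

definition "cumulant_fps c = Abs_fps (\<lambda>j. complex_of_real (Kconst (Suc j) \<rho> / 2 * Tc c (Suc j)))"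

text \<open>A linear combination of the \<open>V c\<close> is one weighted sum of squared norms,
  with weight +t or -t on the two polarized parts of each class, so one differential equation covers
  all classes at once.\<close>

lemma V_sum:
  assumes J: "finite J" "J \<subseteq> dual_classes G"
  shows "has_exp_moment M (\<lambda>\<omega>. \<Sum>c\<in>J. t c * V c \<omega>)"
    and "fps_deriv (moment_fps M (\<lambda>\<omega>. \<Sum>c\<in>J. t c * V c \<omega>)) = moment_fps M (\<lambda>\<omega>. \<Sum>c\<in>J. t c * V c \<omega>) *
      (\<Sum>c\<in>J. Abs_fps (\<lambda>j. of_real (t c) ^ Suc j * fps_nth (cumulant_fps c) j))"
proof -
  interpret q: gauss_quadratic M GH mu "J \<times> UNIV" "\<lambda>k. sg (snd k) * t (fst k)" W by (rule W_quadratic[OF J])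
  have Qt: "(\<Sum>c\<in>J. t c * V c \<omega>) = q.Qt \<omega>" if w: "\<omega> \<in> space M" for \<omega>
    unfolding q.Qt_def q.Q_def sum.cartesian_product'
    by (intro sum.cong refl) (simp add: V_polarize[OF w] UNIV_bool sg_def algebra_simps)
  show "has_exp_moment M (\<lambda>\<omega>. \<Sum>c\<in>J. t c * V c \<omega>)"
    by (rule has_exp_moment_cong[OF q.Qt_exp_moment Qt])
  have tp: "q.trace_power k (Suc j) = ((1 + sg (snd k) * \<rho>) / 2) ^ Suc j * Tc (fst k) (Suc j)" for k j
  proof -
    have "contr mu (Suc j) (q.R k) y y = ((1 + sg (snd k) * \<rho>) / 2) ^ Suc j * contr mu (Suc j) (Rc (fst k)) y y" if y: "y \<in> space mu" for y
    proof -
      have "contr mu (Suc j) (q.R k) y y = contr mu (Suc j) (\<lambda>x y. (1 + sg (snd k) * \<rho>) / 2 * Rc (fst k) x y) y y"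
        by (rule contr_cong[OF _ y y]) (auto simp: q.R_def W_cov_same space_mu)
      thus ?thesis unfolding contr_scale .
    qed
    hence "q.trace_power k (Suc j) = (\<integral>y. ((1 + sg (snd k) * \<rho>) / 2) ^ Suc j * contr mu (Suc j) (Rc (fst k)) y y \<partial>mu)"
      unfolding q.trace_power_def by (rule Bochner_Integration.integral_cong[OF refl])
    also have "\<dots> = ((1 + sg (snd k) * \<rho>) / 2) ^ Suc j * Tc (fst k) (Suc j)"
      unfolding Tc_def by (rule integral_mult_right_zero)
    finally show ?thesis .
  qed
  \<comment> \<open>The two signs contribute (1 + \<rho>)^(j+1) and (-1)^(j+1) (1 - \<rho>)^(j+1),
    whose sum is the closed form of \<open>Kconst\<close>.\<close>
  have P: "2 ^ j * (\<Sum>k\<in>J \<times> UNIV. (sg (snd k) * t (fst k)) ^ Suc j * q.trace_power k (Suc j)) =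
     (\<Sum>c\<in>J. t c ^ Suc j * (Kconst (Suc j) \<rho> / 2 * Tc c (Suc j)))" for j
  proof -
    have "2 ^ j * (\<Sum>k\<in>J \<times> UNIV. (sg (snd k) * t (fst k)) ^ Suc j * q.trace_power k (Suc j)) =
       (\<Sum>c\<in>J. \<Sum>s\<in>UNIV. 2 ^ j * ((sg s * t c) ^ Suc j * (((1 + sg s * \<rho>) / 2) ^ Suc j * Tc c (Suc j))))"
      unfolding tp sum_distrib_left sum.cartesian_product' by simp
    also have "\<dots> = (\<Sum>c\<in>J. t c ^ Suc j * (Kconst (Suc j) \<rho> / 2 * Tc c (Suc j)))"
    proof (rule sum.cong[OF refl])
      fix c
      have "2 ^ j * ((a * t c) ^ Suc j * ((b / 2) ^ Suc j * Tc c (Suc j))) = t c ^ Suc j * (a ^ Suc j * b ^ Suc j / 2 * Tc c (Suc j))" for a b :: real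
        by (simp add: power_mult_distrib power_divide)
      thus "(\<Sum>s\<in>UNIV. 2 ^ j * ((sg s * t c) ^ Suc j * (((1 + sg s * \<rho>) / 2) ^ Suc j * Tc c (Suc j)))) =
        t c ^ Suc j * (Kconst (Suc j) \<rho> / 2 * Tc c (Suc j))"
        by (simp only: Kconst_eq[of "Suc j"] UNIV_bool) (simp add: sg_def algebra_simps add_divide_distrib)
    qed
    finally show ?thesis .
  qed
  have "moment_fps M (\<lambda>\<omega>. \<Sum>c\<in>J. t c * V c \<omega>) = moment_fps M q.Qt" by (rule moment_fps_cong[OF Qt])
  moreover have "Abs_fps (\<lambda>j. complex_of_real (2 ^ j * (\<Sum>k\<in>J \<times> UNIV. (sg (snd k) * t (fst k)) ^ Suc j * q.trace_power k (Suc j)))) =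
     (\<Sum>c\<in>J. Abs_fps (\<lambda>j. of_real (t c) ^ Suc j * fps_nth (cumulant_fps c) j))"
    unfolding P by (rule fps_ext) (simp add: fps_sum_nth cumulant_fps_def)
  ultimately show "fps_deriv (moment_fps M (\<lambda>\<omega>. \<Sum>c\<in>J. t c * V c \<omega>)) = moment_fps M (\<lambda>\<omega>. \<Sum>c\<in>J. t c * V c \<omega>) *
      (\<Sum>c\<in>J. Abs_fps (\<lambda>j. of_real (t c) ^ Suc j * fps_nth (cumulant_fps c) j))"
    using q.moment_fps_ode by simp
qed

lemma V_single:
  assumes c: "c \<in> dual_classes G"
  shows "has_exp_moment M (V c)"
    and "fps_deriv (moment_fps M (\<lambda>\<omega>. s * V c \<omega>)) = moment_fps M (\<lambda>\<omega>. s * V c \<omega>) * Abs_fps (\<lambda>j. of_real s ^ Suc j * fps_nth (cumulant_fps c) j)"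
    and "fps_deriv (moment_fps M (V c)) = moment_fps M (V c) * cumulant_fps c"
proof -
  show "has_exp_moment M (V c)" using V_sum(1)[of "{c}" "\<lambda>_. 1"] c by simp
  show *: "fps_deriv (moment_fps M (\<lambda>\<omega>. s * V c \<omega>)) = moment_fps M (\<lambda>\<omega>. s * V c \<omega>) * Abs_fps (\<lambda>j. of_real s ^ Suc j * fps_nth (cumulant_fps c) j)" for s
    using V_sum(2)[of "{c}" "\<lambda>_. s"] c by simp
  show "fps_deriv (moment_fps M (V c)) = moment_fps M (V c) * cumulant_fps c"
    using *[of 1] by (simp add: fps_nth_inverse)
qed

lemma V_indep: "indep_vars (\<lambda>_. borel) V (dual_classes G)"
proof (rule indep_vars_of_moment_fps[OF finite_dual_classes V_single(1)])
  fix t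
  show "moment_fps M (\<lambda>\<omega>. \<Sum>j\<in>dual_classes G. t j * V j \<omega>) = (\<Prod>j\<in>dual_classes G. moment_fps M (\<lambda>\<omega>. t j * V j \<omega>))"
    by (rule fps_linear_ode_unique[OF V_sum(2)[OF finite_dual_classes order_refl]
          fps_linear_ode_prod[OF finite_dual_classes V_single(2)]])
       (simp_all add: fps_prod_nth_0)
qed

lemma law_eq_iff:
  assumes c: "c \<in> dual_classes G" and s: "s \<in> dual_classes G"
  shows "distr M borel (V c) = distr M borel (V s) \<longleftrightarrow>
    (\<forall>n\<ge>1. Kconst n \<rho> * Tc c n = Kconst n \<rho> * Tc s n)"
proof
  assume "distr M borel (V c) = distr M borel (V s)"
  hence "moment_fps M (V c) = moment_fps M (V s)"
    using V_single(1)[OF c] V_single(1)[OF s] by (intro moment_fps_distr_cong) (auto simp: has_exp_moment_def)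
  hence "cumulant_fps c = cumulant_fps s"
    using fps_linear_ode_coeffs_unique[OF V_single(3)[OF c]] V_single(3)[OF s] by simp
  hence eq: "fps_nth (cumulant_fps c) j = fps_nth (cumulant_fps s) j" for j by simp
  show "\<forall>n\<ge>1. Kconst n \<rho> * Tc c n = Kconst n \<rho> * Tc s n"
  proof (intro allI impI)
    fix n :: nat assume "n \<ge> 1"
    then obtain j where "n = Suc j" by (cases n) auto
    thus "Kconst n \<rho> * Tc c n = Kconst n \<rho> * Tc s n"
      using eq[of j] by (simp add: cumulant_fps_def del: of_real_mult of_real_divide)
  qed
next
  assume *: "\<forall>n\<ge>1. Kconst n \<rho> * Tc c n = Kconst n \<rho> * Tc s n"
  have "cumulant_fps c = cumulant_fps s"
  proof (rule fps_ext)
    fix j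
    have "Kconst (Suc j) \<rho> * Tc c (Suc j) = Kconst (Suc j) \<rho> * Tc s (Suc j)" using * by simp
    thus "fps_nth (cumulant_fps c) j = fps_nth (cumulant_fps s) j"
      by (simp add: cumulant_fps_def del: of_real_mult of_real_divide)
  qed
  hence "moment_fps M (V c) = moment_fps M (V s)"
    using fps_linear_ode_unique[OF V_single(3)[OF c]] V_single(3)[OF s] by simp
  thus "distr M borel (V c) = distr M borel (V s)"
    by (rule distr_eq_of_moment_fps[OF prob_space_axioms prob_space_axioms V_single(1)[OF c] V_single(1)[OF s]])
qed

section \<open>Decomposition of the process and additivity of the traces\<close>

lemma iso_comp_sum: "y \<in> space Y \<Longrightarrow> (\<Sum>c\<in>dual_classes G. cmp c U y \<omega>) = U y \<omega>"
proof -
  assume y: "y \<in> space Y"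
  have "(\<Sum>c\<in>dual_classes G. cmp c U y \<omega>) = (\<Sum>g\<in>carrier G. (\<Sum>c\<in>dual_classes G. idem c g) * U (act (inv g) y) \<omega>)"
    unfolding iso_comp_eq sum_distrib_right by (rule sum.swap)
  also have "\<dots> = (\<Sum>g\<in>carrier G. if g = \<one> then U (act (inv g) y) \<omega> else 0)"
    by (intro sum.cong refl) (simp add: sum_idem)
  also have "\<dots> = U y \<omega>" using fin y by (simp add: act_one)
  finally show ?thesis .
qed

text \<open>Here the form is a path integral over \<open>mu\<close>. Since k acts on
  \<open>y\<close> before a and b do, invariance of the measure yields invariance under right
  translation, in contrast to the left invariance of covariances.\<close>

lemma iso_comp_orthogonal_path:
  assumes c: "c \<in> dual_classes G" "c' \<in> dual_classes G" "c \<noteq> c'" and U: "U \<in> {Z1, Z2}" and w: "\<omega> \<in> space M"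
  shows "(\<integral>y. cmp c U y \<omega> * cmp c' U y \<omega> \<partial>mu) = 0"
proof -
  define B where "B a b = (\<integral>y. U (act a y) \<omega> * U (act b y) \<omega> \<partial>mu)" for a b
  have int: "integrable mu (\<lambda>y. U (act a y) \<omega> * U (act b y) \<omega>)" if "a \<in> carrier G" "b \<in> carrier G" for a b
    using that by (intro L2R_mult_integrable L2_paths U w)
  have "(\<integral>y. cmp c U y \<omega> * cmp c' U y \<omega> \<partial>mu) =
    (\<integral>y. (\<Sum>g1\<in>carrier G. \<Sum>g2\<in>carrier G. idem c g1 * idem c' g2 * (U (act (inv g1) y) \<omega> * U (act (inv g2) y) \<omega>)) \<partial>mu)"
    unfolding iso_comp_eq sum_product by (intro Bochner_Integration.integral_cong sum.cong refl) (simp add: mult_ac)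
  also have "\<dots> = (\<Sum>g1\<in>carrier G. \<Sum>g2\<in>carrier G. idem c g1 * idem c' g2 * B (inv g1) (inv g2))"
    using int by (simp add: B_def Bochner_Integration.integral_sum)
  also have "\<dots> = real (class_dim c) / real (card (carrier G)) * (real (class_dim c') / real (card (carrier G))) *
     (\<Sum>g1\<in>carrier G. \<Sum>g2\<in>carrier G. chi c g1 * chi c' g2 * B (inv g1) (inv g2))"
    unfolding sum_distrib_left by (intro sum.cong refl) (simp add: idem_def)
  also have "(\<Sum>g1\<in>carrier G. \<Sum>g2\<in>carrier G. chi c g1 * chi c' g2 * B (inv g1) (inv g2)) = 0"
  proof (rule chi_orthogonal_right[OF c])
    fix k a b assume g: "k \<in> carrier G" "a \<in> carrier G" "b \<in> carrier G"
    have "B (a \<otimes> k) (b \<otimes> k) = (\<integral>y. U (act a (act k y)) \<omega> * U (act b (act k y)) \<omega> \<partial>mu)"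
      unfolding B_def using g by (intro Bochner_Integration.integral_cong refl) (simp add: act_mult space_mu)
    also have "\<dots> = B a b"
      using mu_inv g int[OF g(2,3)] unfolding invariant_measure_def B_def by simp
    finally show "B (a \<otimes> k) (b \<otimes> k) = B a b" .
  qed
  finally show ?thesis by simp
qed

lemma meas_mu: "(\<lambda>(y, \<omega>). U y \<omega>) \<in> borel_measurable (Y \<Otimes>\<^sub>M M) \<Longrightarrow> (\<lambda>(y, \<omega>). U y \<omega>) \<in> borel_measurable (mu \<Otimes>\<^sub>M M)"
  for U :: "'y \<Rightarrow> 'w \<Rightarrow> real"
  using measurable_cong_sets[OF sets_pair_measure_cong[OF mu_sets refl] refl] by blast

lemma iso_comp_quadratic: "gauss_quadratic M GH mu (dual_classes G) (\<lambda>c. cmp c Z1)"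
proof
  fix c assume c: "c \<in> dual_classes G"
  show "cmp c Z1 y \<in> GH" if "y \<in> space mu" for y using that by (intro iso_comp_GH) (auto simp: space_mu)
  show "(\<lambda>(y, \<omega>). cmp c Z1 y \<omega>) \<in> borel_measurable (mu \<Otimes>\<^sub>M M)" by (intro meas_mu iso_comp_meas) auto
  show "integrable mu (\<lambda>y. (cmp c Z1 y \<omega>)\<^sup>2)" if "\<omega> \<in> space M" for \<omega>
    using iso_comp_L2[of Z1 \<omega> c] that by (simp add: L2R_def)
  show "integrable mu (\<lambda>y. expectation (\<lambda>\<omega>. cmp c Z1 y \<omega> * cmp c Z1 y \<omega>))"
    using kernel_comp_diag_integrable[of c]
    by (subst Bochner_Integration.integrable_cong[OF refl, where g = "\<lambda>y. Rc c y y"]) (auto simp: kernel_comp_eq cov_def space_mu)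
  show "expectation (\<lambda>\<omega>. cmp c Z1 x \<omega> * cmp l Z1 y \<omega>) = 0"
    if "l \<in> dual_classes G" "c \<noteq> l" "x \<in> space mu" "y \<in> space mu" for l x y
    using cov_iso_comp_orthogonal[OF c that(1,2), of Z1 Z1 x y] that by (simp add: cov_def space_mu)
qed (use mu_sf finite_dual_classes in \<open>auto simp: sigma_finite_measure_def\<close>)

lemma Z1_L2:
  assumes w: "\<omega> \<in> space M"
  shows "(\<lambda>y. Z1 y \<omega>) \<in> L2R mu"
proof -
  have "(\<lambda>y. Z1 (act \<one> y) \<omega>) \<in> L2R mu" using w by (intro L2_paths) auto
  moreover have "(\<lambda>y. Z1 y \<omega>) \<in> borel_measurable mu \<longleftrightarrow> (\<lambda>y. Z1 (act \<one> y) \<omega>) \<in> borel_measurable mu"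
    by (rule measurable_cong) (simp add: act_one space_mu)
  moreover have "integrable mu (\<lambda>y. (Z1 y \<omega>)\<^sup>2) \<longleftrightarrow> integrable mu (\<lambda>y. (Z1 (act \<one> y) \<omega>)\<^sup>2)"
    by (rule Bochner_Integration.integrable_cong) (simp_all add: act_one space_mu)
  ultimately show ?thesis unfolding L2R_def by blast
qed

lemma Z1_quadratic: "gauss_quadratic M GH mu {()} (\<lambda>_. Z1)"
proof
  show "Z1 y \<in> GH" if "y \<in> space mu" for y using that by (intro Z_GH) (auto simp: space_mu)
  show "(\<lambda>(y, \<omega>). Z1 y \<omega>) \<in> borel_measurable (mu \<Otimes>\<^sub>M M)" by (intro meas_mu joint_meas) auto
  show "integrable mu (\<lambda>y. (Z1 y \<omega>)\<^sup>2)" if "\<omega> \<in> space M" for \<omega> using Z1_L2[OF that] by (simp add: L2R_def)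
  show "integrable mu (\<lambda>y. expectation (\<lambda>\<omega>. Z1 y \<omega> * Z1 y \<omega>))" using R_diag_integrable by (simp add: cov_def)
qed (use mu_sf in \<open>auto simp: sigma_finite_measure_def\<close>)

text \<open>Additivity of the power traces is read off from \<open>\<integral> Z\<^sup>2 d\<mu> = \<Sum>\<^sub>c \<integral> (Z\<^sup>c)\<^sup>2 d\<mu>\<close>, both sides of
  which have the same cumulant series.\<close>

lemma trace_sum: "(\<Sum>c\<in>dual_classes G. Tc c (Suc j)) = (\<integral>y. contr mu (Suc j) R y y \<partial>mu)"
proof -
  interpret q: gauss_quadratic M GH mu "dual_classes G" "\<lambda>_. 1" "\<lambda>c. cmp c Z1" by (rule iso_comp_quadratic)
  interpret q1: gauss_quadratic M GH mu "{()}" "\<lambda>_. 1" "\<lambda>_. Z1" by (rule Z1_quadratic)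
  have "q1.Qt \<omega> = q.Qt \<omega>" if w: "\<omega> \<in> space M" for \<omega>
  proof -
    have i: "integrable mu (\<lambda>y. cmp c Z1 y \<omega> * cmp c' Z1 y \<omega>)" for c c'
      using w by (intro L2R_mult_integrable iso_comp_L2) auto
    have "q1.Qt \<omega> = (\<integral>y. (Z1 y \<omega>)\<^sup>2 \<partial>mu)" by (simp add: q1.Qt_def q1.Q_def)
    \<comment> \<open>Expanding the square of the sum of components; pathwise orthogonality then
      removes the mixed terms.\<close>
    also have "\<dots> = (\<integral>y. (\<Sum>c\<in>dual_classes G. \<Sum>c'\<in>dual_classes G. cmp c Z1 y \<omega> * cmp c' Z1 y \<omega>) \<partial>mu)"
      by (intro Bochner_Integration.integral_cong refl)
         (simp only: sum_product[symmetric] space_mu iso_comp_sum power2_eq_square)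
    also have "\<dots> = (\<Sum>c\<in>dual_classes G. \<Sum>c'\<in>dual_classes G. (\<integral>y. cmp c Z1 y \<omega> * cmp c' Z1 y \<omega> \<partial>mu))"
      using i by (simp add: Bochner_Integration.integral_sum)
    also have "\<dots> = (\<Sum>c\<in>dual_classes G. \<Sum>c'\<in>dual_classes G. if c' = c then (\<integral>y. (cmp c Z1 y \<omega>)\<^sup>2 \<partial>mu) else 0)"
    proof (intro sum.cong refl)
      fix c c' assume c: "c \<in> dual_classes G" "c' \<in> dual_classes G"
      show "(\<integral>y. cmp c Z1 y \<omega> * cmp c' Z1 y \<omega> \<partial>mu) = (if c' = c then (\<integral>y. (cmp c Z1 y \<omega>)\<^sup>2 \<partial>mu) else 0)"
        using iso_comp_orthogonal_path[OF c _ _ w, of Z1] by (simp add: power2_eq_square)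
    qed
    also have "\<dots> = q.Qt \<omega>" unfolding q.Qt_def q.Q_def using finite_dual_classes by simp
    finally show ?thesis .
  qed
  hence eq: "moment_fps M q1.Qt = moment_fps M q.Qt" by (rule moment_fps_cong)
  have "Abs_fps (\<lambda>j. complex_of_real (2 ^ j * (\<Sum>k\<in>{()}. 1 ^ Suc j * q1.trace_power k (Suc j)))) =
    Abs_fps (\<lambda>j. complex_of_real (2 ^ j * (\<Sum>k\<in>dual_classes G. 1 ^ Suc j * q.trace_power k (Suc j))))"
    by (rule fps_linear_ode_coeffs_unique[OF q1.moment_fps_ode q.moment_fps_ode[folded eq] moment_fps_nth_0])
  hence "fps_nth (Abs_fps (\<lambda>j. complex_of_real (2 ^ j * (\<Sum>k\<in>{()}. 1 ^ Suc j * q1.trace_power k (Suc j))))) j =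
    fps_nth (Abs_fps (\<lambda>j. complex_of_real (2 ^ j * (\<Sum>k\<in>dual_classes G. 1 ^ Suc j * q.trace_power k (Suc j))))) j" by (rule arg_cong)
  hence "q1.trace_power () (Suc j) = (\<Sum>k\<in>dual_classes G. q.trace_power k (Suc j))"
    unfolding fps_nth_Abs_fps of_real_eq_iff by simp
  moreover have "q1.trace_power () (Suc j) = (\<integral>y. contr mu (Suc j) R y y \<partial>mu)"
  proof -
    have "q1.R () = R" by (intro ext) (simp add: q1.R_def cov_def)
    thus ?thesis by (simp add: q1.trace_power_def)
  qed
  moreover have "q.trace_power c (Suc j) = Tc c (Suc j)" for c
    unfolding q.trace_power_def Tc_def
    by (rule Bochner_Integration.integral_cong[OF refl], rule contr_cong) (auto simp: q.R_def kernel_comp_eq cov_def space_mu)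
  ultimately show ?thesis by simp
qed

lemma R_square: "(\<integral>\<^sup>+x. (\<integral>\<^sup>+y. ennreal ((R x y)\<^sup>2) \<partial>mu) \<partial>mu) < \<infinity>"
proof -
  interpret q1: gauss_quadratic M GH mu "{()}" "\<lambda>_. 1" "\<lambda>_. Z1" by (rule Z1_quadratic)
  have "q1.R () = R" by (intro ext) (simp add: q1.R_def cov_def)
  thus ?thesis using q1.R_square_finite[of "()"] by simp
qed

lemma Rc_square:
  assumes c: "c \<in> dual_classes G"
  shows "(\<integral>\<^sup>+x. (\<integral>\<^sup>+y. ennreal ((Rc c x y)\<^sup>2) \<partial>mu) \<partial>mu) < \<infinity>"
proof -
  interpret q: gauss_quadratic M GH mu "dual_classes G" "\<lambda>_. 1" "\<lambda>c. cmp c Z1" by (rule iso_comp_quadratic)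
  have "(\<integral>\<^sup>+x. (\<integral>\<^sup>+y. ennreal ((Rc c x y)\<^sup>2) \<partial>mu) \<partial>mu) = (\<integral>\<^sup>+x. (\<integral>\<^sup>+y. ennreal ((q.R c x y)\<^sup>2) \<partial>mu) \<partial>mu)"
    by (intro nn_integral_cong) (simp add: q.R_def kernel_comp_eq cov_def space_mu)
  thus ?thesis using q.R_square_finite[OF c] by simp
qed

text \<open>The kernel of a component is the component of the kernel: \<open>iso_comp\<close> is
  applied to \<open>\<phi>\<close> with the points of \<open>tau\<close> in the place of outcomes,
  and almost sure linearity of \<open>X\<close> passes the finite group sum through.\<close>

lemma iso_comp_kernel:
  assumes \<phi>: "(\<lambda>(y, t). \<phi> y t) \<in> borel_measurable (Y \<Otimes>\<^sub>M tau)" "\<And>y. y \<in> space Y \<Longrightarrow> \<phi> y \<in> L2R tau"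
    and U: "\<And>y. y \<in> space Y \<Longrightarrow> AE \<omega> in M. U y \<omega> = X (\<phi> y) \<omega>"
  shows "(\<lambda>(y, t). cmp c \<phi> y t) \<in> borel_measurable (Y \<Otimes>\<^sub>M tau)"
    and "y \<in> space Y \<Longrightarrow> cmp c \<phi> y \<in> L2R tau"
    and "y \<in> space Y \<Longrightarrow> AE \<omega> in M. cmp c U y \<omega> = X (cmp c \<phi> y) \<omega>"
proof -
  have eq: "cmp c \<psi> y \<omega> = (\<Sum>g\<in>carrier G. idem c g * \<psi> (act (inv g) y) \<omega>)" for \<psi> :: "'y \<Rightarrow> 'z \<Rightarrow> real" and y \<omega>
    by (simp add: iso_comp_def idem_def chi_def sum_distrib_left mult.assoc)
  have m: "(\<lambda>p. \<phi> (act (inv g) (fst p)) (snd p)) \<in> borel_measurable (Y \<Otimes>\<^sub>M tau)" if "g \<in> carrier G" for g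
  proof -
    have [measurable]: "act (inv g) \<in> Y \<rightarrow>\<^sub>M Y" using that by (intro act_meas) simp
    have "(\<lambda>p. (act (inv g) (fst p), snd p)) \<in> Y \<Otimes>\<^sub>M tau \<rightarrow>\<^sub>M Y \<Otimes>\<^sub>M tau" by measurable
    from measurable_compose[OF this \<phi>(1)] show ?thesis by simp
  qed
  show "(\<lambda>(y, t). cmp c \<phi> y t) \<in> borel_measurable (Y \<Otimes>\<^sub>M tau)"
    unfolding eq case_prod_beta' by (intro borel_measurable_sum borel_measurable_times m) auto
  assume y: "y \<in> space Y"
  have L2: "\<phi> (act (inv g) y) \<in> L2R tau" if "g \<in> carrier G" for g using that y by (intro \<phi>(2) act_space) auto
  have eq': "cmp c \<phi> y = (\<lambda>t. \<Sum>g\<in>carrier G. idem c g * \<phi> (act (inv g) y) t)" by (rule ext) (rule eq)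
  show "cmp c \<phi> y \<in> L2R tau" unfolding eq' by (intro L2R_sum fin L2R_cmult L2)
  have "AE \<omega> in M. \<forall>g\<in>carrier G. U (act (inv g) y) \<omega> = X (\<phi> (act (inv g) y)) \<omega>"
    using y by (intro AE_finite_allI fin U act_space) auto
  moreover have "AE \<omega> in M. X (cmp c \<phi> y) \<omega> = (\<Sum>g\<in>carrier G. idem c g * X (\<phi> (act (inv g) y)) \<omega>)"
    unfolding eq' by (rule X_linear[OF fin L2])
  ultimately show "AE \<omega> in M. cmp c U y \<omega> = X (cmp c \<phi> y) \<omega>"
    by eventually_elim (simp add: eq)
qed

lemma iso_comp_volterra: "corr_volterra M tau X Y (cmp c Z1) (cmp c Z2) \<rho>"
proof -
  have v: "(\<lambda>(y, t). \<phi>1 y t) \<in> borel_measurable (Y \<Otimes>\<^sub>M tau)" "(\<lambda>(y, t). \<phi>2 y t) \<in> borel_measurable (Y \<Otimes>\<^sub>M tau)"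
    "\<And>y. y \<in> space Y \<Longrightarrow> \<phi>1 y \<in> L2R tau" "\<And>y. y \<in> space Y \<Longrightarrow> \<phi>2 y \<in> L2R tau"
    "\<And>y. y \<in> space Y \<Longrightarrow> AE \<omega> in M. Z1 y \<omega> = X (\<phi>1 y) \<omega>" "\<And>y. y \<in> space Y \<Longrightarrow> AE \<omega> in M. Z2 y \<omega> = X (\<phi>2 y) \<omega>"
    using volt unfolding corr_volterra_kernels_def by blast+
  note k1 = iso_comp_kernel[OF v(1,3,5)] and k2 = iso_comp_kernel[OF v(2,4,6)]
  have "corr_volterra_kernels M tau X Y (cmp c Z1) (cmp c Z2) \<rho> (cmp c \<phi>1) (cmp c \<phi>2)"
    unfolding corr_volterra_kernels_def
  proof (intro conjI ballI)
    fix y assume y: "y \<in> space Y"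
    show "cmp c Z1 y \<in> borel_measurable M" "cmp c Z2 y \<in> borel_measurable M"
      using y by (auto intro!: GS.H_measurable iso_comp_GH)
    fix x assume x: "x \<in> space Y"
    show "cov M (cmp c Z2) (cmp c Z2) y x = cov M (cmp c Z1) (cmp c Z1) y x"
      "cov M (cmp c Z1) (cmp c Z2) y x = \<rho> * cov M (cmp c Z1) (cmp c Z1) y x"
      "cov M (cmp c Z2) (cmp c Z1) y x = \<rho> * cov M (cmp c Z1) (cmp c Z1) y x"
      by (simp_all add: cov_iso_comp_rel[OF y x])
  qed (use k1 k2 in auto)
  thus ?thesis unfolding corr_volterra_def by blast
qed

text \<open>Summing the common value over all classes gives |dual| times it on one side and, by
  \<open>trace_sum\<close>, the trace of \<open>R\<close> on the other. \<open>Kconst\<close> stays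
  as a factor since it can vanish, as for \<rho> = 0 and odd n.\<close>

lemma trace_average:
  assumes pair: "\<And>c s n. c \<in> dual_classes G \<Longrightarrow> s \<in> dual_classes G \<Longrightarrow> n \<ge> 1 \<Longrightarrow> Kconst n \<rho> * Tc c n = Kconst n \<rho> * Tc s n"
    and c: "c \<in> dual_classes G" and n: "n \<ge> 1"
  shows "Kconst n \<rho> * Tc c n = Kconst n \<rho> / real (card (dual_classes G)) * (\<integral>y. contr mu n R y y \<partial>mu)"
proof -
  obtain j where j: "n = Suc j" using n by (cases n) auto
  have "Kconst n \<rho> * (\<integral>y. contr mu n R y y \<partial>mu) = (\<Sum>s\<in>dual_classes G. Kconst n \<rho> * Tc s n)"
    unfolding j trace_sum[symmetric] by (rule sum_distrib_left)
  also have "\<dots> = real (card (dual_classes G)) * (Kconst n \<rho> * Tc c n)"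
  proof -
    have "(\<Sum>s\<in>dual_classes G. Kconst n \<rho> * Tc s n) = (\<Sum>s\<in>dual_classes G. Kconst n \<rho> * Tc c n)"
      by (rule sum.cong[OF refl]) (rule pair[OF _ c n])
    thus ?thesis by simp
  qed
  finally have *: "Kconst n \<rho> * (\<integral>y. contr mu n R y y \<partial>mu) = real (card (dual_classes G)) * (Kconst n \<rho> * Tc c n)" .
  moreover have "card (dual_classes G) \<noteq> 0" using c finite_dual_classes by auto
  ultimately show ?thesis by (simp only: times_divide_eq_left *) simp
qed

end

theorem theorem8:
  fixes G :: "('g, 'b) monoid_scheme"
    and act :: "'g \<Rightarrow> 'y \<Rightarrow> 'y"
    and Y :: "'y measure"
    and M :: "'w measure"
    and tau :: "'t measure"
    and X :: "('t \<Rightarrow> real) \<Rightarrow> 'w \<Rightarrow> real"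
    and Z1 Z2 :: "'y \<Rightarrow> 'w \<Rightarrow> real"
    and \<phi>1 \<phi>2 :: "'y \<Rightarrow> 't \<Rightarrow> real"
    and \<rho> :: real
    and mu :: "'y measure"
  defines "R \<equiv> cov M Z1 Z1"
  assumes grp: "group G" and fin: "finite (carrier G)"
    and action: "measurable_action G Y act"
    and real_chars: "\<forall>(d, \<pi>)\<in>irreps G. \<forall>g\<in>carrier G. Im (mtrace (\<pi> g)) = 0"
    and prob: "prob_space M"
    and tau_sf: "sigma_finite_measure tau" and tau_na: "nonatomic tau"
    and iso: "isonormal M tau X"
    and rho: "0 \<le> \<rho>" "\<rho> \<le> 1"
    and volt: "corr_volterra_kernels M tau X Y Z1 Z2 \<rho> \<phi>1 \<phi>2"
    and inv_law: "invariant_law G Y act M Z1 Z2"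
    and mu_sets: "sets mu = sets Y"
    and mu_sf: "sigma_finite_measure mu"
    and mu_inv: "invariant_measure G act mu"
    and joint_meas: "(\<lambda>(y, \<omega>). Z1 y \<omega>) \<in> borel_measurable (Y \<Otimes>\<^sub>M M)"
                    "(\<lambda>(y, \<omega>). Z2 y \<omega>) \<in> borel_measurable (Y \<Otimes>\<^sub>M M)"
    and L2_paths: "\<forall>Z\<in>{Z1, Z2}. \<forall>\<omega>\<in>space M. \<forall>g\<in>carrier G.
          (\<lambda>y. Z (act g y) \<omega>) \<in> borel_measurable mu \<and> integrable mu (\<lambda>y. (Z (act g y) \<omega>)\<^sup>2)"
    and L2_paths_G: "\<forall>Z\<in>{Z1, Z2}. \<forall>\<omega>\<in>space M.
          (\<lambda>(g, y). Z (act g y) \<omega>) \<in> borel_measurable (count_space (carrier G) \<Otimes>\<^sub>M mu)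
          \<and> integrable (count_space (carrier G) \<Otimes>\<^sub>M mu) (\<lambda>(g, y). (Z (act g y) \<omega>)\<^sup>2)"
    and energy1: "(\<integral>\<^sup>+\<omega>. (\<integral>\<^sup>+y. ennreal ((Z1 y \<omega>)\<^sup>2) \<partial>mu) \<partial>M)
                 = (\<integral>\<^sup>+y. (\<integral>\<^sup>+t. ennreal ((\<phi>1 y t)\<^sup>2) \<partial>tau) \<partial>mu)"
    and energy2: "(\<integral>\<^sup>+y. (\<integral>\<^sup>+t. ennreal ((\<phi>1 y t)\<^sup>2) \<partial>tau) \<partial>mu)
                 = (\<integral>\<^sup>+y. ennreal (R y y) \<partial>mu)"
    and energy_fin: "(\<integral>\<^sup>+y. ennreal (R y y) \<partial>mu) < \<infinity>"
  shows
    "((\<integral>\<^sup>+x. (\<integral>\<^sup>+y. ennreal ((R x y)\<^sup>2) \<partial>mu) \<partial>mu) < \<infinity>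
      \<and> (\<forall>c\<in>dual_classes G.
           (\<integral>\<^sup>+x. (\<integral>\<^sup>+y. ennreal ((kernel_comp G act c R x y)\<^sup>2) \<partial>mu) \<partial>mu) < \<infinity>))
     \<and> prob_space.indep_vars M (\<lambda>_. borel)
         (\<lambda>c \<omega>. \<integral>y. iso_comp G act c Z1 y \<omega> * iso_comp G act c Z2 y \<omega> \<partial>mu) (dual_classes G)
     \<and> (\<forall>c\<in>dual_classes G. corr_volterra M tau X Y (iso_comp G act c Z1) (iso_comp G act c Z2) \<rho>)
     \<and> (let V = (\<lambda>c \<omega>. \<integral>y. iso_comp G act c Z1 y \<omega> * iso_comp G act c Z2 y \<omega> \<partial>mu);
            Rc = (\<lambda>c. kernel_comp G act c R);
            law_eq = (\<forall>c\<in>dual_classes G. \<forall>s\<in>dual_classes G.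
                        distr M borel (V c) = distr M borel (V s));
            eq_avg = (\<forall>c\<in>dual_classes G. \<forall>n\<ge>1.
                        Kconst n \<rho> * (\<integral>y. contr mu n (Rc c) y y \<partial>mu)
                        = Kconst n \<rho> / real (card (dual_classes G)) * (\<integral>y. contr mu n R y y \<partial>mu));
            eq_pair = (\<forall>c\<in>dual_classes G. \<forall>s\<in>dual_classes G. \<forall>n\<ge>1.
                        Kconst n \<rho> * (\<integral>y. contr mu n (Rc c) y y \<partial>mu)
                        = Kconst n \<rho> * (\<integral>y. contr mu n (Rc s) y y \<partial>mu))
        in (law_eq \<longleftrightarrow> eq_avg) \<and> (eq_avg \<longleftrightarrow> eq_pair))"
proof -
  interpret volterra_action G M act Y tau X Z1 Z2 \<phi>1 \<phi>2 \<rho> mu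
  proof (intro volterra_action.intro real_char_group.intro finite_group.intro finite_group_axioms.intro
      real_char_group_axioms.intro volterra_action_axioms.intro)
    show "(\<integral>\<^sup>+y. ennreal (cov M Z1 Z1 y y) \<partial>mu) < \<infinity>" using energy_fin by (simp add: R_def)
    show "(\<lambda>(y, \<omega>). U y \<omega>) \<in> borel_measurable (Y \<Otimes>\<^sub>M M)" if "U \<in> {Z1, Z2}" for U
      using that joint_meas by auto
    show "(\<lambda>y. U (act g y) \<omega>) \<in> L2R mu" if "U \<in> {Z1, Z2}" "\<omega> \<in> space M" "g \<in> carrier G" for U \<omega> g
      using that L2_paths unfolding L2R_def by blast
  qed (fact grp fin real_chars prob action iso volt inv_law mu_sets mu_sf mu_inv)+
  have V: "(\<lambda>c \<omega>. \<integral>y. iso_comp G act c Z1 y \<omega> * iso_comp G act c Z2 y \<omega> \<partial>mu) = V"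
    by (intro ext) (simp add: V_def)
  have "(\<forall>c\<in>dual_classes G. \<forall>s\<in>dual_classes G. distr M borel (V c) = distr M borel (V s)) \<longleftrightarrow>
      (\<forall>c\<in>dual_classes G. \<forall>s\<in>dual_classes G. \<forall>n\<ge>1. Kconst n \<rho> * Tc c n = Kconst n \<rho> * Tc s n)"
    by (intro ball_cong refl law_eq_iff)
  moreover have "(\<forall>c\<in>dual_classes G. \<forall>n\<ge>1. Kconst n \<rho> * Tc c n =
        Kconst n \<rho> / real (card (dual_classes G)) * (\<integral>y. contr mu n R y y \<partial>mu)) \<longleftrightarrow>
      (\<forall>c\<in>dual_classes G. \<forall>s\<in>dual_classes G. \<forall>n\<ge>1. Kconst n \<rho> * Tc c n = Kconst n \<rho> * Tc s n)" (is "?avg \<longleftrightarrow> ?pair")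
  proof
    assume ?avg thus ?pair by simp
  next
    assume ?pair thus ?avg unfolding R_def by (intro ballI allI impI trace_average) blast+
  qed
  ultimately show ?thesis
    unfolding Let_def V using R_square Rc_square V_indep iso_comp_volterra
    by (simp only: Tc_def R_def) blast
qed

end
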